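(* Let $f(q)=\log\|q\|$ for $q\in\mathbb{H}^n$ (with $f(0)=-\infty$). Then $f\in\mathcal{QPSH}(\mathbb{H}^n)$ and $$(\partial\partial_Jf)^n=\frac{n!}{2\|q\|^{2n}}\,\Omega_n$$ as measures on $\mathbb{H}^n$.
   Context: Coordinates: $\mathbb{H}^n$ is a right $\mathbb{H}$-module with coordinates $q_0,\dots,q_{n-1}$, $q_i=x_{4i}+x_{4i+1}\mathfrak{i}+x_{4i+2}\mathfrak{j}+x_{4i+3}\mathfrak{k}=z_{2i}+\mathfrak{j}z_{2i+1}$, so that $z_j=x_{2j}+(-1)^jx_{2j+1}\mathfrak{i}$, $j=0,\dots,2n-1$; this identifies $\mathbb{H}^n$ with $\mathbb{C}^{2n}$ and $\mathbb{R}^{4n}$. $\|\cdot\|$ is the Euclidean norm. An upper semicontinuous $u:\Omega\to[-\infty,\infty)$ on a domain $\Omega\subset\mathbb{H}^n$ is quaternionic plurisubharmonic (qpsh), $u\in\mathcal{QPSH}(\Omega)$, if its restriction to every affine right quaternionic line $\{a+b\lambda:\lambda\in\mathbb{H}\}$ ($b\neq0$) intersected with $\Omega$ is subharmonic on an open subset of $\mathbb{R}^4$. Quaternionic Monge-Ampère operator: put $\Omega_n=dz_0\wedge dz_1\wedge\dots\wedge dz_{2n-1}$. For smooth real $u$, $\partial_J u=\sum_{i=0}^{2n-1}(-1)^{i+1}(\partial_{\overline{z_{i+(-1)^i}}}u)\,dz_i$, and $(\partial\partial_J u)^n$ is the $n$-th exterior power of the $(2,0)$-form $\partial(\partial_J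 u)$; it equals $F\,\Omega_n$ for a real function $F$, and $F\,\Omega_n$ is identified with the measure $F\,d\mathcal{L}^{4n}$ ($\mathcal{L}^{4n}$ Lebesgue measure). For a qpsh function $u$ that is locally bounded outside a compact set (such as $f$), $(\partial\partial_Ju)^n$ is the non-negative Borel measure which is the weak limit of $(\partial\partial_Ju_j)^n$ for any sequence of smooth qpsh functions $u_j$ decreasing to $u$; it is a known fact that the limit exists and is independent of the sequence. *)

theory Defs
  imports "HOL-Analysis.Analysis"
begin

section \<open>Quaternions and quaternionic space\<close>

text \<open>
  Quaternions are represented by \<open>real^4\<close>: the components of \<open>x\<^sub>0 + x\<^sub>1 i + x\<^sub>2 j + x\<^sub>3 k\<close> have the
  indices 0, 1, 2, 3 of the index type \<open>4\<close> (in which \<open>0 = 4\<close>).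
  The space \<open>(real^4)^'n\<close> has the Euclidean norm of \<open>\<real>\<^sup>4\<^sup>n\<close> as its norm and
  Lebesgue measure as its \<open>lborel\<close>, where \<open>n = CARD('n)\<close>.
\<close>

type_synonym quat = "real^4"

definition quat :: "real \<Rightarrow> real \<Rightarrow> real \<Rightarrow> real \<Rightarrow> quat" where
  "quat a b c d = (\<chi> l. if l = 0 then a else if l = 1 then b else if l = 2 then c else d)"

definition qmult :: "quat \<Rightarrow> quat \<Rightarrow> quat"  (infixl "\<odot>" 70) where
  "p \<odot> q = quat
     (p$0 * q$0 - p$1 * q$1 - p$2 * q$2 - p$3 * q$3)
     (p$0 * q$1 + p$1 * q$0 + p$2 * q$3 - p$3 * q$2)
     (p$0 * q$2 - p$1 * q$3 + p$2 * q$0 + p$3 * q$1)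
     (p$0 * q$3 + p$1 * q$2 - p$2 * q$1 + p$3 * q$0)"

definition right_scale :: "quat^'n \<Rightarrow> quat \<Rightarrow> quat^'n" where
  "right_scale b l = (\<chi> i. b$i \<odot> l)"

lemma quat_nth [simp]:
  "quat a b c d $ 0 = a" "quat a b c d $ 1 = b" "quat a b c d $ 2 = c" "quat a b c d $ 3 = d"
  by (simp_all add: quat_def)


section \<open>Differentiability\<close>

definition dir_deriv :: "'a::real_normed_vector \<Rightarrow> ('a \<Rightarrow> 'b::real_normed_vector) \<Rightarrow> 'a \<Rightarrow> 'b" where
  "dir_deriv v f x = frechet_derivative f (at x) v"

text \<open>Of class \<open>C\<^sup>k\<close> on an open set \<open>S\<close>.\<close>

primrec Ck_on :: "nat \<Rightarrow> 'a::euclidean_space set \<Rightarrow> ('a \<Rightarrow> 'b::real_normed_vector) \<Rightarrow> bool" where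
  "Ck_on 0 S f \<longleftrightarrow> continuous_on S f"
| "Ck_on (Suc k) S f \<longleftrightarrow>
     (\<forall>x\<in>S. f differentiable (at x)) \<and> (\<forall>b\<in>Basis. Ck_on k S (dir_deriv b f))"

definition smooth_on :: "'a::euclidean_space set \<Rightarrow> ('a \<Rightarrow> 'b::real_normed_vector) \<Rightarrow> bool" where
  "smooth_on S f \<longleftrightarrow> (\<forall>k. Ck_on k S f)"


section \<open>Subharmonic and quaternionic plurisubharmonic functions\<close>

definition harmonic_on :: "'a::euclidean_space set \<Rightarrow> ('a \<Rightarrow> real) \<Rightarrow> bool" where
  "harmonic_on G h \<longleftrightarrow> Ck_on 2 G h \<and> (\<forall>x\<in>G. (\<Sum>b\<in>Basis. dir_deriv b (dir_deriv b h) x) = 0)"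

text \<open>Upper semicontinuous with values in \<open>[-\<infinity>,\<infinity>)\<close>.\<close>

definition usc_on :: "'a::topological_space set \<Rightarrow> ('a \<Rightarrow> ereal) \<Rightarrow> bool" where
  "usc_on S u \<longleftrightarrow> (\<forall>x\<in>S. u x < \<infinity>) \<and> (\<forall>c. openin (top_of_set S) {x\<in>S. u x < c})"

text \<open>
  Subharmonicity in the sense of F. Riesz, by harmonic majorants on relatively compact open
  subsets.  The function that is identically \<open>-\<infinity>\<close> counts as subharmonic, as is
  needed when functions are restricted to lines.
\<close>

definition subharmonic_on :: "'a::euclidean_space set \<Rightarrow> ('a \<Rightarrow> ereal) \<Rightarrow> bool" where
  "subharmonic_on U u \<longleftrightarrow> open U \<and> usc_on U u \<and>
     (\<forall>G h. open G \<and> compact (closure G) \<and> closure G \<subseteq> U \<and>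
        continuous_on (closure G) h \<and> harmonic_on G h \<and>
        (\<forall>x\<in>frontier G. u x \<le> ereal (h x)) \<longrightarrow> (\<forall>x\<in>G. u x \<le> ereal (h x)))"

definition qpsh_on :: "(quat^'n) set \<Rightarrow> (quat^'n \<Rightarrow> ereal) \<Rightarrow> bool" where
  "qpsh_on \<Omega> u \<longleftrightarrow> open \<Omega> \<and> connected \<Omega> \<and> usc_on \<Omega> u \<and>
     (\<forall>a b. b \<noteq> 0 \<longrightarrow>
        subharmonic_on {l. a + right_scale b l \<in> \<Omega>} (\<lambda>l. u (a + right_scale b l)))"


section \<open>Forms of type (p,0)\<close>

text \<open>
  The exterior algebra over \<open>\<complex>\<close> with generators \<open>dz\<^sub>0, dz\<^sub>1, \<dots>\<close>: an element is given by its
  coefficients \<open>A S\<close> with respect to the monomials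
  \<open>dz\<^sub>S = dz\<^sub>s\<^sub>1 \<and> \<dots> \<and> dz\<^sub>s\<^sub>p\<close>, where \<open>S = {s\<^sub>1 < \<dots> < s\<^sub>p}\<close>.  The sign in the exterior product is
  that of the shuffle that sorts \<open>dz\<^sub>T \<and> dz\<^sub>R\<close> (here \<open>R = S - T\<close>).
\<close>

type_synonym ext = "nat set \<Rightarrow> complex"

definition ext_one :: ext where
  "ext_one S = (if S = {} then 1 else 0)"

definition dz :: "nat \<Rightarrow> ext" where
  "dz i S = (if S = {i} then 1 else 0)"

definition wedge :: "ext \<Rightarrow> ext \<Rightarrow> ext"  (infixr "\<and>\<and>" 70) where
  "(A \<and>\<and> B) S = (\<Sum>T\<in>Pow S. (-1) ^ card {(i,j). i \<in> T \<and> j \<in> S - T \<and> j < i} * A T * B (S - T))"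

definition wedge_power :: "ext \<Rightarrow> nat \<Rightarrow> ext" where
  "wedge_power A n = ((\<and>\<and>) A ^^ n) ext_one"

text \<open>The form \<open>\<Omega>\<^sub>n = dz\<^sub>0 \<and> \<dots> \<and> dz\<^bsub>2n-1\<^esub>\<close>.\<close>

definition vol_form :: "nat \<Rightarrow> ext" where
  "vol_form n = foldr (\<and>\<and>) (map dz [0..<2*n]) ext_one"

lemma wedge_dz_monomial:
  assumes "finite R" and "\<And>r. r \<in> R \<Longrightarrow> i < r"
  shows "dz i \<and>\<and> (\<lambda>S. if S = R then 1 else 0) = (\<lambda>S. if S = insert i R then 1 else 0)"
proof
  fix S :: "nat set"
  define f where "f T = (-1) ^ card {(k,j). k \<in> T \<and> j \<in> S - T \<and> j < k} * dz i T *
    (if S - T = R then 1 else (0::complex))" for T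
  have iR: "i \<notin> R" using assms(2) by blast
  have "(dz i \<and>\<and> (\<lambda>S. if S = R then 1 else 0)) S = (\<Sum>T\<in>Pow S. f T)"
    by (simp add: wedge_def f_def)
  also have "\<dots> = (if S = insert i R then 1 else 0)"
  proof (cases "finite S")
    case True
    have "(\<Sum>T\<in>Pow S. f T) = (\<Sum>T\<in>Pow S. if T = {i} then f {i} else 0)"
      by (intro sum.cong refl) (auto simp: f_def dz_def)
    also have "\<dots> = (if i \<in> S then f {i} else 0)"
      using True by simp
    also have "\<dots> = (if S = insert i R then 1 else 0)"
    proof (cases "S = insert i R")
      case eq: True
      have "{(k,j). k \<in> {i} \<and> j \<in> S - {i} \<and> j < k} = {}"
        using assms(2) eq by fastforce
      moreover have "S - {i} = R" using eq iR by auto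
      ultimately show ?thesis using eq by (simp only: f_def dz_def) simp
    next
      case False
      then have "i \<in> S \<Longrightarrow> S - {i} \<noteq> R" by auto
      with False show ?thesis by (simp add: f_def)
    qed
    finally show ?thesis .
  next
    case False
    then show ?thesis using assms(1) by auto
  qed
  finally show "(dz i \<and>\<and> (\<lambda>S. if S = R then 1 else 0)) S = (if S = insert i R then 1 else 0)" .
qed

lemma vol_form_eq: "vol_form n = (\<lambda>S. if S = {..<2*n} then 1 else 0)"
proof -
  have "foldr (\<and>\<and>) (map dz [m..<m+k]) ext_one = (\<lambda>S. if S = {m..<m+k} then 1 else 0)" for m k
  proof (induction k arbitrary: m)
    case 0
    then show ?case by (simp add: ext_one_def fun_eq_iff)
  next
    case (Suc k)
    have "foldr (\<and>\<and>) (map dz [m..<m+Suc k]) ext_one =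
        dz m \<and>\<and> foldr (\<and>\<and>) (map dz [Suc m..<Suc m+k]) ext_one"
      by (simp add: upt_rec)
    also have "\<dots> = (\<lambda>S. if S = insert m {Suc m..<Suc m+k} then 1 else 0)"
      unfolding Suc by (rule wedge_dz_monomial) auto
    also have "insert m {Suc m..<Suc m+k} = {m..<m+Suc k}" by auto
    finally show ?case .
  qed
  from this[of 0 "2*n"] show ?thesis
    by (simp add: vol_form_def atLeast0LessThan)
qed


section \<open>The quaternionic Monge-Ampere operator\<close>

text \<open>
  The coordinates \<open>q\<^sub>0, \<dots>, q\<^bsub>n-1\<^esub>\<close> of a point \<open>q\<close> are \<open>q $ e 0, \<dots>, q $ e (n-1)\<close>, where \<open>e\<close>
  enumerates the index type, i.e. \<open>bij_betw e {..<CARD('n)} UNIV\<close>.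
  The vector \<open>x_vec e m\<close> is the unit vector in the direction of the real coordinate \<open>x\<^sub>m\<close>.
\<close>

definition x_coord :: "(nat \<Rightarrow> 'n) \<Rightarrow> nat \<Rightarrow> quat^'n \<Rightarrow> real" where
  "x_coord e m q = q $ e (m div 4) $ of_nat (m mod 4)"

definition z_coord :: "(nat \<Rightarrow> 'n) \<Rightarrow> nat \<Rightarrow> quat^'n \<Rightarrow> complex" where
  "z_coord e j q = Complex (x_coord e (2*j) q) ((-1) ^ j * x_coord e (2*j+1) q)"

lemma quat_eq_z_coords:
  "q $ e i = quat (Re (z_coord e (2*i) q)) (Im (z_coord e (2*i) q)) 0 0 +
     quat 0 0 1 0 \<odot> quat (Re (z_coord e (2*i+1) q)) (Im (z_coord e (2*i+1) q)) 0 0"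
proof -
  have "2 * (2*i) div 4 = i" "2 * (2*i) mod 4 = 0" "(2 * (2*i) + 1) div 4 = i"
    "(2 * (2*i) + 1) mod 4 = 1" "2 * (2*i+1) div 4 = i" "2 * (2*i+1) mod 4 = 2"
    "(2 * (2*i+1) + 1) div 4 = i" "(2 * (2*i+1) + 1) mod 4 = 3"
    by presburger+
  moreover have "v $ 4 = v $ 0" for v :: quat
    by (rule arg_cong[where f = "($) v"]) simp
  ultimately show ?thesis
    unfolding z_coord_def x_coord_def vec_eq_iff forall_4 by (simp add: qmult_def)
qed

definition x_vec :: "(nat \<Rightarrow> 'n) \<Rightarrow> nat \<Rightarrow> quat^'n" where
  "x_vec e m = axis (e (m div 4)) (axis (of_nat (m mod 4)) 1)"

text \<open>The Wirtinger derivatives belonging to \<open>z_coord e j\<close>; note the sign \<open>(-1) ^ j\<close>.\<close>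

definition d_z :: "(nat \<Rightarrow> 'n) \<Rightarrow> nat \<Rightarrow> (quat^'n \<Rightarrow> complex) \<Rightarrow> quat^'n \<Rightarrow> complex" where
  "d_z e j g q =
     (dir_deriv (x_vec e (2*j)) g q - (-1) ^ j * \<i> * dir_deriv (x_vec e (2*j+1)) g q) / 2"

definition d_zbar :: "(nat \<Rightarrow> 'n) \<Rightarrow> nat \<Rightarrow> (quat^'n \<Rightarrow> complex) \<Rightarrow> quat^'n \<Rightarrow> complex" where
  "d_zbar e j g q =
     (dir_deriv (x_vec e (2*j)) g q + (-1) ^ j * \<i> * dir_deriv (x_vec e (2*j+1)) g q) / 2"

definition del :: "(nat \<Rightarrow> 'n) \<Rightarrow> (quat^'n \<Rightarrow> ext) \<Rightarrow> quat^'n \<Rightarrow> ext" where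
  "del e A q S = (\<Sum>i<2 * CARD('n). (dz i \<and>\<and> (\<lambda>T. d_z e i (\<lambda>p. A p T) q)) S)"

text \<open>The index \<open>i + (-1)\<^sup>i\<close> is \<open>i + 1\<close> for even and \<open>i - 1\<close> for odd \<open>i\<close>.\<close>

definition del_J :: "(nat \<Rightarrow> 'n) \<Rightarrow> (quat^'n \<Rightarrow> real) \<Rightarrow> quat^'n \<Rightarrow> ext" where
  "del_J e u q S = (\<Sum>i<2 * CARD('n). (-1) ^ (i + 1) *
     d_zbar e (if even i then i + 1 else i - 1) (\<lambda>p. complex_of_real (u p)) q * dz i S)"

text \<open>
  For smooth \<open>u\<close> the form \<open>(\<partial>\<partial>\<^sub>J u)\<^sup>n\<close> equals \<open>F \<Omega>\<^sub>n\<close> with a real function \<open>F\<close>; its value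
  is the coefficient at \<open>{..<2n}\<close> (see \<open>vol_form_eq\<close>), and \<open>Re\<close> only changes the type.  The form
  \<open>F \<Omega>\<^sub>n\<close> is identified with \<open>F d\<L>\<close>, Lebesgue measure carrying no further constant.
\<close>

definition MA_form :: "(nat \<Rightarrow> 'n) \<Rightarrow> (quat^'n \<Rightarrow> real) \<Rightarrow> quat^'n \<Rightarrow> ext" where
  "MA_form e u q = wedge_power (del e (del_J e u) q) CARD('n)"

definition MA_smooth :: "(nat \<Rightarrow> 'n) \<Rightarrow> (quat^'n \<Rightarrow> real) \<Rightarrow> quat^'n \<Rightarrow> real" where
  "MA_smooth e u q = Re (MA_form e u q {..<2 * CARD('n)})"

definition locally_bounded_on :: "'a::topological_space set \<Rightarrow> ('a \<Rightarrow> ereal) \<Rightarrow> bool" where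
  "locally_bounded_on S u \<longleftrightarrow>
     (\<forall>x\<in>S. \<exists>V M. open V \<and> x \<in> V \<and> (\<forall>y\<in>V \<inter> S. \<bar>u y\<bar> \<le> ereal M))"

definition smooth_qpsh_approx ::
    "(quat^'n) set \<Rightarrow> (quat^'n \<Rightarrow> ereal) \<Rightarrow> (nat \<Rightarrow> quat^'n \<Rightarrow> real) \<Rightarrow> bool" where
  "smooth_qpsh_approx \<Omega> u U \<longleftrightarrow>
     (\<forall>j. smooth_on \<Omega> (U j) \<and> qpsh_on \<Omega> (\<lambda>q. ereal (U j q))) \<and>
     (\<forall>q\<in>\<Omega>. decseq (\<lambda>j. U j q) \<and> (\<lambda>j. ereal (U j q)) \<longlonglongrightarrow> u q)"

text \<open>
  \<open>F\<^sub>j d\<L> \<longlonglongrightarrow> \<mu>\<close> weakly as Radon measures on \<open>\<Omega>\<close>, i.e. tested against continuous functions with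
  compact support in \<open>\<Omega>\<close>.
\<close>

definition weak_limit_on :: "(quat^'n) set \<Rightarrow> (nat \<Rightarrow> quat^'n \<Rightarrow> real) \<Rightarrow> (quat^'n) measure \<Rightarrow> bool" where
  "weak_limit_on \<Omega> F \<mu> \<longleftrightarrow>
     (\<forall>\<phi>::quat^'n \<Rightarrow> real. continuous_on UNIV \<phi> \<and> compact (closure {q. \<phi> q \<noteq> 0}) \<and>
        closure {q. \<phi> q \<noteq> 0} \<subseteq> \<Omega> \<longrightarrow>
        (\<lambda>j. LINT q|lborel. \<phi> q * F j q) \<longlonglongrightarrow> (LINT q|\<mu>. \<phi> q))"

text \<open>
  \<open>has_MA_measure e \<Omega> u \<mu>\<close> says that \<open>(\<partial>\<partial>\<^sub>J u)\<^sup>n = \<mu>\<close> for a quaternionic plurisubharmonic \<open>u\<close>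
  that is locally bounded outside a compact set.  Local finiteness makes \<open>\<mu>\<close> the only
  Borel measure with this property; the existence of an approximating sequence prevents the
  clause about all sequences from holding vacuously.
\<close>

definition has_MA_measure ::
    "(nat \<Rightarrow> 'n) \<Rightarrow> (quat^'n) set \<Rightarrow> (quat^'n \<Rightarrow> ereal) \<Rightarrow> (quat^'n) measure \<Rightarrow> bool" where
  "has_MA_measure e \<Omega> u \<mu> \<longleftrightarrow>
     qpsh_on \<Omega> u \<and> (\<exists>K. compact K \<and> K \<subseteq> \<Omega> \<and> locally_bounded_on (\<Omega> - K) u) \<and>
     sets \<mu> = sets (restrict_space borel \<Omega>) \<and>
     (\<forall>K. compact K \<and> K \<subseteq> \<Omega> \<longrightarrow> emeasure \<mu> K < \<infinity>) \<and>
     (\<exists>U. smooth_qpsh_approx \<Omega> u U) \<and>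
     (\<forall>U. smooth_qpsh_approx \<Omega> u U \<longrightarrow> weak_limit_on \<Omega> (\<lambda>j. MA_smooth e (U j)) \<mu>)"

definition log_norm :: "quat^'n \<Rightarrow> ereal" where
  "log_norm q = (if q = 0 then -\<infinity> else ereal (ln (norm q)))"

end

theory Submission
  imports Defs
begin

text \<open>
  Write \<open>D(u\<^sub>1, \<dots>, u\<^sub>n)\<close> for the coefficient of \<open>\<partial>\<partial>\<^sub>J u\<^sub>1 \<and> \<dots> \<and> \<partial>\<partial>\<^sub>J u\<^sub>n\<close>.  It is nonnegative on smooth
  plurisubharmonic functions, since a quaternionic positive form is a sum of \<open>n\<close> forms
  \<open>\<alpha> \<and> J\<alpha>\<close> (Cholesky) and a product of such forms is nonnegative (Gaussian elimination).
  As \<open>\<partial>\<close> and \<open>\<partial>\<^sub>J\<close> anticommute, \<open>\<integral> \<phi> D(u, \<dots>) = \<integral> u D(\<phi>, \<dots>)\<close> for a test function \<open>\<phi>\<close>.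
  If \<open>\<phi>\<close> is constant near the origin, the right-hand side only sees \<open>u\<close> on an annulus, where every
  decreasing approximation of \<open>log \<parallel>q\<parallel>\<close> converges uniformly (Dini) and the masses are bounded
  (Chern-Levine-Nirenberg).  Telescoping \<open>D(U, \<dots>, U) - D(V, \<dots>, V)\<close> then shows that any two
  approximations have the same limit on such \<open>\<phi>\<close>, and these are uniformly dense by the
  Stone-Weierstrass theorem.  For \<open>V = log (\<parallel>q\<parallel>\<^sup>2 + \<epsilon>) / 2\<close> the Hessian is a rank-one perturbation of a
  multiple of the standard form, so its Monge-Ampere density is explicit; it converges to the
  claimed density by dominated convergence, whose local integrability follows from the mass bounds
  by Fatou's lemma.
\<close>

text \<open>The obstacle is the pole: approximations of the logarithm have no common lower bound
  near the origin, so moving derivatives onto a general test function gives no control there. A test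
  function that is constant near the origin has no Hessian there, which removes the pole from the
  estimate but not from the test: a cutoff is of this kind and sees the full mass of a ball. Hence
  no mass can collect at the origin, and the limit has no atom, in accordance with the integrability
  of |q|^(-2n) near 0 in dimension 4n. The factor 1/2 is a difference 1 - 1/2. With \<rho> = |q|^2 +
  \<epsilon> the density of the regularised logarithm is n! (1/\<rho>^n - |q|^2/(2 \<rho>^(n+1))):
  the first term comes from the multiple of the standard form, the second from the rank-one
  perturbation, and for \<epsilon> = 0 they differ by a factor 2. Regularity is distributed
  unevenly. Closedness of a product of Hessian forms takes third derivatives of its factors, while
  the test function is differentiated only twice; this is why cutoffs made of truncated cubes
  suffice.\<close>

section \<open>Functions of class C^k\<close>

lemma dir_deriv_eq:
  assumes "(f has_derivative f') (at x)"
  shows "dir_deriv v f x = f' v"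
  using frechet_derivative_at[OF assms] by (simp add: dir_deriv_def)

lemma has_derivative_dir_deriv:
  assumes "f differentiable (at x)"
  shows "(f has_derivative (\<lambda>v. dir_deriv v f x)) (at x)"
  using assms unfolding dir_deriv_def by (simp add: frechet_derivative_works[symmetric])

lemma linear_dir_deriv:
  assumes "f differentiable (at x)"
  shows "linear (\<lambda>v. dir_deriv v f x)"
  using has_derivative_dir_deriv[OF assms] has_derivative_linear by blast

lemma dir_deriv_eq_sum:
  fixes f :: "'a::euclidean_space \<Rightarrow> 'b::real_normed_vector"
  assumes "f differentiable (at x)"
  shows "dir_deriv v f x = (\<Sum>b\<in>Basis. (v \<bullet> b) *\<^sub>R dir_deriv b f x)"
proof -
  interpret linear "\<lambda>v. dir_deriv v f x" by (rule linear_dir_deriv[OF assms])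
  have "dir_deriv v f x = dir_deriv (\<Sum>b\<in>Basis. (v \<bullet> b) *\<^sub>R b) f x"
    by (simp only: euclidean_representation)
  also have "\<dots> = (\<Sum>b\<in>Basis. (v \<bullet> b) *\<^sub>R dir_deriv b f x)"
    by (simp only: sum scale)
  finally show ?thesis .
qed

lemma Ck_on_cong:
  assumes "open S" "\<And>x. x \<in> S \<Longrightarrow> f x = g x" "Ck_on k S f"
  shows "Ck_on k S g"
  using assms(2,3)
proof (induction k arbitrary: f g)
  case 0
  then show ?case using continuous_on_cong[of S S f g] by auto
next
  case (Suc k)
  have D: "(g has_derivative (\<lambda>v. dir_deriv v f x)) (at x)" if "x \<in> S" for x
    by (rule has_derivative_transform_within_open[OF has_derivative_dir_deriv assms(1) that])
       (use Suc.prems that in auto)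
  have "Ck_on k S (dir_deriv b g)" if "b \<in> Basis" for b
    by (rule Suc.IH[where f = "dir_deriv b f"]) (use Suc.prems that D in \<open>auto simp: dir_deriv_eq[OF D]\<close>)
  then show ?case using D by (auto simp: differentiable_def)
qed

lemma Ck_const: "Ck_on k (S::'a::euclidean_space set) (\<lambda>x. c)"
proof (induction k arbitrary: c)
  case (Suc k)
  have "dir_deriv b (\<lambda>x::'a. c) = (\<lambda>x. 0)" for b
    by (simp add: dir_deriv_def fun_eq_iff)
  then show ?case using Suc by simp
qed simp

lemma Ck_on_SucD: "Ck_on (Suc k) S f \<Longrightarrow> Ck_on k S f"
proof (induction k arbitrary: f)
  case 0
  then show ?case
    by (auto intro!: continuous_at_imp_continuous_on differentiable_imp_continuous_within)
qed auto

lemma Ck_on_mono: "Ck_on k S f \<Longrightarrow> l \<le> k \<Longrightarrow> Ck_on l S f"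
  by (induction k) (auto simp del: Ck_on.simps simp: le_Suc_eq dest: Ck_on_SucD)

lemma Ck_on_imp_continuous: "Ck_on k S f \<Longrightarrow> continuous_on S f"
  using Ck_on_mono[of k S f 0] by simp

lemma Ck_on_bounded_linear:
  assumes "bounded_linear L" "open S" "Ck_on k S f"
  shows "Ck_on k S (\<lambda>x. L (f x))"
  using assms(3)
proof (induction k arbitrary: f)
  case 0
  then show ?case using assms(1) linear_continuous_on_compose by (auto intro: bounded_linear.continuous_on)
next
  case (Suc k)
  have D: "((\<lambda>x. L (f x)) has_derivative (\<lambda>v. L (dir_deriv v f x))) (at x)" if "x \<in> S" for x
    using Suc.prems that by (intro bounded_linear.has_derivative[OF assms(1)] has_derivative_dir_deriv) auto
  have "Ck_on k S (dir_deriv b (\<lambda>x. L (f x)))" if "b \<in> Basis" for b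
    by (rule Ck_on_cong[OF assms(2), where f = "\<lambda>x. L (dir_deriv b f x)"])
       (use that Suc in \<open>auto simp: dir_deriv_eq[OF D]\<close>)
  then show ?case using D by (auto simp: differentiable_def)
qed

lemma Ck_on_add:
  assumes "open S" "Ck_on k S f" "Ck_on k S g"
  shows "Ck_on k S (\<lambda>x. f x + g x)"
  using assms(2,3)
proof (induction k arbitrary: f g)
  case 0
  then show ?case by (auto intro: continuous_intros)
next
  case (Suc k)
  have D: "((\<lambda>x. f x + g x) has_derivative (\<lambda>v. dir_deriv v f x + dir_deriv v g x)) (at x)" if "x \<in> S" for x
    using Suc.prems that by (auto intro!: derivative_intros has_derivative_dir_deriv)
  have "Ck_on k S (dir_deriv b (\<lambda>x. f x + g x))" if "b \<in> Basis" for b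
    by (rule Ck_on_cong[OF assms(1), where f = "\<lambda>x. dir_deriv b f x + dir_deriv b g x"])
       (use that Suc in \<open>auto simp: dir_deriv_eq[OF D]\<close>)
  then show ?case using D by (auto simp: differentiable_def)
qed

lemma Ck_on_sum:
  assumes "open S" "\<And>i. i \<in> I \<Longrightarrow> Ck_on k S (f i)"
  shows "Ck_on k S (\<lambda>x. \<Sum>i\<in>I. f i x)"
  using assms(2)
  by (induction I rule: infinite_finite_induct)
     (simp_all add: Ck_const Ck_on_add[OF assms(1)] del: Ck_on.simps)

lemma Ck_on_mult:
  fixes f g :: "_ \<Rightarrow> 'b::real_normed_algebra"
  assumes "open S" "Ck_on k S f" "Ck_on k S g"
  shows "Ck_on k S (\<lambda>x. f x * g x)"
  using assms(2,3)
proof (induction k arbitrary: f g)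
  case 0
  then show ?case by (auto intro: continuous_intros)
next
  case (Suc k)
  have D: "((\<lambda>x. f x * g x) has_derivative (\<lambda>v. f x * dir_deriv v g x + dir_deriv v f x * g x)) (at x)" if "x \<in> S" for x
    using Suc.prems that by (auto intro!: has_derivative_mult has_derivative_dir_deriv)
  have "Ck_on k S (dir_deriv b (\<lambda>x. f x * g x))" if "b \<in> Basis" for b
  proof (rule Ck_on_cong[OF assms(1), where f = "\<lambda>x. f x * dir_deriv b g x + dir_deriv b f x * g x"])
    have "Ck_on k S f" "Ck_on k S g" using Suc.prems Ck_on_SucD by blast+
    then show "Ck_on k S (\<lambda>x. f x * dir_deriv b g x + dir_deriv b f x * g x)"
      using Suc that by (intro Ck_on_add assms(1)) auto
  qed (auto simp: dir_deriv_eq[OF D])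
  then show ?case using D by (auto simp: differentiable_def)
qed

lemma Ck_on_cmult:
  fixes f :: "_ \<Rightarrow> 'b::real_normed_algebra"
  assumes "open S" "Ck_on k S f"
  shows "Ck_on k S (\<lambda>x. c * f x)"
  by (intro Ck_on_mult Ck_const assms)

lemma Ck_on_diff:
  fixes f g :: "_ \<Rightarrow> 'b::real_normed_algebra_1"
  assumes "open S" "Ck_on k S f" "Ck_on k S g"
  shows "Ck_on k S (\<lambda>x. f x - g x)"
  using Ck_on_add[OF assms(1,2) Ck_on_cmult[OF assms(1,3), of "-1"]] by simp

lemma Ck_on_of_real:
  "open S \<Longrightarrow> Ck_on k S f \<Longrightarrow> Ck_on k S (\<lambda>x. complex_of_real (f x))"
  by (rule Ck_on_bounded_linear[OF bounded_linear_of_real])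

text \<open>The whole chain of derivatives \<open>G 0\<close>, \<open>G 1\<close>, ... of the outer
  function is passed as data: one differentiation replaces \<open>G\<close> by its shift, so the
  induction closes. It serves the logarithm and the truncated cubes.\<close>

lemma Ck_on_compose_real:
  fixes f :: "'a::euclidean_space \<Rightarrow> real" and G :: "nat \<Rightarrow> real \<Rightarrow> real"
  assumes S: "open S" and f: "Ck_on k S f"
    and G: "\<And>i x. x \<in> S \<Longrightarrow> i < k \<Longrightarrow> (G i has_real_derivative G (Suc i) (f x)) (at (f x))"
    and c: "\<And>x. x \<in> S \<Longrightarrow> isCont (G k) (f x)"
  shows "Ck_on k S (\<lambda>x. G 0 (f x))"
  using f G c
proof (induction k arbitrary: G)
  case 0
  have "continuous_on S f" using 0 by simp
  then have "isCont f x" if "x \<in> S" for x using that by (simp add: continuous_on_eq_continuous_at[OF S])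
  then have "isCont (\<lambda>x. G 0 (f x)) x" if "x \<in> S" for x
    using isCont_o2[of x f "G 0"] 0(3)[OF that] that by blast
  then show ?case by (simp add: continuous_on_eq_continuous_at[OF S])
next
  case (Suc k)
  have D: "((\<lambda>x. G 0 (f x)) has_derivative (\<lambda>v. G (Suc 0) (f x) * dir_deriv v f x)) (at x)" if "x \<in> S" for x
  proof -
    have "(f has_derivative (\<lambda>v. dir_deriv v f x)) (at x)"
      using Suc.prems(1) that by (auto intro: has_derivative_dir_deriv)
    moreover have "(G 0 has_derivative (*) (G (Suc 0) (f x))) (at (f x))"
      using Suc.prems(2)[OF that, of 0] by (simp add: has_field_derivative_def)
    ultimately show ?thesis
      using has_derivative_compose[of f "\<lambda>v. dir_deriv v f x" x UNIV "G 0"] by simp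
  qed
  have "Ck_on k S (dir_deriv b (\<lambda>x. G 0 (f x)))" if "b \<in> Basis" for b
  proof (rule Ck_on_cong[OF S, where f = "\<lambda>x. G (Suc 0) (f x) * dir_deriv b f x"])
    have "Ck_on k S (\<lambda>x. G (Suc 0) (f x))"
      by (rule Suc.IH[of "\<lambda>i. G (Suc i)"])
         (use Ck_on_SucD[OF Suc.prems(1)] Suc.prems(2,3) in auto)
    then show "Ck_on k S (\<lambda>x. G (Suc 0) (f x) * dir_deriv b f x)"
      using Suc.prems(1) that by (intro Ck_on_mult S) auto
  qed (auto simp: dir_deriv_eq[OF D])
  then show ?case using D by (auto simp: differentiable_def)
qed

lemma Ck_UNIV_differentiable: "Ck_on (Suc k) UNIV f \<Longrightarrow> f differentiable (at x)"
  by auto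

text \<open>\<open>Ck_on\<close> speaks of basis directions; linearity of the derivative carries it
  over to directions such as \<open>right_scale b d\<close>.\<close>

lemma Ck_UNIV_dir_deriv:
  assumes "Ck_on (Suc k) UNIV f"
  shows "Ck_on k UNIV (dir_deriv v f)"
proof -
  have "dir_deriv v f = (\<lambda>x. \<Sum>b\<in>Basis. (v \<bullet> b) *\<^sub>R dir_deriv b f x)"
    by (rule ext) (rule dir_deriv_eq_sum[OF Ck_UNIV_differentiable[OF assms]])
  moreover have "Ck_on k UNIV (\<lambda>x. \<Sum>b\<in>Basis. (v \<bullet> b) *\<^sub>R dir_deriv b f x)"
    using assms by (intro Ck_on_sum Ck_on_bounded_linear[OF bounded_linear_scaleR_right]) auto
  ultimately show ?thesis by simp
qed

lemma dir_deriv_add: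
  "f differentiable (at x) \<Longrightarrow> g differentiable (at x) \<Longrightarrow>
   dir_deriv v (\<lambda>x. f x + g x) x = dir_deriv v f x + dir_deriv v g x"
  by (rule dir_deriv_eq) (auto intro!: derivative_intros has_derivative_dir_deriv)

lemma dir_deriv_mult:
  fixes f g :: "_ \<Rightarrow> 'b::real_normed_algebra"
  shows "f differentiable (at x) \<Longrightarrow> g differentiable (at x) \<Longrightarrow>
   dir_deriv v (\<lambda>x. f x * g x) x = f x * dir_deriv v g x + dir_deriv v f x * g x"
  by (rule dir_deriv_eq[OF has_derivative_mult[OF has_derivative_dir_deriv has_derivative_dir_deriv]])

lemma dir_deriv_bounded_linear:
  "bounded_linear L \<Longrightarrow> f differentiable (at x) \<Longrightarrow>
   dir_deriv v (\<lambda>x. L (f x)) x = L (dir_deriv v f x)"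
  by (rule dir_deriv_eq[OF bounded_linear.has_derivative[OF _ has_derivative_dir_deriv]])

lemma dir_deriv_affine:
  assumes "linear A" "f differentiable (at (a + A x))"
  shows "dir_deriv v (\<lambda>x::'a::euclidean_space. f (a + A x)) x = dir_deriv (A v) f (a + A x)"
    and "(\<lambda>x. f (a + A x)) differentiable (at x)"
proof -
  have "((\<lambda>x. f (a + A x)) has_derivative (\<lambda>v. dir_deriv (A v) f (a + A x))) (at x)"
  proof -
    have "((\<lambda>x. a + A x) has_derivative A) (at x)"
      by (auto intro!: derivative_eq_intros linear_imp_has_derivative assms)
    from has_derivative_compose[OF this has_derivative_dir_deriv[OF assms(2)]]
    show ?thesis .
  qed
  then show "dir_deriv v (\<lambda>x. f (a + A x)) x = dir_deriv (A v) f (a + A x)"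
    and "(\<lambda>x. f (a + A x)) differentiable (at x)"
    by (auto simp: dir_deriv_eq differentiable_def)
qed

lemma Ck_affine:
  fixes f :: "'b::euclidean_space \<Rightarrow> 'c::real_normed_vector" and A :: "'a::euclidean_space \<Rightarrow> 'b"
  assumes "linear A" "Ck_on k UNIV f"
  shows "Ck_on k UNIV (\<lambda>x. f (a + A x))"
  using assms(2)
proof (induction k arbitrary: f)
  case 0
  have "continuous_on UNIV A" using assms(1) by (simp add: linear_continuous_on linear_linear)
  with 0 show ?case by (auto intro!: continuous_intros continuous_on_compose2[of UNIV f])
next
  case (Suc k)
  have "dir_deriv b (\<lambda>x. f (a + A x)) = (\<lambda>x. dir_deriv (A b) f (a + A x))" for b
    by (rule ext) (rule dir_deriv_affine(1)[OF assms(1) Ck_UNIV_differentiable[OF Suc.prems]])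
  moreover have "(\<lambda>x. f (a + A x)) differentiable (at x)" for x
    by (rule dir_deriv_affine(2)[OF assms(1) Ck_UNIV_differentiable[OF Suc.prems]])
  ultimately show ?case
    using Suc.IH[OF Ck_UNIV_dir_deriv[OF Suc.prems]] by auto
qed

lemma has_real_derivative_along_line:
  fixes f :: "'a::real_normed_vector \<Rightarrow> real"
  assumes "f differentiable (at (x + t *\<^sub>R v))"
  shows "((\<lambda>t. f (x + t *\<^sub>R v)) has_real_derivative dir_deriv v f (x + t *\<^sub>R v)) (at t)"
proof -
  have "((\<lambda>t. x + t *\<^sub>R v) has_derivative (\<lambda>s. s *\<^sub>R v)) (at t)"
    by (auto intro!: derivative_eq_intros)
  from has_derivative_compose[OF this has_derivative_dir_deriv[OF assms]]
  have "((\<lambda>t. f (x + t *\<^sub>R v)) has_derivative (\<lambda>s. dir_deriv (s *\<^sub>R v) f (x + t *\<^sub>R v))) (at t)" .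
  then show ?thesis
    using linear_cmul[OF linear_dir_deriv[OF assms]] 
    by (simp add: has_field_derivative_def mult_commute_abs)
qed

text \<open>Both mixed derivatives are approximated by the same second difference.\<close>

lemma second_difference:
  fixes f :: "'a::euclidean_space \<Rightarrow> real"
  assumes "Ck_on 2 UNIV f" "h > 0"
  shows "\<exists>s t. 0 < s \<and> s < h \<and> 0 < t \<and> t < h \<and>
    f (x + h *\<^sub>R v + h *\<^sub>R w) - f (x + h *\<^sub>R v) - f (x + h *\<^sub>R w) + f x
     = h * h * dir_deriv w (dir_deriv v f) (x + s *\<^sub>R v + t *\<^sub>R w)"
proof -
  have C: "Ck_on (Suc (Suc 0)) UNIV f" using assms(1) by (simp add: numeral_2_eq_2)
  have d1: "f differentiable (at y)" for y using Ck_UNIV_differentiable[OF C] .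
  have d2: "dir_deriv v f differentiable (at y)" for y
    using Ck_UNIV_differentiable[OF Ck_UNIV_dir_deriv[OF C]] .
  \<comment> \<open>The difference along \<open>w\<close> is formed first; one mean value step along
    \<open>v\<close> and a second one along \<open>w\<close> then reach the mixed
    derivative.\<close>
  let ?g = "\<lambda>s. f (x + h *\<^sub>R w + s *\<^sub>R v) - f (x + s *\<^sub>R v)"
  have "\<exists>z>0. z < h \<and> ?g h - ?g 0 = (h - 0) * (dir_deriv v f (x + h *\<^sub>R w + z *\<^sub>R v) - dir_deriv v f (x + z *\<^sub>R v))"
    by (rule MVT2[OF assms(2)]) (auto intro!: derivative_intros has_real_derivative_along_line d1)
  then obtain s where s: "0 < s" "s < h"
    "?g h - ?g 0 = h * (dir_deriv v f (x + h *\<^sub>R w + s *\<^sub>R v) - dir_deriv v f (x + s *\<^sub>R v))" by auto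
  let ?k = "\<lambda>t. dir_deriv v f (x + s *\<^sub>R v + t *\<^sub>R w)"
  have "\<exists>z>0. z < h \<and> ?k h - ?k 0 = (h - 0) * dir_deriv w (dir_deriv v f) (x + s *\<^sub>R v + z *\<^sub>R w)"
    by (rule MVT2[OF assms(2)]) (auto intro!: derivative_intros has_real_derivative_along_line d2)
  then obtain t where t: "0 < t" "t < h" "?k h - ?k 0 = h * dir_deriv w (dir_deriv v f) (x + s *\<^sub>R v + t *\<^sub>R w)"
    by auto
  have "?g h - ?g 0 = h * (?k h - ?k 0)" using s(3) by (simp add: add_ac)
  then show ?thesis using s t by (intro exI[of _ s] exI[of _ t]) (simp add: add_ac)
qed

lemma dir_deriv_commute_real:
  fixes f :: "'a::euclidean_space \<Rightarrow> real"
  assumes "Ck_on 2 UNIV f"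
  shows "dir_deriv v (dir_deriv w f) x = dir_deriv w (dir_deriv v f) x"
proof -
  have C: "Ck_on (Suc (Suc 0)) UNIV f" using assms by (simp add: numeral_2_eq_2)
  have c: "isCont (dir_deriv w (dir_deriv v f)) y" for v w y
    using Ck_UNIV_dir_deriv[OF Ck_UNIV_dir_deriv[OF C]] by (simp add: continuous_on_eq_continuous_at)
  define h where "h m = inverse (real (Suc m))" for m
  have h: "h m > 0" for m by (simp add: h_def)
  have h0: "h \<longlonglongrightarrow> 0" unfolding h_def using LIMSEQ_inverse_real_of_nat .
  have lim: "\<exists>X. X \<longlonglongrightarrow> dir_deriv w (dir_deriv v f) x \<and>
     (\<forall>m. f (x + h m *\<^sub>R v + h m *\<^sub>R w) - f (x + h m *\<^sub>R v) - f (x + h m *\<^sub>R w) + f x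
     = h m * h m * X m)" for v w
  proof -
    have "\<forall>m. \<exists>st. 0 < fst st \<and> fst st < h m \<and> 0 < snd st \<and> snd st < h m \<and>
       f (x + h m *\<^sub>R v + h m *\<^sub>R w) - f (x + h m *\<^sub>R v) - f (x + h m *\<^sub>R w) + f x
     = h m * h m * dir_deriv w (dir_deriv v f) (x + fst st *\<^sub>R v + snd st *\<^sub>R w)"
      using second_difference[OF assms h] by simp
    then obtain st where st: "\<And>m. 0 < fst (st m) \<and> fst (st m) < h m \<and> 0 < snd (st m) \<and> snd (st m) < h m \<and>
       f (x + h m *\<^sub>R v + h m *\<^sub>R w) - f (x + h m *\<^sub>R v) - f (x + h m *\<^sub>R w) + f x
     = h m * h m * dir_deriv w (dir_deriv v f) (x + fst (st m) *\<^sub>R v + snd (st m) *\<^sub>R w)"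
      by metis
    define s t where "s m = fst (st m)" and "t m = snd (st m)" for m
    have st: "0 < s m \<and> s m < h m \<and> 0 < t m \<and> t m < h m \<and>
       f (x + h m *\<^sub>R v + h m *\<^sub>R w) - f (x + h m *\<^sub>R v) - f (x + h m *\<^sub>R w) + f x
     = h m * h m * dir_deriv w (dir_deriv v f) (x + s m *\<^sub>R v + t m *\<^sub>R w)"
      for m using st[of m] by (simp add: s_def t_def)
    have "s \<longlonglongrightarrow> 0" "t \<longlonglongrightarrow> 0"
      by (rule real_tendsto_sandwich[OF _ _ tendsto_const h0]; use st in \<open>auto intro!: always_eventually less_imp_le\<close>)+
    then have "(\<lambda>m. x + s m *\<^sub>R v + t m *\<^sub>R w) \<longlonglongrightarrow> x + 0 *\<^sub>R v + 0 *\<^sub>R w"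
      by (intro tendsto_intros)
    then have "(\<lambda>m. dir_deriv w (dir_deriv v f) (x + s m *\<^sub>R v + t m *\<^sub>R w)) \<longlonglongrightarrow> dir_deriv w (dir_deriv v f) x"
      using isCont_tendsto_compose[OF c] by fastforce
    then show ?thesis using st by blast
  qed
  obtain X where X: "X \<longlonglongrightarrow> dir_deriv w (dir_deriv v f) x"
    "\<And>m. f (x + h m *\<^sub>R v + h m *\<^sub>R w) - f (x + h m *\<^sub>R v) - f (x + h m *\<^sub>R w) + f x = h m * h m * X m"
    using lim by meson
  obtain Y where Y: "Y \<longlonglongrightarrow> dir_deriv v (dir_deriv w f) x"
    "\<And>m. f (x + h m *\<^sub>R w + h m *\<^sub>R v) - f (x + h m *\<^sub>R w) - f (x + h m *\<^sub>R v) + f x = h m * h m * Y m"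
    using lim by meson
  have "X m = Y m" for m
  proof -
    have "h m * h m * X m = h m * h m * Y m"
      unfolding X(2)[symmetric] Y(2)[symmetric] by (simp add: add_ac)
    then show ?thesis using h[of m] by simp
  qed
  then have "X = Y" by auto
  then show ?thesis using X(1) Y(1) LIMSEQ_unique by blast
qed

lemma dir_deriv_commute:
  fixes f :: "'a::euclidean_space \<Rightarrow> complex"
  assumes "Ck_on 2 UNIV f"
  shows "dir_deriv v (dir_deriv w f) x = dir_deriv w (dir_deriv v f) x"
proof -
  have C: "Ck_on (Suc (Suc 0)) UNIV f" using assms by (simp add: numeral_2_eq_2)
  have *: "L (dir_deriv v (dir_deriv w f) x) = L (dir_deriv w (dir_deriv v f) x)"
    if L: "bounded_linear L" for L :: "complex \<Rightarrow> real"
  proof -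
    have 1: "dir_deriv v (\<lambda>x. L (f x)) = (\<lambda>x. L (dir_deriv v f x))" for v
      using Ck_UNIV_differentiable[OF C] by (auto simp: dir_deriv_bounded_linear[OF L])
    have 2: "dir_deriv w (\<lambda>x. L (dir_deriv v f x)) = (\<lambda>x. L (dir_deriv w (dir_deriv v f) x))" for v w
      using Ck_UNIV_differentiable[OF Ck_UNIV_dir_deriv[OF C]]
      by (auto simp: dir_deriv_bounded_linear[OF L])
    have "Ck_on 2 UNIV (\<lambda>x. L (f x))" using Ck_on_bounded_linear[OF L _ assms] by simp
    from dir_deriv_commute_real[OF this, of v w x] show ?thesis by (simp add: 1 2)
  qed
  show ?thesis using *[OF bounded_linear_Re] *[OF bounded_linear_Im] by (simp add: complex_eq_iff)
qed


section \<open>Complex vector fields with constant coefficients\<close>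

text \<open>The pair \<open>(v, w)\<close> stands for the complexified vector \<open>v + \<i> w\<close>.\<close>

definition cderiv :: "'a \<times> 'a \<Rightarrow> ('a::real_normed_vector \<Rightarrow> complex) \<Rightarrow> 'a \<Rightarrow> complex" where
  "cderiv X f q = dir_deriv (fst X) f q + \<i> * dir_deriv (snd X) f q"

lemma Ck_cderiv:
  assumes "Ck_on (Suc k) UNIV f"
  shows "Ck_on k UNIV (cderiv X f)"
proof -
  have "cderiv X f = (\<lambda>q. dir_deriv (fst X) f q + \<i> * dir_deriv (snd X) f q)"
    by (auto simp: cderiv_def)
  then show ?thesis
    using assms by (auto intro!: Ck_on_add Ck_on_cmult Ck_UNIV_dir_deriv simp del: Ck_on.simps)
qed

lemma cderiv_add:
  "f differentiable (at x) \<Longrightarrow> g differentiable (at x) \<Longrightarrow>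
   cderiv X (\<lambda>x. f x + g x) x = cderiv X f x + cderiv X g x"
  by (simp add: cderiv_def dir_deriv_add algebra_simps)

lemma cderiv_mult:
  "f differentiable (at x) \<Longrightarrow> g differentiable (at x) \<Longrightarrow>
   cderiv X (\<lambda>x. f x * g x) x = f x * cderiv X g x + cderiv X f x * g x"
  by (simp add: cderiv_def dir_deriv_mult algebra_simps)

lemma cderiv_const [simp]: "cderiv X (\<lambda>x. c) x = 0"
  by (simp add: cderiv_def dir_deriv_def)

lemma cderiv_cmult:
  "f differentiable (at x) \<Longrightarrow> cderiv X (\<lambda>x. c * f x) x = c * cderiv X f x"
  by (simp add: cderiv_mult)

lemma cderiv_sum:
  "(\<And>i. i \<in> I \<Longrightarrow> f i differentiable (at x)) \<Longrightarrow>
   cderiv X (\<lambda>x. \<Sum>i\<in>I. f i x) x = (\<Sum>i\<in>I. cderiv X (f i) x)"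
  by (induction I rule: infinite_finite_induct) (auto simp: cderiv_add differentiable_sum)

lemma cderiv_commute:
  assumes "Ck_on 2 UNIV f"
  shows "cderiv X (cderiv Y f) x = cderiv Y (cderiv X f) (x::'a::euclidean_space)"
proof -
  have C: "Ck_on (Suc (Suc 0)) UNIV f" using assms by (simp add: numeral_2_eq_2)
  have d: "dir_deriv v f differentiable (at x)" for v
    using Ck_UNIV_differentiable[OF Ck_UNIV_dir_deriv[OF C]] .
  have *: "cderiv Z (\<lambda>x. dir_deriv v f x + \<i> * dir_deriv w f x) x =
     cderiv Z (dir_deriv v f) x + \<i> * cderiv Z (dir_deriv w f) x" for Z v w
    using d by (subst cderiv_add) (auto simp: cderiv_cmult)
  have "cderiv Y f = (\<lambda>x. dir_deriv (fst Y) f x + \<i> * dir_deriv (snd Y) f x)" for Y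
    by (auto simp: cderiv_def)
  then show ?thesis
    by (simp add: *) (simp add: cderiv_def algebra_simps
       dir_deriv_commute[OF assms, of "fst Y" "fst X"] dir_deriv_commute[OF assms, of "fst Y" "snd X"]
       dir_deriv_commute[OF assms, of "snd Y" "fst X"] dir_deriv_commute[OF assms, of "snd Y" "snd X"])
qed

section \<open>Exterior multiplication\<close>

text \<open>The sign of sorting \<open>dz i\<close> past the smaller indices of
  \<open>S\<close>.\<close>

definition parity_below :: "nat \<Rightarrow> nat set \<Rightarrow> complex" where
  "parity_below i S = (-1) ^ card {j\<in>S. j < i}"

text \<open>Left multiplication by \<open>dz i\<close> as an operator on coefficients. Calculations
  with iterated operators rest on their anticommutation and avoid a general associativity law for
  \<open>\<and>\<and>\<close>.\<close>

definition dz_mult :: "nat \<Rightarrow> ext \<Rightarrow> ext" where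
  "dz_mult i A S = (if i \<in> S then parity_below i S * A (S - {i}) else 0)"

definition form_mult :: "nat \<Rightarrow> (nat \<Rightarrow> nat \<Rightarrow> complex) \<Rightarrow> ext \<Rightarrow> ext" where
  "form_mult N a A S = (\<Sum>k<N. \<Sum>i<N. a k i * dz_mult k (dz_mult i A) S)"

definition vec_mult :: "nat \<Rightarrow> (nat \<Rightarrow> complex) \<Rightarrow> ext \<Rightarrow> ext" where
  "vec_mult N \<alpha> A S = (\<Sum>k<N. \<alpha> k * dz_mult k A S)"

lemma parity_below_remove:
  assumes "i \<in> S"
  shows "parity_below k (S - {i}) = (if i < k then - parity_below k S else parity_below k S)"
proof -
  have "finite {j\<in>S. j < k}" by simp
  moreover have "{j\<in>S - {i}. j < k} = {j\<in>S. j < k} - {i}" by auto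
  ultimately have "i < k \<Longrightarrow> card {j\<in>S. j < k} = Suc (card {j\<in>S - {i}. j < k})"
    using assms card.remove[of "{j\<in>S. j < k}" i] by simp
  moreover have "\<not> i < k \<Longrightarrow> {j\<in>S - {i}. j < k} = {j\<in>S. j < k}" by auto
  ultimately show ?thesis by (auto simp: parity_below_def)
qed

lemma dz_mult_anticommute: "dz_mult i (dz_mult k A) S = - dz_mult k (dz_mult i A) S"
  by (auto simp: dz_mult_def parity_below_remove insert_commute Diff_insert2[symmetric])

lemma dz_mult_sum: "dz_mult i (\<lambda>S. \<Sum>x\<in>I. c x * A x S) S = (\<Sum>x\<in>I. c x * dz_mult i (A x) S)"
  by (simp add: dz_mult_def sum_distrib_left mult.left_commute)

lemma dz_mult_uminus: "dz_mult i (\<lambda>S. - A S) = (\<lambda>S. - dz_mult i A S)"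
  by (auto simp: dz_mult_def)

lemma vec_mult_uminus: "vec_mult N \<alpha> (\<lambda>S. - A S) = (\<lambda>S. - vec_mult N \<alpha> A S)"
  by (rule ext) (simp add: vec_mult_def dz_mult_uminus sum_negf)

lemma vec_mult_zero: "vec_mult N \<alpha> (\<lambda>S. 0) = (\<lambda>S. 0)"
  by (auto simp: vec_mult_def dz_mult_def fun_eq_iff intro!: sum.neutral)

lemma vec_mult_lin2:
  "vec_mult N \<alpha> (\<lambda>S. A S + x * B S + y * C S) =
   (\<lambda>S. vec_mult N \<alpha> A S + x * vec_mult N \<alpha> B S + y * vec_mult N \<alpha> C S)"
proof -
  have "dz_mult k (\<lambda>S. A S + x * B S + y * C S) S = dz_mult k A S + x * dz_mult k B S + y * dz_mult k C S" for k S
    by (simp add: dz_mult_def algebra_simps)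
  then show ?thesis
    by (intro ext) (simp add: vec_mult_def sum_distrib_left sum.distrib distrib_left mult.left_commute)
qed

lemma vec_mult_lin1:
  "vec_mult N (\<lambda>i. \<alpha> i + x * \<beta> i + y * \<gamma> i) A =
   (\<lambda>S. vec_mult N \<alpha> A S + x * vec_mult N \<beta> A S + y * vec_mult N \<gamma> A S)"
  by (rule ext) (simp add: vec_mult_def sum_distrib_left sum.distrib distrib_right mult.assoc)

lemma form_mult_rank_one: "form_mult N (\<lambda>k i. \<alpha> k * \<beta> i) A = vec_mult N \<alpha> (vec_mult N \<beta> A)"
proof
  fix S
  have "vec_mult N \<alpha> (vec_mult N \<beta> A) S = (\<Sum>k<N. \<alpha> k * (\<Sum>i<N. \<beta> i * dz_mult k (dz_mult i A) S))"
    by (simp add: vec_mult_def[abs_def] dz_mult_sum)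
  then show "form_mult N (\<lambda>k i. \<alpha> k * \<beta> i) A S = vec_mult N \<alpha> (vec_mult N \<beta> A) S"
    by (simp add: form_mult_def sum_distrib_left mult.assoc)
qed

lemma vec_mult_anticommute:
  "vec_mult N \<alpha> (vec_mult N \<beta> A) = (\<lambda>S. - vec_mult N \<beta> (vec_mult N \<alpha> A) S)"
proof
  fix S
  have "(\<Sum>k<N. \<Sum>i<N. \<alpha> k * \<beta> i * dz_mult k (dz_mult i A) S) =
     (\<Sum>i<N. \<Sum>k<N. - (\<beta> i * \<alpha> k * dz_mult i (dz_mult k A) S))"
    by (subst sum.swap) (intro sum.cong refl, subst dz_mult_anticommute, simp)
  then show "vec_mult N \<alpha> (vec_mult N \<beta> A) S = - vec_mult N \<beta> (vec_mult N \<alpha> A) S"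
    unfolding form_mult_rank_one[symmetric] form_mult_def by (simp add: sum_negf)
qed

lemma vec_mult_self: "vec_mult N \<alpha> (vec_mult N \<alpha> A) = (\<lambda>S. 0)"
proof
  fix S
  show "vec_mult N \<alpha> (vec_mult N \<alpha> A) S = 0"
    using fun_cong[OF vec_mult_anticommute[of N \<alpha> \<alpha> A], of S] by (simp add: eq_neg_iff_add_eq_0)
qed

lemma form_mult_sum:
  "form_mult N a (\<lambda>S. \<Sum>x\<in>I. c x * A x S) S = (\<Sum>x\<in>I. c x * form_mult N a (A x) S)"
proof -
  have "dz_mult k (dz_mult i (\<lambda>S. \<Sum>x\<in>I. c x * A x S)) S = (\<Sum>x\<in>I. c x * dz_mult k (dz_mult i (A x)) S)" for k i
  proof -
    have "dz_mult i (\<lambda>S. \<Sum>x\<in>I. c x * A x S) = (\<lambda>S. \<Sum>x\<in>I. c x * dz_mult i (A x) S)"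
      by (rule ext) (rule dz_mult_sum)
    then show ?thesis by (simp add: dz_mult_sum)
  qed
  then have "form_mult N a (\<lambda>S. \<Sum>x\<in>I. c x * A x S) S =
     (\<Sum>k<N. \<Sum>i<N. \<Sum>x\<in>I. c x * (a k i * dz_mult k (dz_mult i (A x)) S))"
    by (simp add: form_mult_def sum_distrib_left mult.left_commute)
  also have "\<dots> = (\<Sum>x\<in>I. \<Sum>k<N. \<Sum>i<N. c x * (a k i * dz_mult k (dz_mult i (A x)) S))"
    by (subst sum.swap[of _ I]) (intro sum.cong refl sum.swap)
  finally show ?thesis by (simp add: form_mult_def sum_distrib_left)
qed

text \<open>Moving two generators past two others takes four transpositions, so the signs cancel;
  this is why forms of degree two commute.\<close>

lemma form_mult_commute_dz_pair:
  "form_mult N a (dz_mult l (dz_mult p A)) S = dz_mult l (dz_mult p (form_mult N a A)) S"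
proof -
  have ac: "dz_mult i (dz_mult k A) = (\<lambda>S. - dz_mult k (dz_mult i A) S)" for i k A
    by (rule ext) (rule dz_mult_anticommute)
  have 4: "dz_mult k (dz_mult i (dz_mult l (dz_mult p A))) = dz_mult l (dz_mult p (dz_mult k (dz_mult i A)))" for k i
    by (simp add: ac[of i l] ac[of i p] ac[of k l] ac[of k p] dz_mult_uminus)
  have "dz_mult l (dz_mult p (form_mult N a A)) S =
     dz_mult l (dz_mult p (\<lambda>S. \<Sum>x\<in>{..<N}\<times>{..<N}. a (fst x) (snd x) * dz_mult (fst x) (dz_mult (snd x) A) S)) S"
    by (simp add: form_mult_def[abs_def] sum.cartesian_product case_prod_beta)
  also have "\<dots> = (\<Sum>x\<in>{..<N}\<times>{..<N}. a (fst x) (snd x) * dz_mult l (dz_mult p (dz_mult (fst x) (dz_mult (snd x) A))) S)"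
    using dz_mult_sum[where A = "\<lambda>x. dz_mult p (dz_mult (fst x) (dz_mult (snd x) A))"]
    by (subst dz_mult_sum[abs_def]) simp
  also have "\<dots> = (\<Sum>x\<in>{..<N}\<times>{..<N}. a (fst x) (snd x) * dz_mult (fst x) (dz_mult (snd x) (dz_mult l (dz_mult p A))) S)"
    by (simp add: 4)
  finally show ?thesis by (simp add: form_mult_def sum.cartesian_product case_prod_beta)
qed

lemma form_mult_commute: "form_mult N a (form_mult N b A) = form_mult N b (form_mult N a A)"
proof
  fix S
  have "form_mult N a (form_mult N b A) S =
     form_mult N a (\<lambda>S. \<Sum>x\<in>{..<N}\<times>{..<N}. b (fst x) (snd x) * dz_mult (fst x) (dz_mult (snd x) A) S) S"
    by (simp add: form_mult_def[of N b, abs_def] sum.cartesian_product case_prod_beta)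
  also have "\<dots> = (\<Sum>x\<in>{..<N}\<times>{..<N}. b (fst x) (snd x) * dz_mult (fst x) (dz_mult (snd x) (form_mult N a A)) S)"
    by (simp add: form_mult_sum form_mult_commute_dz_pair)
  finally show "form_mult N a (form_mult N b A) S = form_mult N b (form_mult N a A) S"
    by (simp add: form_mult_def[of N b] sum.cartesian_product case_prod_beta)
qed

text \<open>Since the generators anticommute, only the antisymmetric part of the coefficient matrix
  acts. Hessian matrices are compared modulo symmetric matrices by this rule.\<close>

lemma form_mult_eqI:
  assumes "\<And>k i. k < N \<Longrightarrow> i < N \<Longrightarrow> a k i - a i k = b k i - b i k"
  shows "form_mult N a A = form_mult N b A"
proof
  fix S
  have *: "2 * form_mult N c A S = (\<Sum>k<N. \<Sum>i<N. (c k i - c i k) * dz_mult k (dz_mult i A) S)" for c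
  proof -
    have "form_mult N c A S = (\<Sum>k<N. \<Sum>i<N. c i k * dz_mult i (dz_mult k A) S)"
      unfolding form_mult_def by (rule sum.swap)
    also have "\<dots> = (\<Sum>k<N. \<Sum>i<N. - c i k * dz_mult k (dz_mult i A) S)"
      by (intro sum.cong refl, subst dz_mult_anticommute, simp)
    finally have "2 * form_mult N c A S = (\<Sum>k<N. \<Sum>i<N. c k i * dz_mult k (dz_mult i A) S) +
       (\<Sum>k<N. \<Sum>i<N. - c i k * dz_mult k (dz_mult i A) S)"
      by (simp add: form_mult_def)
    then show ?thesis by (simp add: sum.distrib[symmetric] algebra_simps)
  qed
  have "2 * form_mult N a A S = 2 * form_mult N b A S"
    unfolding * using assms by (intro sum.cong refl) auto
  then show "form_mult N a A S = form_mult N b A S" by simp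
qed


section \<open>Exterior products and powers as iterated multiplication operators\<close>

lemma wedge_dz: "finite S \<Longrightarrow> (dz i \<and>\<and> A) S = dz_mult i A S"
proof -
  \<comment> \<open>Finiteness matters: for infinite \<open>S\<close> the sum in
    \<open>\<and>\<and>\<close> is 0 by convention, whereas \<open>dz_mult\<close> can be nonzero
    there.\<close>
  assume S: "finite S"
  have "(dz i \<and>\<and> A) S = (\<Sum>T\<in>Pow S. if T = {i} then
     (-1) ^ card {(k,j). k \<in> {i} \<and> j \<in> S - {i} \<and> j < k} * A (S - {i}) else 0)"
    unfolding wedge_def by (intro sum.cong refl) (auto simp: dz_def)
  also have "\<dots> = (if i \<in> S then (-1) ^ card {(k,j). k \<in> {i} \<and> j \<in> S - {i} \<and> j < k} * A (S - {i}) else 0)"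
    using S by simp
  also have "{(k,j). k \<in> {i} \<and> j \<in> S - {i} \<and> j < k} = Pair i ` {j\<in>S. j < i}" by auto
  finally show ?thesis by (simp add: dz_mult_def parity_below_def card_image inj_on_def)
qed

text \<open>The instance of associativity on which the translation rests. The inversions of
  \<open>{k,i}\<close> against the rest of \<open>S\<close> split into those of \<open>k\<close> and
  those of \<open>i\<close>, which yields the product of the two parities.\<close>

lemma wedge_dz_dz:
  assumes S: "finite S"
  shows "((dz k \<and>\<and> dz i) \<and>\<and> A) S = dz_mult k (dz_mult i A) S"
proof -
  have dd: "(dz k \<and>\<and> dz i) T = (if k \<noteq> i \<and> T = {k,i} then (if i < k then -1 else 1) else 0)" if "finite T" for T
  proof -
    have "parity_below k {k,i} = (if i < k then -1 else 1)" if "k \<noteq> i"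
    proof -
      have "{j\<in>{k,i}. j < k} = (if i < k then {i} else {})" by auto
      then show ?thesis by (simp add: parity_below_def)
    qed
    moreover have "k \<in> T \<and> T - {k} = {i} \<longleftrightarrow> k \<noteq> i \<and> T = {k,i}" by auto
    ultimately show ?thesis using that by (auto simp: wedge_dz dz_mult_def dz_def)
  qed
  let ?s = "(-1) ^ card {(x,y). x \<in> {k,i} \<and> y \<in> S - {k,i} \<and> y < x} :: complex"
  have "((dz k \<and>\<and> dz i) \<and>\<and> A) S = (\<Sum>T\<in>Pow S. if T = {k,i} then
     (if k \<noteq> i then ?s * (if i < k then -1 else 1) * A (S - {k,i}) else 0) else 0)"
    unfolding wedge_def[of "dz k \<and>\<and> dz i"] using finite_subset[OF _ S]
    by (intro sum.cong refl) (auto simp: dd)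
  also have "\<dots> = (if k \<noteq> i \<and> k \<in> S \<and> i \<in> S then ?s * (if i < k then -1 else 1) * A (S - {k,i}) else 0)"
    using S by simp
  also have "\<dots> = dz_mult k (dz_mult i A) S"
  proof (cases "k \<noteq> i \<and> k \<in> S \<and> i \<in> S")
    case True
    have "{(x,y). x \<in> {k,i} \<and> y \<in> S - {k,i} \<and> y < x} =
       Pair k ` {j\<in>S - {k} - {i}. j < k} \<union> Pair i ` {j\<in>S - {k} - {i}. j < i}" by auto
    moreover have "card (Pair k ` {j\<in>S - {k} - {i}. j < k} \<union> Pair i ` {j\<in>S - {k} - {i}. j < i}) =
      card {j\<in>S - {k} - {i}. j < k} + card {j\<in>S - {k} - {i}. j < i}"
      using True S by (subst card_Un_disjoint) (auto simp: card_image inj_on_def)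
    ultimately have "?s = parity_below k (S - {k} - {i}) * parity_below i (S - {k} - {i})"
      by (simp add: parity_below_def power_add)
    moreover have "parity_below k (S - {k} - {i}) = (if i < k then - parity_below k S else parity_below k S)"
      "parity_below i (S - {k} - {i}) = parity_below i (S - {k})"
      using True by (auto simp: parity_below_remove)
    moreover have "S - {k,i} = S - {k} - {i}" by auto
    ultimately show ?thesis using True
      by (simp only: dz_mult_def) auto
  qed (auto simp: dz_mult_def)
  finally show ?thesis .
qed

lemma wedge_sum_left:
  "((\<lambda>T. \<Sum>x\<in>I. c x * B x T) \<and>\<and> A) S = (\<Sum>x\<in>I. c x * (B x \<and>\<and> A) S)"
proof -
  have "((\<lambda>T. \<Sum>x\<in>I. c x * B x T) \<and>\<and> A) S =
    (\<Sum>T\<in>Pow S. \<Sum>x\<in>I. c x * ((-1) ^ card {(i,j). i \<in> T \<and> j \<in> S - T \<and> j < i} * B x T * A (S - T)))"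
    by (simp add: wedge_def sum_distrib_left sum_distrib_right mult_ac)
  also have "\<dots> = (\<Sum>x\<in>I. \<Sum>T\<in>Pow S. c x * ((-1) ^ card {(i,j). i \<in> T \<and> j \<in> S - T \<and> j < i} * B x T * A (S - T)))"
    by (rule sum.swap)
  finally show ?thesis by (simp add: wedge_def sum_distrib_left)
qed

lemma wedge_power_eq:
  assumes "\<And>T. \<omega> T = (\<Sum>k<N. \<Sum>i<N. a k i * (dz k \<and>\<and> dz i) T)" "finite S"
  shows "wedge_power \<omega> n S = (form_mult N a ^^ n) ext_one S"
  using assms(2)
proof (induction n arbitrary: S)
  case 0
  then show ?case by (simp add: wedge_power_def)
next
  case (Suc n)
  have \<omega>: "\<omega> = (\<lambda>T. \<Sum>x\<in>{..<N}\<times>{..<N}. a (fst x) (snd x) * (dz (fst x) \<and>\<and> dz (snd x)) T)"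
    using assms(1) by (auto simp: sum.cartesian_product case_prod_beta)
  let ?B = "wedge_power \<omega> n" and ?C = "(form_mult N a ^^ n) ext_one"
  have "wedge_power \<omega> (Suc n) S = (\<omega> \<and>\<and> ?B) S"
    by (simp add: wedge_power_def)
  also have "\<dots> = (\<omega> \<and>\<and> ?C) S"
    unfolding wedge_def using Suc finite_subset by (intro sum.cong refl) auto
  also have "\<dots> = (\<Sum>x\<in>{..<N}\<times>{..<N}. a (fst x) (snd x) * dz_mult (fst x) (dz_mult (snd x) ?C) S)"
    by (subst \<omega>) (simp add: wedge_sum_left wedge_dz_dz[OF Suc.prems])
  also have "\<dots> = form_mult N a ?C S"
    by (simp add: form_mult_def sum.cartesian_product case_prod_beta)
  finally show ?case by simp
qed


section \<open>Quaternionic structure and positive forms\<close>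

text \<open>The index i + (-1)^i in \<open>\<partial>\<^sub>J\<close>: the other complex coordinate
  of the same quaternion.\<close>

definition partner :: "nat \<Rightarrow> nat" where
  "partner i = (if even i then i + 1 else i - 1)"

text \<open>Coefficients of the one-form J\<alpha>, for the conjugate-linear J with J^2 = -1. The
  sign is that of \<open>del_J\<close>, so J maps \<partial>u to \<open>\<partial>\<^sub>J u\<close>
  for real u.\<close>

definition J_vec :: "(nat \<Rightarrow> complex) \<Rightarrow> nat \<Rightarrow> complex" where
  "J_vec \<alpha> i = (-1) ^ (i + 1) * cnj (\<alpha> (partner i))"

definition simple_mult :: "nat \<Rightarrow> (nat \<Rightarrow> complex) \<Rightarrow> ext \<Rightarrow> ext" where
  "simple_mult N \<alpha> A = vec_mult N \<alpha> (vec_mult N (J_vec \<alpha>) A)"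

lemma partner_partner [simp]: "partner (partner i) = i"
  by (auto simp: partner_def)

lemma partner_less [simp]: "partner i < 2 * n \<longleftrightarrow> i < 2 * n"
  by (auto simp: partner_def elim!: evenE oddE)

lemma partner_div2 [simp]: "partner i div 2 = i div 2"
  by (auto simp: partner_def elim!: evenE oddE)

lemma even_partner [simp]: "even (partner i) = odd i"
  by (auto simp: partner_def)

lemma J_vec_J_vec: "J_vec (J_vec \<alpha>) = (\<lambda>i. - \<alpha> i)"
  by (rule ext) (simp add: J_vec_def minus_one_power_iff)

lemma simple_mult_eq_form_mult:
  "simple_mult N \<alpha> A = form_mult N (\<lambda>k i. \<alpha> k * J_vec \<alpha> i) A"
  by (simp add: simple_mult_def form_mult_rank_one)

lemma simple_mult_commute: "simple_mult N \<alpha> (simple_mult N \<beta> A) = simple_mult N \<beta> (simple_mult N \<alpha> A)"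
  by (simp add: simple_mult_eq_form_mult form_mult_commute)

text \<open>The span of \<alpha> and J\<alpha> is stable under J. Hence adding an element of it to
  \<beta> changes J\<beta> by an element of it too, and every added term dies against \<alpha>
  \<and> J\<alpha>.\<close>

lemma simple_mult_absorb:
  "simple_mult N \<alpha> (simple_mult N (\<lambda>i. \<beta> i + x * \<alpha> i + y * J_vec \<alpha> i) A) = simple_mult N \<alpha> (simple_mult N \<beta> A)"
proof -
  let ?V = "vec_mult N" and ?J = "J_vec \<alpha>"
  note ac = vec_mult_anticommute
  have kill: "?V \<alpha> (?V ?J (?V \<alpha> B)) = (\<lambda>S. 0)" "?V \<alpha> (?V ?J (?V ?J B)) = (\<lambda>S. 0)" for B
    by (simp_all add: ac[of N ?J \<alpha>] vec_mult_uminus vec_mult_self vec_mult_zero)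
  have 1: "?V \<alpha> (?V ?J (?V (\<lambda>i. \<gamma> i + u * \<alpha> i + v * ?J i) B)) = ?V \<alpha> (?V ?J (?V \<gamma> B))" for \<gamma> u v B
    by (simp add: vec_mult_lin1 vec_mult_lin2 kill)
  have mv: "?V \<alpha> (?V ?J (?V \<beta> B)) = ?V \<beta> (?V \<alpha> (?V ?J B))" for B
    by (simp add: ac[of N _ \<beta>] vec_mult_uminus)
  have Jb: "J_vec (\<lambda>i. \<beta> i + x * \<alpha> i + y * J_vec \<alpha> i) = (\<lambda>i. J_vec \<beta> i + (- cnj y) * \<alpha> i + cnj x * ?J i)"
  proof
    fix i
    have "J_vec (J_vec \<alpha>) i = - \<alpha> i" by (simp add: J_vec_J_vec)
    then have "(-1) ^ (i + 1) * cnj (J_vec \<alpha> (partner i)) = - \<alpha> i" by (simp only: J_vec_def[of "J_vec \<alpha>"])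
    then show "J_vec (\<lambda>i. \<beta> i + x * \<alpha> i + y * J_vec \<alpha> i) i = J_vec \<beta> i + (- cnj y) * \<alpha> i + cnj x * ?J i"
      unfolding J_vec_def[of "\<lambda>i. \<beta> i + x * \<alpha> i + y * J_vec \<alpha> i"] J_vec_def[of \<beta>]
      by (simp add: J_vec_def[of \<alpha> i] algebra_simps)
  qed
  show ?thesis
    unfolding simple_mult_def Jb 1 mv 1 ..
qed

section \<open>Monomials in whole quaternionic coordinates, and Gaussian elimination\<close>

definition blocks :: "nat set \<Rightarrow> nat set" where
  "blocks C = {j. j div 2 \<in> C}"

definition monomial :: "nat set \<Rightarrow> ext" where
  "monomial C S = (if S = blocks C then 1 else 0)"

lemma blocks_eq_iff [simp]: "blocks C = blocks C' \<longleftrightarrow> C = C'"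
proof -
  have "C = {x. 2 * x \<in> blocks C}" for C by (simp add: blocks_def)
  then show ?thesis by metis
qed

lemma blocks_lessThan: "blocks {..<n} = {..<2*n}"
  by (auto simp: blocks_def)

lemma blocks_pair: "2 * l \<in> blocks C \<longleftrightarrow> l \<in> C" "2 * l + 1 \<in> blocks C \<longleftrightarrow> l \<in> C" "Suc (2 * l) \<in> blocks C \<longleftrightarrow> l \<in> C"
  by (simp_all add: blocks_def)

lemma blocks_remove: "blocks C - {2*l, 2*l+1} = blocks (C - {l})"
  by (auto simp: blocks_def)

lemma blocks_insert: "blocks (insert l C) = insert (2*l) (insert (2*l+1) (blocks C))"
  by (auto simp: blocks_def)

text \<open>No sign appears, because the two neighbouring generators pass the same smaller
  indices.\<close>

lemma dz_mult_pair:
  "dz_mult (2*l) (dz_mult (2*l+1) A) S =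
     (if 2*l \<in> S \<and> 2*l+1 \<in> S then A (S - {2*l, 2*l+1}) else 0)"
proof -
  have "{j\<in>S. j < 2*l+1} = insert (2*l) {j\<in>S. j < 2*l}" if "2*l \<in> S"
    using that by auto
  then have "2*l \<in> S \<Longrightarrow> parity_below (2*l+1) (S - {2*l}) = parity_below (2*l) S"
    by (subst parity_below_remove) (auto simp: parity_below_def)
  moreover have "parity_below (2*l) S * parity_below (2*l) S = 1"
    by (simp add: parity_below_def power_add[symmetric])
  ultimately show ?thesis
    by (auto simp: dz_mult_def Diff_insert2[symmetric] insert_commute)
qed

text \<open>The blocks of \<open>C\<close> other than \<open>l\<close> are already filled and
  \<alpha> vanishes outside \<open>C\<close>, so only the 2 x 2 minor of \<alpha> and J\<alpha> in
  block \<open>l\<close> survives. That minor is the squared length of \<alpha> in the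
  block.\<close>

lemma simple_mult_monomial:
  assumes C: "C \<subseteq> {..<n}" "l \<in> C" and \<alpha>: "\<And>i. i < 2*n \<Longrightarrow> i div 2 \<notin> C \<Longrightarrow> \<alpha> i = 0"
  shows "simple_mult (2*n) \<alpha> (monomial (C - {l})) S =
    of_real ((cmod (\<alpha> (2*l)))\<^sup>2 + (cmod (\<alpha> (2*l+1)))\<^sup>2) * monomial C S"
proof -
  let ?A = "monomial (C - {l})"
  let ?t = "\<lambda>k i. \<alpha> k * J_vec \<alpha> i * dz_mult k (dz_mult i ?A) S"
  have ln: "2*l < 2*n" "2*l+1 < 2*n" using C by auto
  have zero: "?t k i = 0" if "k < 2*n" "i < 2*n" "\<not> (k div 2 = l \<and> i div 2 = l)" for k i
  proof -
    have "dz_mult k (dz_mult i ?A) S = 0" if "k div 2 \<in> C - {l}"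
      using that by (auto simp: dz_mult_def monomial_def blocks_def)
    moreover have "dz_mult k (dz_mult i ?A) S = 0" if "i div 2 \<in> C - {l}"
      using that by (auto simp: dz_mult_def monomial_def blocks_def)
    moreover have "\<alpha> k = 0" if "k div 2 \<notin> C" using \<alpha> that \<open>k < 2*n\<close> by auto
    moreover have "J_vec \<alpha> i = 0" if "i div 2 \<notin> C" using \<alpha>[of "partner i"] that \<open>i < 2*n\<close>
      by (simp add: J_vec_def)
    ultimately show ?thesis using that(3) by auto
  qed
  have two: "(\<Sum>k<2*n. f k) = f (2*l) + f (2*l+1)" if "\<And>k. k < 2*n \<Longrightarrow> k div 2 \<noteq> l \<Longrightarrow> f k = 0"
    for f :: "nat \<Rightarrow> complex"
  proof -
    have "k div 2 \<noteq> l" if "k \<notin> {2*l,2*l+1}" for k using that by auto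
    then have "(\<Sum>k<2*n. f k) = (\<Sum>k\<in>{2*l,2*l+1}. f k)"
      by (intro sum.mono_neutral_right) (use ln that in auto)
    then show ?thesis by simp
  qed
  have "simple_mult (2*n) \<alpha> ?A S = (\<Sum>k<2*n. \<Sum>i<2*n. ?t k i)"
    by (simp add: simple_mult_eq_form_mult form_mult_def)
  also have "\<dots> = (?t (2*l) (2*l) + ?t (2*l) (2*l+1)) + (?t (2*l+1) (2*l) + ?t (2*l+1) (2*l+1))"
  proof -
    have "(\<Sum>i<2*n. ?t k i) = 0" if "k < 2*n" "k div 2 \<noteq> l" for k
      using zero that by (intro sum.neutral) auto
    then have "(\<Sum>k<2*n. \<Sum>i<2*n. ?t k i) = (\<Sum>i<2*n. ?t (2*l) i) + (\<Sum>i<2*n. ?t (2*l+1) i)"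
      by (rule two)
    moreover have "(\<Sum>i<2*n. ?t k i) = ?t k (2*l) + ?t k (2*l+1)" if "k < 2*n" for k
      using zero that by (intro two) auto
    ultimately show ?thesis using ln by simp
  qed
  also have "?t (2*l) (2*l) = 0" by (simp add: dz_mult_def)
  also have "?t (2*l+1) (2*l+1) = 0" by (simp add: dz_mult_def)
  also have "dz_mult (2*l+1) (dz_mult (2*l) ?A) S = - dz_mult (2*l) (dz_mult (2*l+1) ?A) S"
    by (rule dz_mult_anticommute)
  also have "dz_mult (2*l) (dz_mult (2*l+1) ?A) S = monomial C S"
  proof -
    have "2*l \<in> S \<and> 2*l+1 \<in> S \<and> S - {2*l,2*l+1} = blocks (C - {l}) \<longleftrightarrow> S = blocks C"
      using C(2) blocks_remove[of C l] blocks_pair[of l C] by blast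
    then show ?thesis unfolding dz_mult_pair by (auto simp: monomial_def)
  qed
  finally show ?thesis
    by (simp add: J_vec_def partner_def complex_norm_square algebra_simps del: of_real_power)
qed

text \<open>Commutativity brings the factor of \<alpha> next to each \<beta> in turn, so absorption
  applies to all factors of the product.\<close>

lemma foldr_simple_mult_absorb:
  assumes "\<And>\<beta>. \<beta> \<in> set \<beta>s \<Longrightarrow> f \<beta> = (\<lambda>i. \<beta> i + x \<beta> * \<alpha> i + y \<beta> * J_vec \<alpha> i)"
  shows "simple_mult N \<alpha> (foldr (simple_mult N) (map f \<beta>s) A) = simple_mult N \<alpha> (foldr (simple_mult N) \<beta>s A)"
  using assms
proof (induction \<beta>s)
  case (Cons \<beta> \<beta>s)
  have "simple_mult N \<alpha> (foldr (simple_mult N) (map f (\<beta> # \<beta>s)) A) =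
     simple_mult N \<alpha> (simple_mult N \<beta> (foldr (simple_mult N) (map f \<beta>s) A))"
    using Cons.prems[of \<beta>] by (simp add: simple_mult_absorb)
  also have "\<dots> = simple_mult N \<beta> (simple_mult N \<alpha> (foldr (simple_mult N) (map f \<beta>s) A))"
    by (rule simple_mult_commute)
  also have "simple_mult N \<alpha> (foldr (simple_mult N) (map f \<beta>s) A) = simple_mult N \<alpha> (foldr (simple_mult N) \<beta>s A)"
    using Cons by simp
  also have "simple_mult N \<beta> \<dots> = simple_mult N \<alpha> (simple_mult N \<beta> (foldr (simple_mult N) \<beta>s A))"
    by (rule simple_mult_commute)
  finally show ?case by simp
qed simp

text \<open>
  Gaussian elimination over the quaternions: a pivot column of the first vector is removed from
  all other vectors, so that only the pivot component of the first vector matters.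
\<close>

lemma simple_product_nonneg:
  assumes "C \<subseteq> {..<n}" "length \<alpha>s = card C"
    and "\<And>\<alpha> i. \<alpha> \<in> set \<alpha>s \<Longrightarrow> i < 2*n \<Longrightarrow> i div 2 \<notin> C \<Longrightarrow> \<alpha> i = 0"
  shows "\<exists>c\<ge>0. foldr (simple_mult (2*n)) \<alpha>s ext_one = (\<lambda>S. of_real c * monomial C S)"
  using assms
proof (induction "length \<alpha>s" arbitrary: \<alpha>s C)
  case 0
  then have "C = {}" using finite_subset by fastforce
  with 0 show ?case
    by (intro exI[of _ 1]) (auto simp: monomial_def ext_one_def blocks_def)
next
  case (Suc m)
  then obtain \<alpha> \<beta>s where \<alpha>s: "\<alpha>s = \<alpha> # \<beta>s" by (cases \<alpha>s) auto
  show ?case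
  proof (cases "\<exists>l\<in>C. \<alpha> (2*l) \<noteq> 0 \<or> \<alpha> (2*l+1) \<noteq> 0")
    case False
    have "\<alpha> i = 0" if "i < 2*n" for i
    proof (cases "i div 2 \<in> C")
      case True
      have "i = 2 * (i div 2) \<or> i = 2 * (i div 2) + 1" by presburger
      then show ?thesis using False True by metis
    qed (use Suc.prems(3)[of \<alpha>] \<alpha>s that in auto)
    then have "vec_mult (2*n) \<alpha> A = (\<lambda>S. 0)" for A by (intro ext) (simp add: vec_mult_def)
    then show ?thesis by (intro exI[of _ 0]) (simp add: \<alpha>s simple_mult_def)
  next
    case True
    then obtain l where l: "l \<in> C" "\<alpha> (2*l) \<noteq> 0 \<or> \<alpha> (2*l+1) \<noteq> 0" by blast
    define r where "r = complex_of_real ((cmod (\<alpha> (2*l)))\<^sup>2 + (cmod (\<alpha> (2*l+1)))\<^sup>2)"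
    have r: "r \<noteq> 0" "r = \<alpha> (2*l) * cnj (\<alpha> (2*l)) + \<alpha> (2*l+1) * cnj (\<alpha> (2*l+1))"
      unfolding r_def of_real_eq_0_iff using l(2)
      by (auto simp: sum_power2_eq_zero_iff complex_norm_square[symmetric])
    \<comment> \<open>Inside block \<open>l\<close> the vectors \<alpha> and J\<alpha> are
      orthogonal of squared length \<open>r\<close>, hence a basis of C^2. The numbers
      \<open>x \<beta>\<close> and \<open>y \<beta>\<close> are minus the coordinates of \<beta> in
      it, so \<open>f \<beta>\<close> vanishes on the block.\<close>
    define x y where
      "x \<beta> = - (\<beta> (2*l) * cnj (\<alpha> (2*l)) + \<beta> (2*l+1) * cnj (\<alpha> (2*l+1))) / r" and
      "y \<beta> = - (\<beta> (2*l+1) * \<alpha> (2*l) - \<beta> (2*l) * \<alpha> (2*l+1)) / r" for \<beta> :: "nat \<Rightarrow> complex"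
    define f where "f \<beta> = (\<lambda>i. \<beta> i + x \<beta> * \<alpha> i + y \<beta> * J_vec \<alpha> i)" for \<beta>
    have J: "J_vec \<alpha> (2*l) = - cnj (\<alpha> (2*l+1))" "J_vec \<alpha> (Suc (2*l)) = cnj (\<alpha> (2*l))"
      by (simp_all add: J_vec_def partner_def)
    have "r * f \<beta> (2*l) = 0" "r * f \<beta> (2*l+1) = 0" for \<beta>
      using r(1) by (simp_all add: f_def x_def y_def J distrib_left divide_simps)
        (simp_all add: r(2) algebra_simps)
    then have f0: "f \<beta> (2*l) = 0" "f \<beta> (2*l+1) = 0" for \<beta> using r(1) by auto
    have supp: "f \<beta> i = 0" if "\<beta> \<in> set \<beta>s" "i < 2*n" "i div 2 \<notin> C - {l}" for \<beta> i
    proof (cases "i div 2 = l")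
      case True
      then have "i = 2*l \<or> i = 2*l+1" by presburger
      then show ?thesis using f0 by auto
    next
      case False
      then have "i div 2 \<notin> C" using that by auto
      then show ?thesis using that Suc.prems(3)[of \<beta> i] Suc.prems(3)[of \<alpha> i] Suc.prems(3)[of \<alpha> "partner i"]
        by (simp add: f_def J_vec_def \<alpha>s)
    qed
    have fin: "finite C" using Suc.prems(1) finite_subset by blast
    have "\<exists>c\<ge>0. foldr (simple_mult (2*n)) (map f \<beta>s) ext_one = (\<lambda>S. of_real c * monomial (C - {l}) S)"
    proof (rule Suc.hyps(1))
      show "m = length (map f \<beta>s)" "length (map f \<beta>s) = card (C - {l})"
        using Suc.hyps(2) Suc.prems(2) l(1) fin by (auto simp: \<alpha>s)
    next
      fix \<beta> i assume "\<beta> \<in> set (map f \<beta>s)" "i < 2*n" "i div 2 \<notin> C - {l}"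
      then show "\<beta> i = 0" using supp by auto
    qed (use Suc.prems(1) in auto)
    then obtain c where c: "c \<ge> 0" "foldr (simple_mult (2*n)) (map f \<beta>s) ext_one = (\<lambda>S. of_real c * monomial (C - {l}) S)"
      by blast
    have lin: "simple_mult (2*n) \<alpha> (\<lambda>S. z * A S) S = z * simple_mult (2*n) \<alpha> A S" for z A S
      using form_mult_sum[of "2*n" _ "\<lambda>_. z" "\<lambda>_. A" "{0::nat}" S] by (simp add: simple_mult_eq_form_mult)
    have "foldr (simple_mult (2*n)) \<alpha>s ext_one = simple_mult (2*n) \<alpha> (foldr (simple_mult (2*n)) (map f \<beta>s) ext_one)"
      using foldr_simple_mult_absorb[of \<beta>s f x \<alpha> y "2*n" ext_one] by (simp add: \<alpha>s f_def)
    also have "\<dots> = (\<lambda>S. of_real (c * ((cmod (\<alpha> (2*l)))\<^sup>2 + (cmod (\<alpha> (2*l+1)))\<^sup>2)) * monomial C S)"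
      unfolding c(2) lin
      using simple_mult_monomial[OF Suc.prems(1) l(1), of \<alpha>] Suc.prems(3)[of \<alpha>]
      by (auto simp: \<alpha>s mult.assoc)
    finally show ?thesis using c(1) by (intro exI[of _ "c * ((cmod (\<alpha> (2*l)))\<^sup>2 + (cmod (\<alpha> (2*l+1)))\<^sup>2)"]) auto
  qed
qed

section \<open>Cholesky decomposition of quaternionic Hermitian matrices\<close>

definition herm_quad :: "nat \<Rightarrow> (nat \<Rightarrow> nat \<Rightarrow> complex) \<Rightarrow> (nat \<Rightarrow> complex) \<Rightarrow> complex" where
  "herm_quad N g c = (\<Sum>k<N. \<Sum>l<N. g k l * c k * cnj (c l))"

text \<open>The condition with \<open>partner\<close> singles out the complex 2n x 2n matrices that
  represent quaternionic Hermitian n x n matrices.\<close>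

definition J_hermitian_psd :: "nat \<Rightarrow> (nat \<Rightarrow> nat \<Rightarrow> complex) \<Rightarrow> bool" where
  "J_hermitian_psd n g \<longleftrightarrow>
     (\<forall>k<2*n. \<forall>l<2*n. g l k = cnj (g k l) \<and> g (partner l) (partner k) = (-1) ^ (k + l) * g k l) \<and>
     (\<forall>c. 0 \<le> Re (herm_quad (2*n) g c))"

text \<open>A quaternionic matrix of rank one; for nonzero \<alpha> its complex rank is two, since
  \<alpha> and J\<alpha> are orthogonal.\<close>

definition J_rank_one :: "(nat \<Rightarrow> complex) \<Rightarrow> nat \<Rightarrow> nat \<Rightarrow> complex" where
  "J_rank_one \<alpha> k l = \<alpha> k * cnj (\<alpha> l) + J_vec \<alpha> k * cnj (J_vec \<alpha> l)"

lemma minus_one_partner: "(-1) ^ partner i = - ((-1) ^ i :: complex)"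
  by (auto simp: minus_one_power_iff)

lemma J_rank_one_partner:
  "J_rank_one \<alpha> (partner l) (partner k) = (-1) ^ (k + l) * J_rank_one \<alpha> k l"
  by (simp add: J_rank_one_def J_vec_def power_add minus_one_partner algebra_simps)

text \<open>Changing one coordinate affects the form through a single column. This serves both to
  find kernel vectors and to complete squares.\<close>

lemma herm_quad_shift:
  assumes p: "p < N" and herm: "\<And>k l. k < N \<Longrightarrow> l < N \<Longrightarrow> g l k = cnj (g k l)"
  shows "herm_quad N g (\<lambda>k. c k + (if k = p then t else 0)) =
    herm_quad N g c + (\<Sum>k<N. g k p * c k) * cnj t + t * cnj (\<Sum>k<N. g k p * c k) + g p p * t * cnj t"
proof -
  let ?d = "\<lambda>k. if k = p then t else 0"
  have d1: "(\<Sum>l<N. h l * cnj (?d l)) = h p * cnj t" for h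
  proof -
    have "(\<Sum>l<N. h l * cnj (?d l)) = (\<Sum>l<N. if l = p then h p * cnj t else 0)"
      by (intro sum.cong) auto
    then show ?thesis using p by simp
  qed
  have d2: "(\<Sum>k<N. \<Sum>l<N. h k l * ?d k * r l) = (\<Sum>l<N. h p l * t * r l)" for h r
  proof -
    have "(\<Sum>k<N. \<Sum>l<N. h k l * ?d k * r l) = (\<Sum>k<N. if k = p then \<Sum>l<N. h p l * t * r l else 0)"
      by (intro sum.cong) auto
    then show ?thesis using p by simp
  qed
  have "herm_quad N g (\<lambda>k. c k + ?d k) = (\<Sum>k<N. \<Sum>l<N. g k l * c k * cnj (c l)) +
     (\<Sum>k<N. \<Sum>l<N. g k l * c k * cnj (?d l)) + (\<Sum>k<N. \<Sum>l<N. g k l * ?d k * cnj (c l)) +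
     (\<Sum>k<N. \<Sum>l<N. g k l * ?d k * cnj (?d l))"
    by (simp only: herm_quad_def complex_cnj_add sum.distrib distrib_left distrib_right) simp
  also have "(\<Sum>k<N. \<Sum>l<N. g k l * c k * cnj (?d l)) = (\<Sum>k<N. g k p * c k) * cnj t"
    unfolding d1 sum_distrib_right ..
  also have "(\<Sum>k<N. \<Sum>l<N. g k l * ?d k * cnj (c l)) = (\<Sum>l<N. g p l * t * cnj (c l))"
    unfolding d2 ..
  also have "\<dots> = t * cnj (\<Sum>k<N. g k p * c k)"
    using herm[OF _ p] by (simp add: sum_distrib_left mult_ac)
  also have "(\<Sum>k<N. \<Sum>l<N. g k l * ?d k * cnj (?d l)) = g p p * t * cnj t"
    unfolding d2[of g "\<lambda>l. cnj (?d l)"] by (rule d1)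
  finally show ?thesis by (simp add: herm_quad_def)
qed

text \<open>If the diagonal entry at \<open>p\<close> is 0, moving \<open>c\<close> in direction
  \<open>p\<close> changes the form linearly; a nonzero slope would make it negative.\<close>

lemma psd_kernel:
  assumes p: "p < N" and herm: "\<And>k l. k < N \<Longrightarrow> l < N \<Longrightarrow> g l k = cnj (g k l)"
    and psd: "\<And>c. 0 \<le> Re (herm_quad N g c)" and "g p p = 0"
  shows "(\<Sum>k<N. g k p * c k) = 0"
proof (rule ccontr)
  let ?x = "\<Sum>k<N. g k p * c k"
  assume x: "?x \<noteq> 0"
  \<comment> \<open>Chosen to bring the value of the form down to exactly -1.\<close>
  define r where "r = (Re (herm_quad N g c) + 1) / (2 * (cmod ?x)\<^sup>2)"
  have "0 \<le> Re (herm_quad N g (\<lambda>k. c k + (if k = p then - of_real r * ?x else 0)))" by (rule psd)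
  also have "\<dots> = Re (herm_quad N g c) - 2 * r * (cmod ?x)\<^sup>2"
  proof -
    have "Re (q + X * cnj (- of_real r * X) + - of_real r * X * cnj X + 0) = Re q - 2 * r * (cmod X)\<^sup>2" for q X
      by (simp add: cmod_power2) (simp add: power2_eq_square algebra_simps)
    then show ?thesis by (subst herm_quad_shift[OF p herm]) (simp_all only: assms(4) mult_zero_left)
  qed
  also have "\<dots> = -1" 
  proof -
    have "2 * r * (cmod ?x)\<^sup>2 = Re (herm_quad N g c) + 1" using x by (simp add: r_def)
    then show ?thesis by linarith
  qed
  finally show False by simp
qed

text \<open>Splits off one quaternionic pivot, that is the columns \<open>p\<close> and
  \<open>p + 1\<close>. One vector \<alpha> clears both, because the scaled second column is
  J\<alpha>. The last alternative keeps columns cleared that are already 0, as the induction over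
  the pivots demands.\<close>

lemma cholesky_step:
  assumes g: "J_hermitian_psd n g" and p: "p < 2*n" "even p"
  obtains \<alpha> where
    "J_hermitian_psd n (\<lambda>k l. g k l - J_rank_one \<alpha> k l)"
    "\<And>k r. k < 2*n \<Longrightarrow> r < 2*n \<Longrightarrow> r = p \<or> r = p + 1 \<or> (\<forall>k<2*n. g k r = 0) \<Longrightarrow> g k r - J_rank_one \<alpha> k r = 0"
proof -
  let ?N = "2*n"
  define q where "q = p + 1"
  have q: "q < ?N" "partner p = q" "partner q = p" "odd q" 
  proof -
    obtain m where "p = 2 * m" using p(2) by (elim evenE)
    then show "q < ?N" "partner p = q" "partner q = p" "odd q" using p(1) by (auto simp: partner_def q_def)
  qed
  have herm: "g l k = cnj (g k l)" if "k < ?N" "l < ?N" for k l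
    using g that unfolding J_hermitian_psd_def by blast
  have J: "g (partner l) (partner k) = (-1) ^ (k + l) * g k l" if "k < ?N" "l < ?N" for k l
    using g that unfolding J_hermitian_psd_def by blast
  have psd: "0 \<le> Re (herm_quad ?N g c)" for c using g unfolding J_hermitian_psd_def by blast
  \<comment> \<open>J-symmetry makes the 2 x 2 pivot block a real multiple \<open>P\<close> of the
    identity, so one scaling serves both columns.\<close>
  have qq: "g q q = g p p" using J[of p p] p q by (simp add: power_add[symmetric])
  have pq0: "g p q = 0" using J[of p q] p q by (simp add: minus_one_power_iff)
  have qp0: "g q p = 0" using pq0 herm[of p q] p q by simp
  define P where "P = Re (g p p)"
  have gpp: "g p p = of_real P" using herm[OF p(1) p(1)] by (simp add: P_def complex_eq_iff)
  have gqq: "g q q = of_real P" using qq gpp by simp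
  have "0 \<le> Re (herm_quad ?N g (\<lambda>k. (\<lambda>k. 0) k + (if k = p then 1 else 0)))" by (rule psd)
  then have P0: "P \<ge> 0"
    by (subst (asm) herm_quad_shift[OF p(1) herm]) (auto simp: herm_quad_def gpp)
  \<comment> \<open>If \<open>P = 0\<close>, division by zero makes \<alpha> vanish and nothing is
    subtracted; both pivot columns are 0 in that case by \<open>psd_kernel\<close>.\<close>
  define \<alpha> where "\<alpha> k = g k p / of_real (sqrt P)" for k
  have J\<alpha>: "J_vec \<alpha> k = g k q / of_real (sqrt P)" if k: "k < ?N" for k
  proof -
    have pk: "partner k < ?N" using k by simp
    have "J_vec \<alpha> k = (-1) ^ (k + 1) * g p (partner k) / of_real (sqrt P)"
      using herm[OF pk p(1)] by (simp add: J_vec_def \<alpha>_def)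
    also have "g p (partner k) = (-1) ^ (k + q) * g k q" using J[of k q] k q by simp
    finally show ?thesis using q by (simp add: power_add minus_one_power_iff)
  qed
  have rk: "J_rank_one \<alpha> k l = (g k p * g p l + g k q * g q l) / of_real P" if "k < ?N" "l < ?N" for k l
  proof -
    have "of_real (sqrt P) * of_real (sqrt P) = complex_of_real P"
      using P0 by (simp flip: of_real_mult)
    then show ?thesis
      using that herm[of l p] herm[of l q] p q
      by (simp add: J_rank_one_def J\<alpha> \<alpha>_def add_divide_distrib)
  qed
  have P_zero: "g k p = 0" "g k q = 0" if "P = 0" "k < ?N" for k
    using psd_kernel[OF p(1) herm psd, of "\<lambda>j. if j = k then 1 else 0"]
      psd_kernel[OF q(1) herm psd, of "\<lambda>j. if j = k then 1 else 0"] that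
    by (simp_all add: gpp gqq if_distrib cong: if_cong)
  have "J_hermitian_psd n (\<lambda>k l. g k l - J_rank_one \<alpha> k l)"
    unfolding J_hermitian_psd_def
  proof (intro conjI allI impI)
    fix k l assume kl: "k < ?N" "l < ?N"
    show "g l k - J_rank_one \<alpha> l k = cnj (g k l - J_rank_one \<alpha> k l)"
      using herm[OF kl] by (simp add: J_rank_one_def mult.commute)
    show "g (partner l) (partner k) - J_rank_one \<alpha> (partner l) (partner k) =
          (- 1) ^ (k + l) * (g k l - J_rank_one \<alpha> k l)"
      using J[OF kl] by (simp add: J_rank_one_partner algebra_simps)
  next
    fix c
    define x y where "x = (\<Sum>k<?N. g k p * c k)" and "y = (\<Sum>k<?N. g k q * c k)"
    have "herm_quad ?N (\<lambda>k l. g k l - J_rank_one \<alpha> k l) c =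
       (\<Sum>k<?N. \<Sum>l<?N. g k l * c k * cnj (c l) - (g k p * c k) * (g p l * cnj (c l)) / P
           - (g k q * c k) * (g q l * cnj (c l)) / P)"
      unfolding herm_quad_def by (intro sum.cong refl) (simp add: rk diff_divide_distrib add_divide_distrib algebra_simps)
    also have "\<dots> = herm_quad ?N g c - x * (\<Sum>l<?N. g p l * cnj (c l)) / P - y * (\<Sum>l<?N. g q l * cnj (c l)) / P"
      by (simp add: herm_quad_def sum_subtractf x_def y_def sum_product sum_divide_distrib)
    also have "(\<Sum>l<?N. g p l * cnj (c l)) = cnj x" unfolding x_def using herm[OF _ p(1)] by (simp add: mult.commute)
    also have "(\<Sum>l<?N. g q l * cnj (c l)) = cnj y" unfolding y_def using herm[OF _ q(1)] by (simp add: mult.commute)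
    finally have quad: "herm_quad ?N (\<lambda>k l. g k l - J_rank_one \<alpha> k l) c = herm_quad ?N g c - x * cnj x / P - y * cnj y / P" .
    show "0 \<le> Re (herm_quad ?N (\<lambda>k l. g k l - J_rank_one \<alpha> k l) c)"
    proof (cases "P = 0")
      case True
      then show ?thesis using psd[of c] quad by simp
    next
      case False
      \<comment> \<open>The remainder is a Schur complement: its value at \<open>c\<close> is the
        value of \<open>g\<close> at \<open>c\<close> moved by -x/P in \<open>p\<close> and by -y/P
        in \<open>q\<close>. The two shifts do not interact because
        \<open>g p q = 0\<close>.\<close>
      let ?c = "\<lambda>k. c k + (if k = p then - x / P else 0)"
      have 1: "herm_quad ?N g ?c = herm_quad ?N g c - x * cnj x / P"
      proof -
        have "herm_quad ?N g ?c = herm_quad ?N g c + x * cnj (- x / P) + - x / P * cnj x + g p p * (- x / P) * cnj (- x / P)"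
          unfolding x_def by (rule herm_quad_shift[OF p(1) herm])
        then show ?thesis using False by (simp add: gpp)
      qed
      have "(\<Sum>k<?N. g k q * ?c k) = y + (\<Sum>k<?N. if k = p then g p q * (- x / P) else 0)"
        unfolding y_def sum.distrib[symmetric] by (intro sum.cong) (auto simp: algebra_simps)
      then have y: "(\<Sum>k<?N. g k q * ?c k) = y" by (simp add: pq0)
      have "herm_quad ?N g (\<lambda>k. ?c k + (if k = q then - y / P else 0)) = herm_quad ?N g c - x * cnj x / P - y * cnj y / P"
      proof -
        have "herm_quad ?N g (\<lambda>k. ?c k + (if k = q then - y / P else 0)) =
          herm_quad ?N g ?c + (\<Sum>k<?N. g k q * ?c k) * cnj (- y / P) +
            - y / P * cnj (\<Sum>k<?N. g k q * ?c k) + g q q * (- y / P) * cnj (- y / P)"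
          by (rule herm_quad_shift[OF q(1) herm])
        from this[unfolded y] show ?thesis using False by (simp add: gqq 1)
      qed
      then show ?thesis using psd[of "\<lambda>k. ?c k + (if k = q then - y / P else 0)"] quad by simp
    qed
  qed
  moreover have "g k r - J_rank_one \<alpha> k r = 0"
    if k: "k < ?N" and r: "r < ?N" "r = p \<or> r = p + 1 \<or> (\<forall>k<?N. g k r = 0)" for k r
  proof (cases "P = 0")
    case True
    have "g k r = 0" using r(2) P_zero[OF True k] k by (auto simp: q_def)
    then show ?thesis using True k r(1) by (simp add: rk)
  next
    case False
    from r(2) consider "r = p" | "r = q" | "\<forall>k<?N. g k r = 0" by (auto simp: q_def)
    then show ?thesis
    proof cases
      case 3
      then show ?thesis using k r(1) p q by (simp add: rk)
    qed (use False k p q in \<open>simp_all add: rk gpp gqq pq0 qp0\<close>)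
  qed
  ultimately show thesis using that by blast
qed

lemma cholesky:
  assumes "J_hermitian_psd n g"
  shows "\<exists>\<alpha>. \<forall>k<2*n. \<forall>l<2*n. g k l = (\<Sum>j<n. J_rank_one (\<alpha> j) k l)"
proof -
  \<comment> \<open>\<open>d\<close> counts the pivots still to be split off, the first
    \<open>n - d\<close> pairs of columns being 0. The vector found for the pair \<open>m\<close> is
    stored at index \<open>m\<close>.\<close>
  have "\<exists>\<alpha>. \<forall>k<2*n. \<forall>l<2*n. g k l = (\<Sum>j\<in>{n-d..<n}. J_rank_one (\<alpha> j) k l)"
    if "d \<le> n" "J_hermitian_psd n g" "\<And>k l. k < 2*n \<Longrightarrow> l < 2*(n-d) \<Longrightarrow> g k l = 0" for d g
    using that
  proof (induction d arbitrary: g)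
    case 0
    then show ?case by simp
  next
    case (Suc d)
    define m where "m = n - Suc d"
    have m: "2*m < 2*n" "n - d = Suc m" "m < n" using Suc.prems(1) by (auto simp: m_def)
    obtain \<alpha> where \<alpha>: "J_hermitian_psd n (\<lambda>k l. g k l - J_rank_one \<alpha> k l)"
      "\<And>k r. k < 2*n \<Longrightarrow> r < 2*n \<Longrightarrow> r = 2*m \<or> r = 2*m + 1 \<or> (\<forall>k<2*n. g k r = 0) \<Longrightarrow> g k r - J_rank_one \<alpha> k r = 0"
      using cholesky_step[OF Suc.prems(2) m(1)] by auto
    have "g k l - J_rank_one \<alpha> k l = 0" if "k < 2*n" "l < 2*(n-d)" for k l
    proof -
      have "l < 2*m \<or> l = 2*m \<or> l = 2*m+1" using that m by auto
      moreover have "\<forall>k<2*n. g k l = 0" if "l < 2*m" using Suc.prems(3) that by (simp add: m_def)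
      ultimately show ?thesis using \<alpha>(2)[of k l] that m by auto
    qed
    then obtain \<beta> where \<beta>: "\<forall>k<2*n. \<forall>l<2*n. g k l - J_rank_one \<alpha> k l = (\<Sum>j\<in>{n-d..<n}. J_rank_one (\<beta> j) k l)"
      using Suc.IH[OF _ \<alpha>(1)] Suc.prems(1) by auto
    have "{n - Suc d..<n} = insert m {n-d..<n}" using m by (auto simp: m_def)
    then have "\<forall>k<2*n. \<forall>l<2*n. g k l = (\<Sum>j\<in>{n - Suc d..<n}. J_rank_one ((\<beta>(m := \<alpha>)) j) k l)"
      using \<beta> m by (auto simp: algebra_simps intro!: sum.cong)
    then show ?case by blast
  qed
  from this[of n g] show ?thesis using assms by (simp add: atLeast0LessThan)
qed

text \<open>The Hermitian matrix of a (2,0)-form: antisymmetrised coefficients with the second slot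
  twisted by J. Its J-symmetry is automatic from the antisymmetrisation, so positivity is stated by
  Hermitian symmetry and semidefiniteness.\<close>

definition herm_of_form :: "(nat \<Rightarrow> nat \<Rightarrow> complex) \<Rightarrow> nat \<Rightarrow> nat \<Rightarrow> complex" where
  "herm_of_form a k l = (-1) ^ l * (a k (partner l) - a (partner l) k)"

definition positive_form :: "nat \<Rightarrow> (nat \<Rightarrow> nat \<Rightarrow> complex) \<Rightarrow> bool" where
  "positive_form n a \<longleftrightarrow>
     (\<forall>k<2*n. \<forall>l<2*n. herm_of_form a l k = cnj (herm_of_form a k l)) \<and>
     (\<forall>c. 0 \<le> Re (herm_quad (2*n) (herm_of_form a) c))"

lemma form_mult_sum_left:
  "form_mult N (\<lambda>k i. \<Sum>x\<in>I. c x * a x k i) A S = (\<Sum>x\<in>I. c x * form_mult N (a x) A S)"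
proof -
  have "form_mult N (\<lambda>k i. \<Sum>x\<in>I. c x * a x k i) A S =
    (\<Sum>k<N. \<Sum>i<N. \<Sum>x\<in>I. c x * (a x k i * dz_mult k (dz_mult i A) S))"
    by (simp add: form_mult_def sum_distrib_right mult.assoc)
  also have "\<dots> = (\<Sum>x\<in>I. \<Sum>k<N. \<Sum>i<N. c x * (a x k i * dz_mult k (dz_mult i A) S))"
    by (subst sum.swap[of _ I]) (intro sum.cong refl sum.swap)
  finally show ?thesis by (simp add: form_mult_def sum_distrib_left)
qed

text \<open>Undoing the twist by J turns the Cholesky term of \<alpha> into \<alpha> \<and>
  J\<alpha>: as J^2 = -1, the second half of \<open>J_rank_one\<close> becomes minus the transpose
  of the first.\<close>

lemma positive_form_decomposition:
  assumes "positive_form n a"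
  shows "\<exists>\<alpha>. \<forall>A. form_mult (2*n) a A = (\<lambda>S. \<Sum>j<n. simple_mult (2*n) (\<alpha> j) A S)"
proof -
  have "herm_of_form a (partner l) (partner k) = (-1) ^ (k + l) * herm_of_form a k l" for k l
    by (simp add: herm_of_form_def minus_one_partner power_add algebra_simps)
  then have "J_hermitian_psd n (herm_of_form a)"
    using assms unfolding J_hermitian_psd_def positive_form_def by blast
  from cholesky[OF this] obtain \<alpha> where
    \<alpha>: "\<And>k l. k < 2*n \<Longrightarrow> l < 2*n \<Longrightarrow> herm_of_form a k l = (\<Sum>j<n. J_rank_one (\<alpha> j) k l)" by blast
  have "form_mult (2*n) a A S = (\<Sum>j<n. simple_mult (2*n) (\<alpha> j) A S)" for A S
  proof -
    have "form_mult (2*n) a A = form_mult (2*n) (\<lambda>k i. \<Sum>j<n. 1 * (\<alpha> j k * J_vec (\<alpha> j) i)) A"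
    proof (rule form_mult_eqI)
      fix k i assume ki: "k < 2*n" "i < 2*n"
      have "a k i - a i k = (-1) ^ (i + 1) * herm_of_form a k (partner i)"
        by (simp add: herm_of_form_def minus_one_partner)
      also have "\<dots> = (\<Sum>j<n. \<alpha> j k * J_vec (\<alpha> j) i + J_vec (\<alpha> j) k * J_vec (J_vec (\<alpha> j)) i)"
        unfolding \<alpha>[OF ki(1) partner_less[THEN iffD2, OF ki(2)]] by (simp add: J_rank_one_def sum_distrib_left J_vec_def[of _ i] algebra_simps)
      finally show "a k i - a i k = (\<Sum>j<n. 1 * (\<alpha> j k * J_vec (\<alpha> j) i)) - (\<Sum>j<n. 1 * (\<alpha> j i * J_vec (\<alpha> j) k))"
        by (simp add: J_vec_J_vec sum_subtractf mult.commute)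
    qed
    then have "form_mult (2*n) a A S = form_mult (2*n) (\<lambda>k i. \<Sum>j<n. 1 * (\<alpha> j k * J_vec (\<alpha> j) i)) A S"
      by (rule fun_cong)
    also have "\<dots> = (\<Sum>j<n. 1 * form_mult (2*n) (\<lambda>k i. \<alpha> j k * J_vec (\<alpha> j) i) A S)"
      by (rule form_mult_sum_left)
    finally show ?thesis by (simp add: simple_mult_eq_form_mult)
  qed
  then show ?thesis by blast
qed

lemma foldr_simple_mult_sum:
  "foldr (simple_mult N) \<beta>s (\<lambda>S. \<Sum>x\<in>I. A x S) S = (\<Sum>x\<in>I. foldr (simple_mult N) \<beta>s (A x) S)"
proof (induction \<beta>s arbitrary: S)
  case (Cons \<beta> \<beta>s)
  have "foldr (simple_mult N) \<beta>s (\<lambda>S. \<Sum>x\<in>I. A x S) = (\<lambda>S. \<Sum>x\<in>I. 1 * foldr (simple_mult N) \<beta>s (A x) S)"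
    using Cons by auto
  moreover have "simple_mult N \<beta> (\<lambda>S. \<Sum>x\<in>I. 1 * B x S) S = (\<Sum>x\<in>I. simple_mult N \<beta> (B x) S)" for B
    unfolding simple_mult_eq_form_mult form_mult_sum by simp
  ultimately show ?case by simp
qed simp

lemma positive_forms_product_nonneg:
  assumes "length as = n" "\<And>a. a \<in> set as \<Longrightarrow> positive_form n a"
  shows "\<exists>r\<ge>0. foldr (form_mult (2*n)) as ext_one {..<2*n} = complex_of_real r"
proof -
  \<comment> \<open>Generalised by a list \<open>\<beta>s\<close> of factors that are already split.
    Once \<open>as\<close> is empty, \<open>simple_product_nonneg\<close> applies with all
    blocks.\<close>
  have "\<exists>r\<ge>0. foldr (simple_mult (2*n)) \<beta>s (foldr (form_mult (2*n)) as ext_one) {..<2*n} = complex_of_real r"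
    if "length \<beta>s + length as = n" "\<And>a. a \<in> set as \<Longrightarrow> positive_form n a" for \<beta>s as
    using that
  proof (induction as arbitrary: \<beta>s)
    case Nil
    have "\<exists>c\<ge>0. foldr (simple_mult (2*n)) \<beta>s ext_one = (\<lambda>S. complex_of_real c * monomial {..<n} S)"
      by (rule simple_product_nonneg) (use Nil in \<open>auto simp: less_mult_imp_div_less mult.commute\<close>)
    then show ?case by (auto simp: monomial_def blocks_lessThan)
  next
    case (Cons a as)
    obtain \<alpha> where \<alpha>: "\<And>A. form_mult (2*n) a A = (\<lambda>S. \<Sum>j<n. simple_mult (2*n) (\<alpha> j) A S)"
      using positive_form_decomposition[of n a] Cons.prems(2) by auto
    let ?B = "foldr (form_mult (2*n)) as ext_one"
    have "\<exists>r\<ge>0. foldr (simple_mult (2*n)) (\<beta>s @ [\<alpha> j]) ?B {..<2*n} = complex_of_real r" for j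
      by (rule Cons.IH) (use Cons.prems in auto)
    then obtain r where r: "\<And>j. r j \<ge> 0" "\<And>j. foldr (simple_mult (2*n)) (\<beta>s @ [\<alpha> j]) ?B {..<2*n} = complex_of_real (r j)"
      by metis
    have "foldr (simple_mult (2*n)) \<beta>s (foldr (form_mult (2*n)) (a # as) ext_one) {..<2*n} = complex_of_real (\<Sum>j<n. r j)"
      using r(2) by (simp add: \<alpha> foldr_simple_mult_sum)
    then show ?case using r(1) by (intro exI[of _ "\<Sum>j<n. r j"]) (auto intro: sum_nonneg)
  qed
  from this[of "[]" as] show ?thesis using assms by simp
qed


section \<open>Powers of a rank-one perturbation of the standard form\<close>

text \<open>The form dz_0 \<and> dz_1 + dz_2 \<and> dz_3 + ..., which belongs to the potential
  |q|^2/2.\<close>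

definition std_form :: "nat \<Rightarrow> nat \<Rightarrow> complex" where
  "std_form k i = (if even k \<and> i = k + 1 then 1 else 0)"

lemma form_mult_std:
  "form_mult (2*n) std_form A S = (\<Sum>l<n. dz_mult (2*l) (dz_mult (2*l+1) A) S)"
proof -
  have "form_mult (2*n) std_form A S = (\<Sum>k<2*n. if even k then dz_mult k (dz_mult (k+1) A) S else 0)"
    unfolding form_mult_def
  proof (intro sum.cong refl)
    fix k assume "k \<in> {..<2*n}"
    then have k: "k < 2*n" by simp
    have "(\<Sum>i<2*n. std_form k i * dz_mult k (dz_mult i A) S) =
      (\<Sum>i<2*n. if i = k + 1 then (if even k then dz_mult k (dz_mult (k+1) A) S else 0) else 0)"
      by (intro sum.cong) (auto simp: std_form_def)
    moreover have "k + 1 < 2*n" if "even k" using k that by (elim evenE) simp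
    ultimately show "(\<Sum>i<2*n. std_form k i * dz_mult k (dz_mult i A) S) =
      (if even k then dz_mult k (dz_mult (k+1) A) S else 0)" by auto
  qed
  also have "\<dots> = (\<Sum>k\<in>(\<lambda>l. 2*l) ` {..<n}. dz_mult k (dz_mult (k+1) A) S)"
    by (rule sum.mono_neutral_cong_right) (auto elim!: evenE)
  also have "\<dots> = (\<Sum>l<n. dz_mult (2*l) (dz_mult (2*l+1) A) S)"
    by (subst sum.reindex) (auto simp: inj_on_def)
  finally show ?thesis .
qed

text \<open>A product of \<open>m\<close> distinct blocks arises from m! orders of its factors, and
  a repeated block gives 0.\<close>

lemma std_form_power:
  "(form_mult (2*n) std_form ^^ m) ext_one = (\<lambda>S. if \<exists>C\<subseteq>{..<n}. card C = m \<and> S = blocks C then fact m else 0)"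
proof (induction m)
  case 0
  have "(\<exists>C\<subseteq>{..<n}. card C = 0 \<and> S = blocks C) \<longleftrightarrow> S = {}" for S
    using finite_subset[of _ "{..<n}"] by (auto simp: blocks_def)
  then show ?case by (auto simp: ext_one_def)
next
  case (Suc m)
  let ?B = "(form_mult (2*n) std_form ^^ m) ext_one"
  show ?case
  proof
    fix S
    have pw: "(form_mult (2*n) std_form ^^ Suc m) ext_one S = (\<Sum>l<n. if 2*l \<in> S \<and> 2*l+1 \<in> S then ?B (S - {2*l,2*l+1}) else 0)"
      by (simp add: form_mult_std dz_mult_pair[simplified])
    show "(form_mult (2*n) std_form ^^ Suc m) ext_one S =
       (if \<exists>C\<subseteq>{..<n}. card C = Suc m \<and> S = blocks C then fact (Suc m) else 0)"
    proof (cases "\<exists>C\<subseteq>{..<n}. card C = Suc m \<and> S = blocks C")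
      case True
      then obtain C where C: "C \<subseteq> {..<n}" "card C = Suc m" "S = blocks C" by blast
      have fin: "finite C" using C(1) finite_subset by blast
      have "(if 2*l \<in> S \<and> 2*l+1 \<in> S then ?B (S - {2*l,2*l+1}) else 0) = (if l \<in> C then fact m else 0)" if "l < n" for l
      proof -
        have "\<exists>C'\<subseteq>{..<n}. card C' = m \<and> blocks (C - {l}) = blocks C'" if "l \<in> C"
          using C fin that by (intro exI[of _ "C - {l}"]) auto
        then show ?thesis unfolding C(3) blocks_remove Suc by (auto simp: blocks_pair)
      qed
      then have "(form_mult (2*n) std_form ^^ Suc m) ext_one S = (\<Sum>l<n. if l \<in> C then fact m else 0)"
        unfolding pw by (intro sum.cong) auto
      also have "\<dots> = of_nat (card C) * fact m"
        using C(1) by (simp add: sum.If_cases Int_absorb1 fin)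
      finally show ?thesis using True C(2) by (simp add: algebra_simps)
    next
      case False
      have "(if 2*l \<in> S \<and> 2*l+1 \<in> S then ?B (S - {2*l,2*l+1}) else 0) = 0" if "l < n" for l
      proof (rule ccontr)
        assume *: "\<not> ?thesis"
        then have S: "2*l \<in> S" "2*l+1 \<in> S" "?B (S - {2*l,2*l+1}) \<noteq> 0" by (auto split: if_splits)
        then obtain C where C: "C \<subseteq> {..<n}" "card C = m" "S - {2*l,2*l+1} = blocks C"
          unfolding Suc by (auto split: if_splits)
        have "l \<notin> C" using C(3) blocks_pair[of l C] by blast
        moreover have "S = blocks (insert l C)" using S C(3) by (auto simp: blocks_insert)
        ultimately show False using False C that finite_subset[OF C(1)]
          by (metis (no_types, lifting) card_insert_disjoint finite_lessThan insert_subset lessThan_iff)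
      qed
      then show ?thesis unfolding pw if_not_P[OF False] by (intro sum.neutral) auto
    qed
  qed
qed

text \<open>A pair with \<open>i\<close> different from \<open>partner k\<close> would leave a
  half-filled block, which does not occur in the power. On the remaining pairs the sign of
  \<open>diag\<close> cancels that of \<open>J_vec\<close>.\<close>

lemma simple_mult_std_power:
  assumes "n > 0"
  shows "simple_mult (2*n) \<alpha> ((form_mult (2*n) std_form ^^ (n - 1)) ext_one) {..<2*n} =
    fact (n - 1) * (\<Sum>k<2*n. of_real ((cmod (\<alpha> k))\<^sup>2))"
proof -
  define B where "B = (form_mult (2*n) std_form ^^ (n - 1)) ext_one"
  have Bval: "B ({..<2*n} - {2*l,2*l+1}) = fact (n - 1)" if "l < n" for l
  proof -
    have "{..<2*n} - {2*l,2*l+1} = blocks ({..<n} - {l})"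
      by (simp add: blocks_lessThan[symmetric] blocks_remove[simplified])
    then show ?thesis unfolding B_def std_form_power using that
      by (auto intro!: exI[of _ "{..<n} - {l}"])
  qed
  have zero: "dz_mult k (dz_mult i B) {..<2*n} = 0" if ki: "k < 2*n" "i < 2*n" "i \<noteq> partner k" for k i
  proof (cases "i = k")
    case False
    have "B ({..<2*n} - {k} - {i}) = 0"
    proof (rule ccontr)
      assume "B ({..<2*n} - {k} - {i}) \<noteq> 0"
      then obtain C where C: "{..<2*n} - {k} - {i} = blocks C" unfolding B_def std_form_power by (auto split: if_splits)
      have "k \<notin> blocks C" using C by auto
      then have "partner k \<notin> blocks C" by (simp add: blocks_def)
      moreover have "partner k \<noteq> k" using even_partner[of k] by metis
      ultimately have "partner k \<notin> {..<2*n} - {k} - {i}" using C by simp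
      then show False using ki \<open>partner k \<noteq> k\<close> by auto
    qed
    then show ?thesis by (simp add: dz_mult_def)
  qed (simp add: dz_mult_def)
  have diag: "dz_mult k (dz_mult (partner k) B) {..<2*n} = (-1) ^ k * fact (n - 1)" if "k < 2*n" for k
  proof (cases "even k")
    case True
    then obtain l where "k = 2*l" by (elim evenE)
    then show ?thesis using that Bval[of l] dz_mult_pair[of l B "{..<2*n}"] by (auto simp: partner_def)
  next
    case False
    then obtain l where "k = 2*l+1" by (elim oddE)
    then show ?thesis using that Bval[of l] dz_mult_pair[of l B "{..<2*n}"]
      dz_mult_anticommute[of k "2*l" B "{..<2*n}"] by (auto simp: partner_def)
  qed
  have "simple_mult (2*n) \<alpha> B {..<2*n} = (\<Sum>k<2*n. \<Sum>i<2*n. if i = partner k then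
      \<alpha> k * J_vec \<alpha> (partner k) * ((-1) ^ k * fact (n - 1)) else 0)"
    unfolding simple_mult_eq_form_mult form_mult_def[of "2*n" "\<lambda>k i. \<alpha> k * J_vec \<alpha> i"]
    by (intro sum.cong refl) (auto simp: zero diag)
  also have "\<dots> = (\<Sum>k<2*n. \<alpha> k * J_vec \<alpha> (partner k) * ((-1) ^ k * fact (n - 1)))"
    by (intro sum.cong refl) simp
  also have "\<dots> = (\<Sum>k<2*n. fact (n - 1) * of_real ((cmod (\<alpha> k))\<^sup>2))"
    by (intro sum.cong refl)
       (simp add: J_vec_def minus_one_partner complex_norm_square minus_one_power_iff del: of_real_power)
  finally show ?thesis by (simp add: sum_distrib_left B_def)
qed

text \<open>The square of \<alpha> \<and> J\<alpha> is 0, so the binomial expansion stops after the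
  linear term, whose factor is n (n-1)! = n!.\<close>

lemma std_plus_simple_power:
  assumes n: "n > 0" and a: "\<And>k i. k < 2*n \<Longrightarrow> i < 2*n \<Longrightarrow>
     a k i - a i k = (x * std_form k i + y * (\<alpha> k * J_vec \<alpha> i)) - (x * std_form i k + y * (\<alpha> i * J_vec \<alpha> k))"
  shows "(form_mult (2*n) a ^^ n) ext_one {..<2*n} =
    fact n * (x ^ n + x ^ (n - 1) * y * (\<Sum>k<2*n. of_real ((cmod (\<alpha> k))\<^sup>2)))"
proof -
  let ?K = "form_mult (2*n) std_form" and ?R = "simple_mult (2*n) \<alpha>"
  have step: "form_mult (2*n) a A S = x * ?K A S + y * ?R A S" for A S
  proof -
    have "form_mult (2*n) a A = form_mult (2*n) (\<lambda>k i. x * std_form k i + y * (\<alpha> k * J_vec \<alpha> i)) A"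
      by (rule form_mult_eqI) (rule a)
    then show ?thesis
      by (simp add: simple_mult_eq_form_mult form_mult_def sum.distrib sum_distrib_left algebra_simps)
  qed
  have lin: "form_mult (2*n) b (\<lambda>S. u * A S + v * B S) S = u * form_mult (2*n) b A S + v * form_mult (2*n) b B S" for b u v A B S
    using form_mult_sum[of "2*n" b "\<lambda>j::bool. if j then u else v" "\<lambda>j. if j then A else B" UNIV S]
    by (simp add: UNIV_bool add.commute)
  have RR: "?R (?R A) = (\<lambda>S. 0)" for A
    by (simp add: simple_mult_def vec_mult_anticommute[of _ "J_vec \<alpha>" \<alpha>] vec_mult_uminus vec_mult_self vec_mult_zero)
  have KR: "?K (?R A) = ?R (?K A)" for A
    by (simp add: simple_mult_eq_form_mult form_mult_commute)
  \<comment> \<open>At \<open>m = 0\<close> the truncated difference \<open>m - 1\<close> is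
    harmless because of the factor \<open>of_nat m\<close>.\<close>
  have pw: "(form_mult (2*n) a ^^ m) ext_one =
     (\<lambda>S. x ^ m * (?K ^^ m) ext_one S + (of_nat m * x ^ (m - 1) * y) * ?R ((?K ^^ (m - 1)) ext_one) S)" for m
  proof (induction m)
    case (Suc m)
    let ?A = "(?K ^^ m) ext_one" and ?B = "(?K ^^ (m - 1)) ext_one"
    show ?case
    proof
      fix S
      have RB: "x * (of_nat m * x ^ (m - 1) * y) * ?K (?R ?B) S = of_nat m * x ^ m * y * ?R ?A S"
      proof (cases m)
        case (Suc j)
        have "?K (?R ((?K ^^ j) ext_one)) = ?R (?K ((?K ^^ j) ext_one))" by (rule KR)
        then show ?thesis by (simp add: Suc del: mult_Suc_right)
      qed simp
      have "(form_mult (2*n) a ^^ Suc m) ext_one S = form_mult (2*n) a ((form_mult (2*n) a ^^ m) ext_one) S" by simp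
      also have "\<dots> = x * (x ^ m * ?K ?A S + (of_nat m * x ^ (m - 1) * y) * ?K (?R ?B) S)
          + y * (x ^ m * ?R ?A S + (of_nat m * x ^ (m - 1) * y) * ?R (?R ?B) S)"
        unfolding step Suc by (simp add: lin simple_mult_eq_form_mult)
      also have "\<dots> = x ^ Suc m * ?K ?A S + of_nat (Suc m) * x ^ m * y * ?R ?A S"
      proof -
        have "x * (x ^ m * a + c * b) + y * (x ^ m * r + c * 0) = x ^ Suc m * a + of_nat (Suc m) * x ^ m * y * r"
          if "x * c * b = of_nat m * x ^ m * y * r" for a b c r
          using that by (simp add: algebra_simps)
        from this[OF RB] show ?thesis by (simp only: RR)
      qed
      finally show "(form_mult (2*n) a ^^ Suc m) ext_one S = x ^ Suc m * (?K ^^ Suc m) ext_one S +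
          (of_nat (Suc m) * x ^ (Suc m - 1) * y) * ?R ((?K ^^ (Suc m - 1)) ext_one) S" by simp
    qed
  qed simp
  have "\<exists>C\<subseteq>{..<n}. card C = n \<and> {..<2*n} = blocks C"
    by (intro exI[of _ "{..<n}"]) (simp add: blocks_lessThan)
  then have "(?K ^^ n) ext_one {..<2*n} = fact n" by (simp add: std_form_power)
  moreover have "of_nat n * fact (n - 1) = (fact n :: complex)"
    using n by (simp add: fact_reduce)
  ultimately show ?thesis
    unfolding pw simple_mult_std_power[OF n] by (simp add: algebra_simps)
qed

section \<open>Integration by parts\<close>

definition supported_in :: "real \<Rightarrow> ('a::real_normed_vector \<Rightarrow> 'b::zero) \<Rightarrow> bool" where
  "supported_in R f \<longleftrightarrow> (\<forall>x. R < norm x \<longrightarrow> f x = 0)"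

lemma supported_inD: "supported_in R f \<Longrightarrow> R < norm x \<Longrightarrow> f x = 0"
  by (simp add: supported_in_def)

lemma integrable_supported:
  fixes f :: "'a::euclidean_space \<Rightarrow> 'b::{banach, second_countable_topology}"
  assumes "continuous_on UNIV f" "supported_in R f"
  shows "integrable lborel f"
proof -
  have "integrable lborel (\<lambda>x. indicator (cball 0 R) x *\<^sub>R f x)"
    using assms(1) by (intro borel_integrable_compact) (auto intro: continuous_on_subset)
  moreover have "(\<lambda>x. indicator (cball 0 R) x *\<^sub>R f x) = f"
    using assms(2) by (force simp: supported_in_def indicator_def)
  ultimately show ?thesis by simp
qed

lemma bounded_supported:
  fixes f :: "'a::euclidean_space \<Rightarrow> 'b::real_normed_vector"
  assumes "continuous_on UNIV f" "supported_in R f"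
  obtains M where "M \<ge> 0" "\<And>x. norm (f x) \<le> M"
proof -
  have "compact (f ` cball 0 R)"
    using assms(1) by (intro compact_continuous_image) (auto intro: continuous_on_subset)
  then obtain M where M: "M > 0" "\<And>y. y \<in> f ` cball 0 R \<Longrightarrow> norm y \<le> M"
    using compact_imp_bounded bounded_pos by metis
  have "norm (f x) \<le> M" for x
    using M assms(2) by (cases "norm x \<le> R") (auto simp: supported_in_def)
  then show thesis using that M(1) by (metis less_imp_le)
qed

lemma supported_dir_deriv:
  assumes "supported_in R f"
  shows "supported_in R (dir_deriv v f)"
  unfolding supported_in_def
proof (intro allI impI)
  fix x :: 'a assume "R < norm x"
  then have x: "x \<in> {y. R < norm y}" by simp
  have o: "open {y::'a. R < norm y}" by (intro open_Collect_less continuous_intros)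
  have "(f has_derivative (\<lambda>_. 0)) (at x)"
  proof (rule has_derivative_transform_within_open[OF _ o x])
    show "((\<lambda>_. 0) has_derivative (\<lambda>_. 0)) (at x)" by simp
  qed (use assms in \<open>simp add: supported_in_def\<close>)
  then show "dir_deriv v f x = 0" by (rule dir_deriv_eq)
qed

lemma difference_quotient_bound:
  fixes f :: "'a::euclidean_space \<Rightarrow> 'b::real_normed_vector"
  assumes d: "\<And>x. f differentiable (at x)" and M: "\<And>x. norm (dir_deriv v f x) \<le> M" and h: "h \<ge> 0"
  shows "norm (f (x + h *\<^sub>R v) - f x) \<le> M * h"
proof -
  have "norm ((\<lambda>t. f (x + t *\<^sub>R v)) h - (\<lambda>t. f (x + t *\<^sub>R v)) 0) \<le> M * norm (h - 0)"
  proof (rule differentiable_bound[of UNIV _ "\<lambda>t s. s *\<^sub>R dir_deriv v f (x + t *\<^sub>R v)"])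
    fix t :: real
    have "((\<lambda>t. x + t *\<^sub>R v) has_derivative (\<lambda>s. s *\<^sub>R v)) (at t)"
      by (auto intro!: derivative_eq_intros)
    from has_derivative_compose[OF this has_derivative_dir_deriv[OF d]]
    show "((\<lambda>t. f (x + t *\<^sub>R v)) has_derivative (\<lambda>s. s *\<^sub>R dir_deriv v f (x + t *\<^sub>R v))) (at t within UNIV)"
      using linear_cmul[OF linear_dir_deriv[OF d]] by simp
    show "onorm (\<lambda>s. s *\<^sub>R dir_deriv v f (x + t *\<^sub>R v)) \<le> M"
      by (rule onorm_le) (use mult_right_mono[OF M abs_ge_zero] in \<open>simp add: mult.commute\<close>)
  qed auto
  then show ?thesis using h by simp
qed

text \<open>By translation invariance the difference quotients have integral 0; they converge to the
  derivative under a constant bound on a fixed ball.\<close>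

lemma integral_dir_deriv_zero:
  fixes f :: "'a::euclidean_space \<Rightarrow> complex"
  assumes C: "Ck_on (Suc 0) UNIV f" and supp: "supported_in R f"
  shows "(LINT x|lborel. dir_deriv v f x) = 0"
proof -
  have d: "f differentiable (at x)" for x using Ck_UNIV_differentiable[OF C] .
  have cf: "continuous_on UNIV f" using Ck_on_imp_continuous[OF C] .
  have cd: "continuous_on UNIV (dir_deriv v f)" using Ck_UNIV_dir_deriv[OF C] by simp
  obtain M where M: "M \<ge> 0" "\<And>x. norm (dir_deriv v f x) \<le> M"
    using bounded_supported[OF cd supported_dir_deriv[OF supp]] by blast
  define h where "h m = inverse (real (Suc m))" for m
  have h: "0 < h m" "h m \<le> 1" for m by (auto simp: h_def field_simps)
  have h0: "h \<longlonglongrightarrow> 0" unfolding h_def by (rule LIMSEQ_inverse_real_of_nat)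
  define F where "F m x = inverse (h m) *\<^sub>R (f (x + h m *\<^sub>R v) - f x)" for m x
  have fi: "integrable lborel f" by (rule integrable_supported[OF cf supp])
  have meas: "f \<in> borel_measurable borel" using cf by (rule borel_measurable_continuous_onI)
  have tr: "integrable lborel (\<lambda>x. f (c + x))" "(LINT x|lborel. f (c + x)) = (LINT x|lborel. f x)" for c
    using integrable_distr[of "(+) c" lborel borel f] integral_distr[of "(+) c" lborel borel f] fi meas
    by (simp_all add: lborel_distr_plus)
  have F0: "(LINT x|lborel. F m x) = 0" for m
    using tr[of "h m *\<^sub>R v"] fi by (simp add: F_def add.commute[of _ "h m *\<^sub>R v"])
  have "(\<lambda>m. LINT x|lborel. F m x) \<longlonglongrightarrow> (LINT x|lborel. dir_deriv v f x)"
  proof (rule integral_dominated_convergence)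
    show "dir_deriv v f \<in> borel_measurable lborel"
      using borel_measurable_continuous_onI[OF cd] by simp
    show "F m \<in> borel_measurable lborel" for m
      unfolding F_def using cf
      by (auto intro!: borel_measurable_continuous_onI continuous_intros continuous_on_compose2[OF cf])
    \<comment> \<open>The radius grows by \<open>norm v\<close> because the steps \<open>h m\<close>
      are at most 1.\<close>
    show "integrable lborel (\<lambda>x. indicator (cball (0::'a) (R + norm v)) x *\<^sub>R M)"
      by (intro borel_integrable_compact) auto
    show "AE x in lborel. (\<lambda>m. F m x) \<longlonglongrightarrow> dir_deriv v f x"
    proof (intro AE_I2)
      fix x
      have "((\<lambda>t. x + t *\<^sub>R v) has_derivative (\<lambda>s. s *\<^sub>R v)) (at 0)"
        by (auto intro!: derivative_eq_intros)
      from has_derivative_compose[OF this has_derivative_dir_deriv[OF d]]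
      have "((\<lambda>t. f (x + t *\<^sub>R v)) has_vector_derivative dir_deriv v f x) (at 0)"
        using linear_cmul[OF linear_dir_deriv[OF d]] by (simp add: has_vector_derivative_def)
      then have "((\<lambda>t. norm ((f (x + t *\<^sub>R v) - f x - t *\<^sub>R dir_deriv v f x) /\<^sub>R \<bar>t\<bar>)) \<longlongrightarrow> 0) (at 0)"
        by (intro tendsto_norm_zero) (simp add: has_vector_derivative_def has_derivative_def)
      then have "((\<lambda>t. (f (x + t *\<^sub>R v) - f x - t *\<^sub>R dir_deriv v f x) /\<^sub>R t) \<longlongrightarrow> 0) (at 0)"
        by (subst tendsto_norm_zero_iff[symmetric]) simp
      then have "((\<lambda>t. (f (x + t *\<^sub>R v) - f x - t *\<^sub>R dir_deriv v f x) /\<^sub>R t + dir_deriv v f x) \<longlongrightarrow> 0 + dir_deriv v f x) (at 0)"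
        by (intro tendsto_intros)
      then have "((\<lambda>t. (f (x + t *\<^sub>R v) - f x) /\<^sub>R t) \<longlongrightarrow> 0 + dir_deriv v f x) (at 0)"
        by (rule Lim_transform_eventually) (auto simp: eventually_at_filter scaleR_diff_right)
      then have "((\<lambda>t. (f (x + t *\<^sub>R v) - f x) /\<^sub>R t) \<longlongrightarrow> dir_deriv v f x) (at 0)" by simp
      moreover have "filterlim h (at 0) sequentially"
        using h0 h(1) by (auto simp: filterlim_at intro!: always_eventually) (metis less_irrefl)
      ultimately show "(\<lambda>m. F m x) \<longlonglongrightarrow> dir_deriv v f x"
        unfolding F_def using filterlim_compose by fast
    qed
    show "AE x in lborel. norm (F m x) \<le> indicator (cball 0 (R + norm v)) x *\<^sub>R M" for m
    proof (intro AE_I2)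
      fix x
      show "norm (F m x) \<le> indicator (cball 0 (R + norm v)) x *\<^sub>R M"
      proof (cases "norm x \<le> R + norm v")
        case True
        have "norm (f (x + h m *\<^sub>R v) - f x) \<le> M * h m"
          using difference_quotient_bound[OF d M(2)] h[of m] by (simp add: less_imp_le)
        moreover have "norm (F m x) = norm (f (x + h m *\<^sub>R v) - f x) / h m"
          unfolding F_def norm_scaleR using h(1)[of m] by (simp add: divide_inverse mult.commute)
        ultimately have "norm (F m x) \<le> M" using h(1)[of m] by (simp add: pos_divide_le_eq)
        then show ?thesis using True by simp
      next
        case False
        have "norm (h m *\<^sub>R v) \<le> norm v" using h[of m] by (simp add: mult_left_le_one_le)
        then have "R < norm (x + h m *\<^sub>R v)"
          using False norm_triangle_ineq4[of "x + h m *\<^sub>R v" "h m *\<^sub>R v"] by simp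
        moreover have "R < norm x" using False norm_ge_zero[of v] by linarith
        ultimately have "F m x = 0" using supp by (simp add: F_def supported_in_def)
        then show ?thesis using M(1) by simp
      qed
    qed
  qed
  then have "(\<lambda>m. 0) \<longlonglongrightarrow> (LINT x|lborel. dir_deriv v f x)" by (simp add: F0)
  from LIMSEQ_unique[OF this tendsto_const] show ?thesis .
qed

lemma supported_cderiv: "supported_in R f \<Longrightarrow> supported_in R (cderiv Z f)"
  using supported_dir_deriv[of R f] by (simp add: supported_in_def cderiv_def)

lemma integral_cderiv:
  fixes f :: "'a::euclidean_space \<Rightarrow> complex"
  assumes "Ck_on (Suc 0) UNIV f" "supported_in R f"
  shows "integrable lborel (cderiv Z f)" "(LINT x|lborel. cderiv Z f x) = 0"
proof -
  have i: "integrable lborel (dir_deriv v f)" for v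
    using Ck_UNIV_dir_deriv[OF assms(1)] supported_dir_deriv[OF assms(2)] by (auto intro: integrable_supported)
  have "cderiv Z f = (\<lambda>x. dir_deriv (fst Z) f x + \<i> * dir_deriv (snd Z) f x)"
    by (auto simp: cderiv_def)
  then show "integrable lborel (cderiv Z f)" "(LINT x|lborel. cderiv Z f x) = 0"
    using i by (simp_all add: integral_dir_deriv_zero[OF assms])
qed


section \<open>Products of Hessian forms: closedness and integration by parts\<close>

definition hess :: "(nat \<Rightarrow> 'a \<times> 'a) \<Rightarrow> (nat \<Rightarrow> 'a \<times> 'a) \<Rightarrow> ('a::real_normed_vector \<Rightarrow> complex) \<Rightarrow> 'a \<Rightarrow> nat \<Rightarrow> nat \<Rightarrow> complex" where
  "hess X Y u q k i = cderiv (X k) (cderiv (Y i) u) q"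

definition hess_prod :: "nat \<Rightarrow> (nat \<Rightarrow> 'a \<times> 'a) \<Rightarrow> (nat \<Rightarrow> 'a \<times> 'a) \<Rightarrow> ('a::real_normed_vector \<Rightarrow> complex) list \<Rightarrow> 'a \<Rightarrow> ext" where
  "hess_prod N X Y us q = foldr (form_mult N) (map (\<lambda>u. hess X Y u q) us) ext_one"

lemma hess_prod_Cons: "hess_prod N X Y (u # us) q = form_mult N (hess X Y u q) (hess_prod N X Y us q)"
  by (simp add: hess_prod_def)

lemma hess_prod_Nil: "hess_prod N X Y [] q = ext_one"
  by (simp add: hess_prod_def)

lemma dz_mult_field:
  fixes A :: "'a::euclidean_space \<Rightarrow> ext"
  shows "(\<And>S. Ck_on k UNIV (\<lambda>q. A q S)) \<Longrightarrow> Ck_on k UNIV (\<lambda>q. dz_mult i (A q) S)"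
    and "(\<And>S. (\<lambda>q. A q S) differentiable (at q)) \<Longrightarrow>
      cderiv Z (\<lambda>q. dz_mult i (A q) S) q = dz_mult i (\<lambda>S. cderiv Z (\<lambda>q. A q S) q) S"
  by (cases "i \<in> S"; simp add: dz_mult_def Ck_const cderiv_cmult Ck_on_cmult del: Ck_on.simps)+

lemma dz_mult_zero: "dz_mult i (\<lambda>S. 0) = (\<lambda>S. 0)"
  by (auto simp: dz_mult_def)

lemma Ck_hess:
  "Ck_on (Suc (Suc k)) UNIV u \<Longrightarrow> Ck_on k UNIV (\<lambda>q. hess X Y u q l i)"
  unfolding hess_def by (intro Ck_cderiv) (auto intro!: Ck_cderiv simp del: Ck_on.simps)

lemma Ck_hess_prod:
  fixes us :: "('a::euclidean_space \<Rightarrow> complex) list"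
  assumes "\<And>u. u \<in> set us \<Longrightarrow> Ck_on (Suc (Suc k)) UNIV u"
  shows "Ck_on k UNIV (\<lambda>q. hess_prod N X Y us q S)"
  using assms
proof (induction us arbitrary: S)
  case Nil
  then show ?case by (simp add: hess_prod_Nil Ck_const del: Ck_on.simps)
next
  case (Cons u us)
  then show ?case unfolding hess_prod_Cons form_mult_def
    by (intro Ck_on_sum Ck_on_mult Ck_hess dz_mult_field(1) open_UNIV) auto
qed

text \<open>In the product rule the \<open>X k\<close> derivative of a Hessian entry is symmetric in
  the two \<open>X\<close> indices, while the generators anticommute, so these terms cancel in
  pairs. The other terms contain the divergence of the shorter product.\<close>

lemma hess_prod_closed:
  fixes us :: "('a::euclidean_space \<Rightarrow> complex) list"
  assumes "\<And>u. u \<in> set us \<Longrightarrow> Ck_on 3 UNIV u"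
  shows "(\<Sum>k<N. cderiv (X k) (\<lambda>q. dz_mult k (hess_prod N X Y us q) S) q) = 0"
  using assms
proof (induction us arbitrary: S)
  case Nil
  then show ?case by (simp add: hess_prod_Nil)
next
  case (Cons u us)
  let ?T = "hess_prod N X Y us"
  have 3: "3 = Suc (Suc (Suc 0))" by simp
  have T1: "Ck_on (Suc 0) UNIV (\<lambda>q. ?T q S)" for S
    using Cons.prems by (intro Ck_hess_prod) (auto simp: 3 simp del: Ck_on.simps)
  have M1: "Ck_on (Suc 0) UNIV (\<lambda>q. dz_mult k (dz_mult l (dz_mult p (?T q))) S)" for k l p S
    by (intro dz_mult_field(1) T1)
  have u: "Ck_on (Suc (Suc (Suc 0))) UNIV u" using Cons.prems by (simp add: 3 del: Ck_on.simps)
  have h1: "Ck_on (Suc 0) UNIV (\<lambda>q. hess X Y u q l p)" for l p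
    by (rule Ck_hess[OF u])
  have d: "f differentiable (at x)" if "Ck_on (Suc 0) UNIV f" for f :: "'a \<Rightarrow> complex" and x
    using Ck_UNIV_differentiable[OF that] .
  have "dz_mult k (hess_prod N X Y (u # us) q) S =
    (\<Sum>l<N. \<Sum>p<N. hess X Y u q l p * dz_mult k (dz_mult l (dz_mult p (?T q))) S)" for k q
    unfolding hess_prod_Cons form_mult_def[abs_def] sum.cartesian_product case_prod_beta by (rule dz_mult_sum)
  then have "cderiv (X k) (\<lambda>q. dz_mult k (hess_prod N X Y (u # us) q) S) q =
     (\<Sum>l<N. \<Sum>p<N. hess X Y u q l p * cderiv (X k) (\<lambda>q. dz_mult k (dz_mult l (dz_mult p (?T q))) S) q +
       cderiv (X k) (\<lambda>q. hess X Y u q l p) q * dz_mult k (dz_mult l (dz_mult p (?T q))) S)" for k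
    by (simp add: cderiv_sum differentiable_sum differentiable_mult d[OF h1] d[OF M1] cderiv_mult)
  then have "(\<Sum>k<N. cderiv (X k) (\<lambda>q. dz_mult k (hess_prod N X Y (u # us) q) S) q) =
     (\<Sum>k<N. \<Sum>l<N. \<Sum>p<N. hess X Y u q l p * cderiv (X k) (\<lambda>q. dz_mult k (dz_mult l (dz_mult p (?T q))) S) q) +
     (\<Sum>k<N. \<Sum>l<N. \<Sum>p<N. cderiv (X k) (\<lambda>q. hess X Y u q l p) q * dz_mult k (dz_mult l (dz_mult p (?T q))) S)"
    by (simp add: sum.distrib)
  also have "(\<Sum>k<N. \<Sum>l<N. \<Sum>p<N. hess X Y u q l p * cderiv (X k) (\<lambda>q. dz_mult k (dz_mult l (dz_mult p (?T q))) S) q)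
     = (\<Sum>l<N. \<Sum>p<N. hess X Y u q l p * (\<Sum>k<N. cderiv (X k) (\<lambda>q. dz_mult k (dz_mult l (dz_mult p (?T q))) S) q))"
    by (simp only: sum_distrib_left) (subst sum.swap, intro sum.cong refl sum.swap)
  also have "\<dots> = 0"
  proof -
    have "(\<Sum>k<N. cderiv (X k) (\<lambda>q. dz_mult k (dz_mult l (dz_mult p (?T q))) S) q) = 0" for l p
    proof -
      have ac: "dz_mult i (dz_mult k A) = (\<lambda>S. - dz_mult k (dz_mult i A) S)" for i k A
        by (rule ext) (rule dz_mult_anticommute)
      have "dz_mult k (dz_mult l (dz_mult p A)) = dz_mult l (dz_mult p (dz_mult k A))" for k A
        by (simp add: ac[of k l] ac[of k p] dz_mult_uminus)
      then have "(\<Sum>k<N. cderiv (X k) (\<lambda>q. dz_mult k (dz_mult l (dz_mult p (?T q))) S) q) =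
         (\<Sum>k<N. dz_mult l (dz_mult p (\<lambda>S. cderiv (X k) (\<lambda>q. dz_mult k (?T q) S) q)) S)"
        by (simp add: dz_mult_field d[OF dz_mult_field(1)[OF T1]] d[OF dz_mult_field(1)[OF dz_mult_field(1)[OF T1]]])
      also have "\<dots> = dz_mult l (dz_mult p (\<lambda>S. \<Sum>k<N. 1 * cderiv (X k) (\<lambda>q. dz_mult k (?T q) S) q)) S"
        unfolding dz_mult_sum[abs_def] by simp
      also have "\<dots> = 0" using Cons by (simp add: dz_mult_zero)
      finally show ?thesis .
    qed
    then show ?thesis by simp
  qed
  also have "(\<Sum>k<N. \<Sum>l<N. \<Sum>p<N. cderiv (X k) (\<lambda>q. hess X Y u q l p) q * dz_mult k (dz_mult l (dz_mult p (?T q))) S) = 0"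
    (is "?Z = 0")
  proof -
    have sy: "cderiv (X k) (\<lambda>q. hess X Y u q l p) q = cderiv (X l) (\<lambda>q. hess X Y u q k p) q" for k l p
      unfolding hess_def by (rule cderiv_commute) (use Ck_cderiv[OF u, of "Y p"] in \<open>simp only: numeral_2_eq_2\<close>)
    have "?Z = (\<Sum>k<N. \<Sum>l<N. \<Sum>p<N. - (cderiv (X l) (\<lambda>q. hess X Y u q k p) q * dz_mult l (dz_mult k (dz_mult p (?T q))) S))"
      by (intro sum.cong refl, subst sy, subst dz_mult_anticommute) simp
    also have "\<dots> = (\<Sum>l<N. \<Sum>k<N. \<Sum>p<N. - (cderiv (X l) (\<lambda>q. hess X Y u q k p) q * dz_mult l (dz_mult k (dz_mult p (?T q))) S))"
      by (rule sum.swap)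
    also have "\<dots> = - ?Z" by (simp add: sum_negf)
    finally show ?thesis by simp
  qed
  finally show ?case by simp
qed

text \<open>This is the rule that \<open>\<partial>\<close> and \<open>\<partial>\<^sub>J\<close>
  anticommute: fields with constant coefficients commute, so exchanging them transposes each Hessian
  and reverses its antisymmetric part. It transfers closedness from the \<open>X\<close> fields to
  the \<open>Y\<close> fields.\<close>

lemma hess_prod_swap:
  fixes us :: "('a::euclidean_space \<Rightarrow> complex) list"
  assumes "\<And>u. u \<in> set us \<Longrightarrow> Ck_on 2 UNIV u"
  shows "hess_prod N X Y us q = (\<lambda>S. (-1) ^ length us * hess_prod N Y X us q S)"
  using assms
proof (induction us)
  case (Cons u us)
  have "hess_prod N X Y (u # us) q = form_mult N (\<lambda>k i. - hess Y X u q k i) (hess_prod N X Y us q)"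
    unfolding hess_prod_Cons
  proof (rule form_mult_eqI)
    fix k i
    show "hess X Y u q k i - hess X Y u q i k = - hess Y X u q k i - - hess Y X u q i k"
      using cderiv_commute[of u "X k" "Y i" q] cderiv_commute[of u "X i" "Y k" q] Cons.prems by (simp add: hess_def)
  qed
  also have "\<dots> = (\<lambda>S. (-1) ^ length us * form_mult N (\<lambda>k i. - hess Y X u q k i) (hess_prod N Y X us q) S)"
    using Cons form_mult_sum[of N _ "\<lambda>_. (-1) ^ length us" "\<lambda>_. hess_prod N Y X us q" "{0::nat}"] by (intro ext) simp
  also have "\<dots> = (\<lambda>S. (-1) ^ length (u # us) * hess_prod N Y X (u # us) q S)"
    by (simp add: hess_prod_Cons form_mult_def sum_negf)
  finally show ?case .
qed (simp add: hess_prod_Nil)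

lemma hess_prod_closed':
  fixes us :: "('a::euclidean_space \<Rightarrow> complex) list"
  assumes "\<And>u. u \<in> set us \<Longrightarrow> Ck_on 3 UNIV u"
  shows "(\<Sum>i<N. cderiv (Y i) (\<lambda>q. dz_mult i (hess_prod N X Y us q) S) q) = 0"
proof -
  have "Ck_on 2 UNIV u" if "u \<in> set us" for u using assms[OF that] Ck_on_mono by fastforce
  then have "hess_prod N X Y us q = (\<lambda>S. (-1) ^ length us * hess_prod N Y X us q S)" for q
    by (rule hess_prod_swap)
  then have eq: "dz_mult i (hess_prod N X Y us q) S = (-1) ^ length us * dz_mult i (hess_prod N Y X us q) S" for i q
    by (simp add: dz_mult_def)
  have "Ck_on (Suc 0) UNIV (\<lambda>q. dz_mult i (hess_prod N Y X us q) S)" for i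
    using assms by (intro dz_mult_field(1) Ck_hess_prod) (auto simp: numeral_3_eq_3 simp del: Ck_on.simps)
  from Ck_UNIV_differentiable[OF this]
  have "(\<Sum>i<N. cderiv (Y i) (\<lambda>q. dz_mult i (hess_prod N X Y us q) S) q) =
     (-1) ^ length us * (\<Sum>i<N. cderiv (Y i) (\<lambda>q. dz_mult i (hess_prod N Y X us q) S) q)"
    by (simp add: eq cderiv_cmult sum_distrib_left)
  then show ?thesis using hess_prod_closed[OF assms] by simp
qed

text \<open>The integrands differ by a divergence. The support of \<phi> makes both fluxes compactly
  supported: \<phi> is a factor of one, and its derivatives are factors of the other.\<close>

lemma integration_by_parts:
  fixes u \<phi> :: "'a::euclidean_space \<Rightarrow> complex"
  assumes u: "Ck_on 2 UNIV u" and \<phi>: "Ck_on 2 UNIV \<phi>" and supp: "supported_in R \<phi>"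
    and us: "\<And>w. w \<in> set us \<Longrightarrow> Ck_on 3 UNIV w"
  shows "(LINT q|lborel. \<phi> q * hess_prod N X Y (u # us) q S) = (LINT q|lborel. u q * hess_prod N X Y (\<phi> # us) q S)"
proof -
  \<comment> \<open>Cofactors of the first Hessian in the product. They are divergence free in
    either index, so no term with their derivatives remains.\<close>
  define C where "C k i q = dz_mult k (dz_mult i (hess_prod N X Y us q)) S" for k i q
  have 2: "2 = Suc (Suc 0)" by simp
  note u' = u[unfolded 2] and \<phi>' = \<phi>[unfolded 2]
  have T1: "Ck_on (Suc 0) UNIV (\<lambda>q. hess_prod N X Y us q S)" for S
    using us by (intro Ck_hess_prod) (auto simp: numeral_3_eq_3 simp del: Ck_on.simps)
  have C1: "Ck_on (Suc 0) UNIV (C k i)" for k i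
    unfolding C_def by (intro dz_mult_field(1) T1)
  have d: "f differentiable (at x)" if "Ck_on (Suc 0) UNIV f" for f :: "'a \<Rightarrow> complex" and x
    using Ck_UNIV_differentiable[OF that] .
  have Cdiv2: "(\<Sum>i<N. cderiv (Y i) (C k i) q) = 0" for k q
  proof -
    have "(\<Sum>i<N. cderiv (Y i) (C k i) q) = (\<Sum>i<N. 1 * dz_mult k (\<lambda>S. cderiv (Y i) (\<lambda>q. dz_mult i (hess_prod N X Y us q) S) q) S)"
      unfolding C_def by (simp add: dz_mult_field(2) d[OF dz_mult_field(1)[OF T1]])
    also have "\<dots> = dz_mult k (\<lambda>S. \<Sum>i<N. 1 * cderiv (Y i) (\<lambda>q. dz_mult i (hess_prod N X Y us q) S) q) S"
      by (rule dz_mult_sum[symmetric])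
    also have "\<dots> = 0" by (simp add: hess_prod_closed'[OF us] dz_mult_zero)
    finally show ?thesis .
  qed
  have Cdiv1: "(\<Sum>k<N. cderiv (X k) (C k i) q) = 0" for i q
  proof -
    have "C k i q = - 1 * dz_mult i (dz_mult k (hess_prod N X Y us q)) S" for k q
      unfolding C_def by (subst dz_mult_anticommute) simp
    then have "C k i = (\<lambda>q. - 1 * dz_mult i (dz_mult k (hess_prod N X Y us q)) S)" for k by blast
    then have "cderiv (X k) (C k i) q = - 1 * dz_mult i (\<lambda>S. cderiv (X k) (\<lambda>q. dz_mult k (hess_prod N X Y us q) S) q) S" for k
      by (simp only: cderiv_cmult dz_mult_field(2) d[OF dz_mult_field(1)[OF T1]] d[OF dz_mult_field(1)[OF dz_mult_field(1)[OF T1]]])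
    then have "(\<Sum>k<N. cderiv (X k) (C k i) q) = (\<Sum>k<N. - 1 * dz_mult i (\<lambda>S. cderiv (X k) (\<lambda>q. dz_mult k (hess_prod N X Y us q) S) q) S)"
      by simp
    also have "\<dots> = dz_mult i (\<lambda>S. \<Sum>k<N. - 1 * cderiv (X k) (\<lambda>q. dz_mult k (hess_prod N X Y us q) S) q) S"
      by (rule dz_mult_sum[symmetric])
    also have "\<dots> = 0" using hess_prod_closed[OF us, where X = X] by (simp add: sum_negf dz_mult_zero)
    finally show ?thesis .
  qed
  \<comment> \<open>\<open>F\<close> contains \<phi> and the \<open>Y\<close> derivative of
    \<open>u\<close>, \<open>G\<close> contains \<open>u\<close> and the \<open>X\<close> derivative
    of \<phi>. The divergences share the term with one derivative on each function, which cancels in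
    the difference.\<close>
  define F where "F k q = (\<Sum>i<N. \<phi> q * (cderiv (Y i) u q * C k i q))" for k q
  define G where "G i q = (\<Sum>k<N. u q * (cderiv (X k) \<phi> q * C k i q))" for i q
  note D1 = Ck_on_SucD
  have F1: "Ck_on (Suc 0) UNIV (F k)" for k
    unfolding F_def by (intro Ck_on_sum Ck_on_mult C1 open_UNIV Ck_cderiv[OF u'] D1[OF \<phi>'])
  have G1: "Ck_on (Suc 0) UNIV (G i)" for i
    unfolding G_def by (intro Ck_on_sum Ck_on_mult C1 open_UNIV Ck_cderiv[OF \<phi>'] D1[OF u'])
  have FS: "supported_in R (F k)" for k using supp by (simp add: F_def supported_in_def)
  have GS: "supported_in R (G i)" for i using supported_cderiv[OF supp] by (simp add: G_def supported_in_def)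
  have id: "\<phi> q * hess_prod N X Y (u # us) q S - u q * hess_prod N X Y (\<phi> # us) q S =
      (\<Sum>k<N. cderiv (X k) (F k) q) - (\<Sum>i<N. cderiv (Y i) (G i) q)" for q
  proof -
    have A: "cderiv (X k) (F k) q = \<phi> q * (\<Sum>i<N. cderiv (Y i) u q * cderiv (X k) (C k i) q) +
       \<phi> q * (\<Sum>i<N. hess X Y u q k i * C k i q) + (\<Sum>i<N. cderiv (X k) \<phi> q * cderiv (Y i) u q * C k i q)" for k
      unfolding F_def hess_def
      by (simp add: cderiv_sum cderiv_mult differentiable_mult d[OF C1] d[OF D1[OF \<phi>']] d[OF Ck_cderiv[OF u']]
           sum_distrib_left sum.distrib algebra_simps)
    have B: "cderiv (Y i) (G i) q = u q * (\<Sum>k<N. cderiv (X k) \<phi> q * cderiv (Y i) (C k i) q) +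
       u q * (\<Sum>k<N. hess X Y \<phi> q k i * C k i q) + (\<Sum>k<N. cderiv (X k) \<phi> q * cderiv (Y i) u q * C k i q)" for i
      unfolding G_def hess_def cderiv_commute[OF \<phi>, of "X _" "Y i"]
      by (simp add: cderiv_sum cderiv_mult differentiable_mult d[OF C1] d[OF D1[OF u']] d[OF Ck_cderiv[OF \<phi>']]
           sum_distrib_left sum.distrib algebra_simps)
    have A0: "(\<Sum>k<N. \<Sum>i<N. cderiv (Y i) u q * cderiv (X k) (C k i) q) = 0"
      by (subst sum.swap) (simp add: sum_distrib_left[symmetric] Cdiv1)
    have B0: "(\<Sum>i<N. \<Sum>k<N. cderiv (X k) \<phi> q * cderiv (Y i) (C k i) q) = 0"
      by (subst sum.swap) (simp add: sum_distrib_left[symmetric] Cdiv2)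
    have E: "hess_prod N X Y (w # us) q S = (\<Sum>k<N. \<Sum>i<N. hess X Y w q k i * C k i q)" for w
      by (simp add: hess_prod_Cons form_mult_def C_def)
    have "(\<Sum>k<N. cderiv (X k) (F k) q) = \<phi> q * hess_prod N X Y (u # us) q S +
        (\<Sum>k<N. \<Sum>i<N. cderiv (X k) \<phi> q * cderiv (Y i) u q * C k i q)"
      unfolding A E sum.distrib sum_distrib_left[symmetric] A0 by simp
    moreover have "(\<Sum>i<N. cderiv (Y i) (G i) q) = u q * hess_prod N X Y (\<phi> # us) q S +
        (\<Sum>k<N. \<Sum>i<N. cderiv (X k) \<phi> q * cderiv (Y i) u q * C k i q)"
      unfolding B E sum.distrib sum_distrib_left[symmetric] B0
      using sum.swap[of "\<lambda>k i. hess X Y \<phi> q k i * C k i q" "{..<N}" "{..<N}"]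
        sum.swap[of "\<lambda>k i. cderiv (X k) \<phi> q * cderiv (Y i) u q * C k i q" "{..<N}" "{..<N}"] by simp
    ultimately show ?thesis by simp
  qed
  have i0: "(LINT q|lborel. (\<Sum>k<N. cderiv (X k) (F k) q) - (\<Sum>i<N. cderiv (Y i) (G i) q)) = 0"
    using integral_cderiv[OF F1 FS] integral_cderiv[OF G1 GS] by simp
  have c0: "continuous_on UNIV (\<lambda>q. hess_prod N X Y (w # us) q S)" if "Ck_on (Suc (Suc 0)) UNIV w" for w
  proof -
    have "Ck_on 0 UNIV (\<lambda>q. hess_prod N X Y (w # us) q S)"
      using us that Ck_on_mono[of 3 UNIV _ "Suc (Suc 0)"] by (intro Ck_hess_prod) (auto simp del: Ck_on.simps)
    then show ?thesis by simp
  qed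
  have "integrable lborel (\<lambda>q. \<phi> q * hess_prod N X Y (u # us) q S)"
    by (rule integrable_supported[of _ R])
       (use supp Ck_on_imp_continuous[OF \<phi>] c0[OF u'] in \<open>auto simp: supported_in_def intro!: continuous_intros\<close>)
  moreover have "integrable lborel (\<lambda>q. u q * hess_prod N X Y (\<phi> # us) q S)"
  proof (rule integrable_supported[of _ R])
    have "supported_in R (\<lambda>q. hess X Y \<phi> q k i)" for k i
      unfolding hess_def using supported_cderiv[OF supported_cderiv[OF supp]] by (simp add: supported_in_def)
    then show "supported_in R (\<lambda>q. u q * hess_prod N X Y (\<phi> # us) q S)"
      by (simp add: supported_in_def hess_prod_Cons form_mult_def)
  qed (use Ck_on_imp_continuous[OF u] c0[OF \<phi>'] in \<open>auto intro!: continuous_intros\<close>)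
  ultimately show ?thesis
    using i0 unfolding id[symmetric] by simp
qed

section \<open>The Monge-Ampere operator in terms of Hessians\<close>

definition dz_vec :: "(nat \<Rightarrow> 'n::finite) \<Rightarrow> nat \<Rightarrow> (quat^'n) \<times> (quat^'n)" where
  "dz_vec e k = ((1/2) *\<^sub>R x_vec e (2*k), (- ((-1) ^ k) / 2) *\<^sub>R x_vec e (2*k+1))"

definition dzbar_vec :: "(nat \<Rightarrow> 'n::finite) \<Rightarrow> nat \<Rightarrow> (quat^'n) \<times> (quat^'n)" where
  "dzbar_vec e k = ((1/2) *\<^sub>R x_vec e (2*k), ((-1) ^ k / 2) *\<^sub>R x_vec e (2*k+1))"

text \<open>Chosen so that applying it to \<open>u\<close> gives the coefficient of
  \<open>dz i\<close> in \<open>del_J e u\<close>.\<close>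

definition J_dz_vec :: "(nat \<Rightarrow> 'n::finite) \<Rightarrow> nat \<Rightarrow> (quat^'n) \<times> (quat^'n)" where
  "J_dz_vec e i = (-1) ^ (i + 1) *\<^sub>R dzbar_vec e (partner i)"

lemma dir_deriv_scaleR_vec:
  "f differentiable (at x) \<Longrightarrow> dir_deriv (c *\<^sub>R v) f x = c *\<^sub>R dir_deriv v f x"
  by (rule linear_cmul[OF linear_dir_deriv])

lemma cderiv_scaleR_vec:
  "f differentiable (at x) \<Longrightarrow> cderiv (c *\<^sub>R Z) f x = of_real c * cderiv Z f x"
  by (simp add: cderiv_def dir_deriv_scaleR_vec scaleR_conv_of_real algebra_simps)

lemma d_z_eq: "g differentiable (at q) \<Longrightarrow> d_z e k g q = cderiv (dz_vec e k) g q"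
  unfolding d_z_def cderiv_def dz_vec_def fst_conv snd_conv
  by (simp only: dir_deriv_scaleR_vec) (simp add: scaleR_conv_of_real diff_divide_distrib)

lemma d_zbar_eq: "g differentiable (at q) \<Longrightarrow> d_zbar e k g q = cderiv (dzbar_vec e k) g q"
  unfolding d_zbar_def cderiv_def dzbar_vec_def fst_conv snd_conv
  by (simp only: dir_deriv_scaleR_vec) (simp add: scaleR_conv_of_real add_divide_distrib)

lemma cderiv_cnj:
  assumes "g differentiable (at q)"
  shows "cderiv (fst Z, - snd Z) (\<lambda>p. cnj (g p)) q = cnj (cderiv Z g q)"
proof -
  have "(\<lambda>p. cnj (g p)) differentiable (at q)"
    using bounded_linear.has_derivative[OF bounded_linear_cnj has_derivative_dir_deriv[OF assms]]
    by (auto simp: differentiable_def)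
  then have "dir_deriv (- v) (\<lambda>p. cnj (g p)) q = - dir_deriv v (\<lambda>p. cnj (g p)) q" for v
    using dir_deriv_scaleR_vec[of "\<lambda>p. cnj (g p)" q "-1" v] by simp
  then show ?thesis
    by (simp add: cderiv_def dir_deriv_bounded_linear[OF bounded_linear_cnj assms])
qed

lemma wedge_sum_right:
  "(A \<and>\<and> (\<lambda>T. \<Sum>x\<in>I. c x * B x T)) S = (\<Sum>x\<in>I. c x * (A \<and>\<and> B x) S)"
proof -
  have "(A \<and>\<and> (\<lambda>T. \<Sum>x\<in>I. c x * B x T)) S =
    (\<Sum>T\<in>Pow S. \<Sum>x\<in>I. c x * ((-1) ^ card {(i,j). i \<in> T \<and> j \<in> S - T \<and> j < i} * A T * B x (S - T)))"
    by (simp add: wedge_def sum_distrib_left sum_distrib_right mult_ac)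
  also have "\<dots> = (\<Sum>x\<in>I. \<Sum>T\<in>Pow S. c x * ((-1) ^ card {(i,j). i \<in> T \<and> j \<in> S - T \<and> j < i} * A T * B x (S - T)))"
    by (rule sum.swap)
  finally show ?thesis by (simp add: wedge_def sum_distrib_left)
qed

abbreviation cfun :: "('a \<Rightarrow> real) \<Rightarrow> 'a \<Rightarrow> complex" where
  "cfun u \<equiv> \<lambda>q. complex_of_real (u q)"

text \<open>The polarised operator D of the overview, as a complex number; that it is real where it
  is integrated follows from positivity.\<close>

definition mixed_MA :: "(nat \<Rightarrow> 'n::finite) \<Rightarrow> (quat^'n \<Rightarrow> real) list \<Rightarrow> quat^'n \<Rightarrow> complex" where
  "mixed_MA e us q = hess_prod (2 * CARD('n)) (dz_vec e) (J_dz_vec e) (map cfun us) q {..<2 * CARD('n)}"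

lemma foldr_replicate_eq_funpow: "foldr f (replicate n a) x = (f a ^^ n) x"
  by (induction n) auto

lemma MA_smooth_eq:
  fixes e :: "nat \<Rightarrow> 'n::finite" and u :: "quat^'n \<Rightarrow> real"
  assumes "Ck_on 2 UNIV u"
  shows "MA_smooth e u q = Re (mixed_MA e (replicate CARD('n) u) q)"
proof -
  let ?N = "2 * CARD('n)" and ?u = "cfun u"
  have u2: "Ck_on (Suc (Suc 0)) UNIV ?u"
    using Ck_on_of_real[OF open_UNIV assms] by (simp only: numeral_2_eq_2)
  have d0: "?u differentiable (at x)" for x using Ck_UNIV_differentiable[OF u2] .
  have d1: "cderiv Z ?u differentiable (at x)" for Z x using Ck_UNIV_differentiable[OF Ck_cderiv[OF u2]] .
  have J: "del_J e u p T = (\<Sum>i<?N. dz i T * cderiv (J_dz_vec e i) ?u p)" for p T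
    unfolding del_J_def
    by (intro sum.cong refl)
       (simp only: d_zbar_eq[OF d0] J_dz_vec_def cderiv_scaleR_vec[OF d0] partner_def, simp)
  have "d_z e k (\<lambda>p. del_J e u p T) q = (\<Sum>i<?N. hess (dz_vec e) (J_dz_vec e) ?u q k i * dz i T)" for k T
  proof -
    have "d_z e k (\<lambda>p. del_J e u p T) q = cderiv (dz_vec e k) (\<lambda>p. \<Sum>i<?N. dz i T * cderiv (J_dz_vec e i) ?u p) q"
      unfolding J by (intro d_z_eq differentiable_sum differentiable_mult d1 ballI differentiable_const finite_lessThan)
    also have "\<dots> = (\<Sum>i<?N. dz i T * hess (dz_vec e) (J_dz_vec e) ?u q k i)"
      by (simp add: cderiv_sum differentiable_mult d1 cderiv_cmult hess_def)
    finally show ?thesis by (simp add: mult.commute)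
  qed
  then have "del e (del_J e u) q T = (\<Sum>k<?N. \<Sum>i<?N. hess (dz_vec e) (J_dz_vec e) ?u q k i * (dz k \<and>\<and> dz i) T)" for T
    unfolding del_def by (simp add: wedge_sum_right)
  then have "MA_form e u q {..<?N} = (form_mult ?N (hess (dz_vec e) (J_dz_vec e) ?u q) ^^ CARD('n)) ext_one {..<?N}"
    unfolding MA_form_def by (intro wedge_power_eq) auto
  then show ?thesis
    by (simp add: MA_smooth_def mixed_MA_def hess_prod_def map_replicate foldr_replicate_eq_funpow)
qed


section \<open>Positivity of mixed Monge-Ampere forms\<close>

text \<open>By the chain rule, the Laplacian of l \<mapsto> u (q + b l) at l = 0. Being pointwise,
  it can express plurisubharmonicity at a single point.\<close>

definition line_laplacian :: "quat^'n \<Rightarrow> (quat^'n \<Rightarrow> real) \<Rightarrow> quat^'n \<Rightarrow> real" where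
  "line_laplacian b u q = (\<Sum>d\<in>Basis. dir_deriv (right_scale b d) (dir_deriv (right_scale b d) u) q)"

lemma quat_basis: "(\<Sum>d\<in>(Basis::quat set). f d) = f (quat 1 0 0 0) + f (quat 0 1 0 0) + f (quat 0 0 1 0) + f (quat 0 0 0 1)"
proof -
  have four: "v $ 4 = v $ 0" for v :: quat by (rule arg_cong[where f = "($) v"]) simp
  have q: "axis (0::4) 1 = quat 1 0 0 0" "axis (1::4) 1 = quat 0 1 0 0" "axis (2::4) 1 = quat 0 0 1 0" "axis (3::4) 1 = quat 0 0 0 1"
    by (auto simp: vec_eq_iff axis_def forall_4 quat_def)
  have "(Basis::quat set) = (\<lambda>l. axis l 1) ` (UNIV::4 set)"
    by (auto simp: Basis_vec_def)
  moreover have "(UNIV::4 set) = {0,1,2,3}"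
    using UNIV_4 by auto
  moreover have "inj (\<lambda>l::4. axis l (1::real))"
    by (auto simp: inj_def axis_eq_axis)
  ultimately have "(\<Sum>d\<in>(Basis::quat set). f d) = (\<Sum>l\<in>{0,1,2,3::4}. f (axis l 1))"
    by (metis (no_types, lifting) inj_on_subset sum.reindex_cong subset_UNIV)
  then show ?thesis by (simp add: q add.assoc)
qed

lemma cderiv_lincomb:
  fixes f :: "'a::real_normed_vector \<Rightarrow> complex"
  assumes "f differentiable (at q)"
  shows "(\<Sum>k\<in>I. c k * cderiv (Z k) f q) =
    cderiv (\<Sum>k\<in>I. Re (c k) *\<^sub>R fst (Z k) - Im (c k) *\<^sub>R snd (Z k), \<Sum>k\<in>I. Re (c k) *\<^sub>R snd (Z k) + Im (c k) *\<^sub>R fst (Z k)) f q"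
proof -
  interpret linear "\<lambda>v. dir_deriv v f q" by (rule linear_dir_deriv[OF assms])
  have "c k * cderiv (Z k) f q = dir_deriv (Re (c k) *\<^sub>R fst (Z k) - Im (c k) *\<^sub>R snd (Z k)) f q +
     \<i> * dir_deriv (Re (c k) *\<^sub>R snd (Z k) + Im (c k) *\<^sub>R fst (Z k)) f q" for k
    by (subst complex_eq[of "c k"]) (simp add: cderiv_def diff add scale scaleR_conv_of_real algebra_simps)
  then show ?thesis unfolding cderiv_def[of "(_, _)"] fst_conv snd_conv sum sum_distrib_left sum.distrib[symmetric]
    by (intro sum.cong refl)
qed

lemma sum_pairs: "(\<Sum>k<2*n. f k) = (\<Sum>i<n. f (2*i) + f (2*i+1))" for f :: "nat \<Rightarrow> 'a::comm_monoid_add"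
  by (induction n) (auto simp: add.assoc)

text \<open>Combining the Wirtinger fields with coefficients \<open>c\<close> gives v + \<i> w. The
  form is then (v + \<i> w)(v - \<i> w) u, where the mixed terms cancel by symmetry of second
  derivatives.\<close>

lemma hermitian_part_quad:
  fixes e :: "nat \<Rightarrow> 'n::finite" and u :: "quat^'n \<Rightarrow> real" and n :: nat
  assumes u: "Ck_on 2 UNIV u"
  defines "v c \<equiv> \<Sum>k<2*n. Re (c k) *\<^sub>R fst (dz_vec e k) - Im (c k) *\<^sub>R snd (dz_vec e k)"
    and "w c \<equiv> \<Sum>k<2*n. Re (c k) *\<^sub>R snd (dz_vec e k) + Im (c k) *\<^sub>R fst (dz_vec e k)"
  shows "herm_quad (2*n) (\<lambda>k l. cderiv (dz_vec e k) (cderiv (dzbar_vec e l) (cfun u)) q) c =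
     of_real (dir_deriv (v c) (dir_deriv (v c) u) q + dir_deriv (w c) (dir_deriv (w c) u) q)"
proof -
  let ?u = "cfun u"
  have uS: "Ck_on (Suc (Suc 0)) UNIV u" using u by (simp only: numeral_2_eq_2)
  have u2: "Ck_on (Suc (Suc 0)) UNIV ?u" by (rule Ck_on_of_real[OF open_UNIV uS])
  have d0: "?u differentiable (at x)" for x using Ck_UNIV_differentiable[OF u2] .
  have d1: "cderiv Z ?u differentiable (at x)" for Z x using Ck_UNIV_differentiable[OF Ck_cderiv[OF u2]] .
  have dr: "dir_deriv v ?u = cfun (dir_deriv v u)" for v
    by (rule ext) (rule dir_deriv_bounded_linear[OF bounded_linear_of_real Ck_UNIV_differentiable[OF uS]])
  have dr2: "dir_deriv v' (cfun (dir_deriv v u)) q = of_real (dir_deriv v' (dir_deriv v u) q)" for v v'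
    by (rule dir_deriv_bounded_linear[OF bounded_linear_of_real Ck_UNIV_differentiable[OF Ck_UNIV_dir_deriv[OF uS]]])
  have dd: "dir_deriv v ?u differentiable (at x)" for v x using Ck_UNIV_differentiable[OF Ck_UNIV_dir_deriv[OF u2]] .
  have bar: "dzbar_vec e l = (fst (dz_vec e l), - snd (dz_vec e l))" for l
    by (simp add: dz_vec_def dzbar_vec_def)
  have "(\<Sum>l<2*n. cnj (c l) * cderiv (dzbar_vec e l) ?u p) = cderiv (v c, - w c) ?u p" for p
    unfolding cderiv_lincomb[OF d0] v_def w_def bar by (simp add: sum_negf[symmetric] sum_subtractf)
  then have inner: "(\<Sum>l<2*n. cnj (c l) * cderiv (dzbar_vec e l) ?u p) = cderiv (v c, - w c) ?u p" for p by blast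
  have "herm_quad (2*n) (\<lambda>k l. cderiv (dz_vec e k) (cderiv (dzbar_vec e l) ?u) q) c =
     (\<Sum>k<2*n. c k * cderiv (dz_vec e k) (\<lambda>p. \<Sum>l<2*n. cnj (c l) * cderiv (dzbar_vec e l) ?u p) q)"
    unfolding herm_quad_def
    by (intro sum.cong refl) (simp add: cderiv_sum differentiable_mult d1 cderiv_cmult sum_distrib_left mult_ac)
  also have "\<dots> = cderiv (v c, w c) (cderiv (v c, - w c) ?u) q"
    unfolding inner by (subst cderiv_lincomb) (auto simp: v_def w_def d1)
  also have "\<dots> = of_real (dir_deriv (v c) (dir_deriv (v c) u) q + dir_deriv (w c) (dir_deriv (w c) u) q)"
  proof -
    have neg: "dir_deriv (- w c) ?u p = - 1 * dir_deriv (w c) ?u p" for p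
      using dir_deriv_scaleR_vec[OF d0, of "-1" "w c" p] by simp
    have exp: "cderiv (v c, - w c) ?u = (\<lambda>p. dir_deriv (v c) ?u p + (- \<i>) * dir_deriv (w c) ?u p)"
      by (auto simp: cderiv_def neg)
    have "cderiv (v c, w c) (cderiv (v c, - w c) ?u) q =
      cderiv (v c, w c) (dir_deriv (v c) ?u) q + (- \<i>) * cderiv (v c, w c) (dir_deriv (w c) ?u) q"
      unfolding exp
      by (subst cderiv_add[OF dd differentiable_mult[OF differentiable_const dd]]) (simp only: cderiv_cmult[OF dd])
    also have "\<dots> = of_real (dir_deriv (v c) (dir_deriv (v c) u) q + dir_deriv (w c) (dir_deriv (w c) u) q)"
      by (simp add: cderiv_def dr dr2 dir_deriv_commute_real[OF u, of "w c" "v c"] algebra_simps)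
    finally show ?thesis .
  qed
  finally show ?thesis .
qed

text \<open>The link between right quaternionic lines and positive forms: the Hermitian form at
  \<open>c\<close> is the sum of the second derivatives of \<open>u\<close> in four real directions,
  which are b, bi, bj, bk up to sign for b = \<open>v c\<close>. So it is the Laplacian of
  \<open>u\<close> along one line.\<close>

lemma positive_form_hess:
  fixes e :: "nat \<Rightarrow> 'n::finite" and u :: "quat^'n \<Rightarrow> real"
  assumes e: "bij_betw e {..<CARD('n)} UNIV" and u: "Ck_on 2 UNIV u"
    and pos: "\<And>b. 0 \<le> line_laplacian b u q"
  shows "positive_form CARD('n) (hess (dz_vec e) (J_dz_vec e) (cfun u) q)"
proof -
  let ?n = "CARD('n)" and ?u = "cfun u"
  define h where "h k l = cderiv (dz_vec e k) (cderiv (dzbar_vec e l) ?u) q" for k l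
  have u2: "Ck_on (Suc (Suc 0)) UNIV ?u"
    using Ck_on_of_real[OF open_UNIV u] by (simp only: numeral_2_eq_2)
  have u2': "Ck_on 2 UNIV ?u" using u2 by (simp only: numeral_2_eq_2)
  have d0: "?u differentiable (at x)" for x using Ck_UNIV_differentiable[OF u2] .
  have d1: "cderiv Z ?u differentiable (at x)" for Z x using Ck_UNIV_differentiable[OF Ck_cderiv[OF u2]] .
  have "cderiv (J_dz_vec e i) ?u = (\<lambda>p. (-1) ^ (i + 1) * cderiv (dzbar_vec e (partner i)) ?u p)" for i
    unfolding J_dz_vec_def by (rule ext) (simp only: cderiv_scaleR_vec[OF d0], simp)
  then have a: "hess (dz_vec e) (J_dz_vec e) ?u q k i = (-1) ^ (i + 1) * h k (partner i)" for k i
    unfolding hess_def h_def by (simp only: cderiv_cmult[OF d1])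
  have herm: "herm_of_form (hess (dz_vec e) (J_dz_vec e) ?u q) k l = h k l + (-1) ^ (k + l) * h (partner l) (partner k)" for k l
    unfolding herm_of_form_def a by (simp add: minus_one_partner power_add algebra_simps)
  have hh: "h l k = cnj (h k l)" for k l
  proof -
    have bar: "dzbar_vec e l = (fst (dz_vec e l), - snd (dz_vec e l))"
      "dz_vec e l = (fst (dzbar_vec e l), - snd (dzbar_vec e l))" for l
      by (simp_all add: dz_vec_def dzbar_vec_def)
    have "(\<lambda>p. cnj (cderiv (dzbar_vec e l) ?u p)) = cderiv (dz_vec e l) ?u"
      by (rule ext) (subst bar(2), use cderiv_cnj[OF d0, of "dzbar_vec e l"] in simp)
    then have "cnj (h k l) = cderiv (dzbar_vec e k) (cderiv (dz_vec e l) ?u) q"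
      unfolding h_def by (subst cderiv_cnj[OF d1, symmetric]) (simp only: bar(1)[symmetric])
    then show ?thesis unfolding h_def by (simp only: cderiv_commute[OF u2', of "dz_vec e l"])
  qed
  have psd: "0 \<le> Re (herm_quad (2 * ?n) (herm_of_form (hess (dz_vec e) (J_dz_vec e) ?u q)) c)" for c
  proof -
    \<comment> \<open>Minus J applied to the coefficients. It absorbs the J-conjugated half of
      \<open>herm\<close>, so both halves become values of the same form \<open>h\<close>.\<close>
    define c' where "c' l = (-1) ^ l * cnj (c (partner l))" for l
    define v where "v c = (\<Sum>k<2*?n. Re (c k) *\<^sub>R fst (dz_vec e k) - Im (c k) *\<^sub>R snd (dz_vec e k))" for c
    define w where "w c = (\<Sum>k<2*?n. Re (c k) *\<^sub>R snd (dz_vec e k) + Im (c k) *\<^sub>R fst (dz_vec e k))" for c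
    have bij: "bij_betw partner {..<2*?n} {..<2*?n}"
      by (rule bij_betwI[of _ _ _ partner]) auto
    have re: "(\<Sum>k<2*?n. f k) = (\<Sum>k<2*?n. f (partner k))" for f :: "nat \<Rightarrow> complex"
      by (rule sum.reindex_bij_betw[OF bij, symmetric])
    have "herm_quad (2*?n) (\<lambda>k l. (-1) ^ (k + l) * h (partner l) (partner k)) c = herm_quad (2*?n) h c'"
    proof -
      have "herm_quad (2*?n) (\<lambda>k l. (-1) ^ (k + l) * h (partner l) (partner k)) c =
        (\<Sum>k<2*?n. \<Sum>l<2*?n. (-1) ^ (k + l) * h (partner l) (partner k) * c k * cnj (c l))"
        by (simp add: herm_quad_def)
      also have "\<dots> = (\<Sum>k<2*?n. \<Sum>l<2*?n. (-1) ^ (partner k + partner l) *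
          h (partner (partner l)) (partner (partner k)) * c (partner k) * cnj (c (partner l)))"
        by (rule trans[OF re]) (intro sum.cong refl re)
      also have "\<dots> = (\<Sum>k<2*?n. \<Sum>l<2*?n. h l k * c' l * cnj (c' k))"
        by (intro sum.cong refl) (simp add: c'_def power_add minus_one_partner)
      also have "\<dots> = herm_quad (2*?n) h c'"
        unfolding herm_quad_def by (rule sum.swap)
      finally show ?thesis .
    qed
    then have split: "herm_quad (2 * ?n) (herm_of_form (hess (dz_vec e) (J_dz_vec e) ?u q)) c = herm_quad (2*?n) h c + herm_quad (2*?n) h c'"
      by (simp add: herm_quad_def herm sum.distrib distrib_right)
    have hq: "herm_quad (2*?n) h c = of_real (dir_deriv (v c) (dir_deriv (v c) u) q + dir_deriv (w c) (dir_deriv (w c) u) q)" for c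
      unfolding h_def v_def w_def by (rule hermitian_part_quad[OF u])
    have quad: "Re (herm_quad (2 * ?n) (herm_of_form (hess (dz_vec e) (J_dz_vec e) ?u q)) c) =
        dir_deriv (v c) (dir_deriv (v c) u) q + dir_deriv (w c) (dir_deriv (w c) u) q +
        (dir_deriv (v c') (dir_deriv (v c') u) q + dir_deriv (w c') (dir_deriv (w c') u) q)"
      unfolding split hq by simp
    define Q where "Q p = (\<Sum>i<?n. axis (e i) (p i))" for p :: "nat \<Rightarrow> quat"
    have Q_nth: "Q p $ e i = p i" if "i < ?n" for p i
    proof -
      have "Q p $ e i = (\<Sum>j<?n. if j = i then p i else 0)"
        unfolding Q_def sum_component using e that
        by (intro sum.cong refl) (auto simp: axis_def bij_betw_def inj_on_def)
      then show ?thesis using that by simp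
    qed
    have x: "x_vec e (2*(2*i)) = axis (e i) (quat 1 0 0 0)" "x_vec e (2*(2*i)+1) = axis (e i) (quat 0 1 0 0)"
      "x_vec e (2*(2*i+1)) = axis (e i) (quat 0 0 1 0)" "x_vec e (2*(2*i+1)+1) = axis (e i) (quat 0 0 0 1)" for i
    proof -
      have "2 * (2*i) div 4 = i" "2 * (2*i) mod 4 = 0" "(2 * (2*i) + 1) div 4 = i"
        "(2 * (2*i) + 1) mod 4 = 1" "2 * (2*i+1) div 4 = i" "2 * (2*i+1) mod 4 = 2"
        "(2 * (2*i+1) + 1) div 4 = i" "(2 * (2*i+1) + 1) mod 4 = 3" by presburger+
      moreover have "axis (0::4) 1 = quat 1 0 0 0" "axis (1::4) 1 = quat 0 1 0 0" "axis (2::4) 1 = quat 0 0 1 0" "axis (3::4) 1 = quat 0 0 0 1"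
        by (auto simp: vec_eq_iff axis_def forall_4 quat_def)
      ultimately show "x_vec e (2*(2*i)) = axis (e i) (quat 1 0 0 0)" "x_vec e (2*(2*i)+1) = axis (e i) (quat 0 1 0 0)"
        "x_vec e (2*(2*i+1)) = axis (e i) (quat 0 0 1 0)" "x_vec e (2*(2*i+1)+1) = axis (e i) (quat 0 0 0 1)"
        by (simp_all add: x_vec_def)
    qed
    have ax: "r *\<^sub>R axis j p = axis j (r *\<^sub>R p)" "axis j p + axis j p' = axis j (p + p')" "axis j p - axis j p' = axis j (p - p')"
      for r and j :: 'n and p p' :: quat
      by (auto simp: vec_eq_iff axis_def)
    have v: "v c = Q (\<lambda>i. quat (Re (c (2*i)) / 2) (Im (c (2*i)) / 2) (Re (c (2*i+1)) / 2) (- Im (c (2*i+1)) / 2))" for c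
      unfolding v_def Q_def sum_pairs dz_vec_def fst_conv snd_conv x ax
      by (intro sum.cong refl arg_cong2[where f = axis]) (auto simp: vec_eq_iff forall_4 quat_def)
    have w: "w c = Q (\<lambda>i. quat (Im (c (2*i)) / 2) (- Re (c (2*i)) / 2) (Im (c (2*i+1)) / 2) (Re (c (2*i+1)) / 2))" for c
      unfolding w_def Q_def sum_pairs dz_vec_def fst_conv snd_conv x ax
      by (intro sum.cong refl arg_cong2[where f = axis]) (auto simp: vec_eq_iff forall_4 quat_def)
    have c': "c' (2*i) = cnj (c (2*i+1))" "c' (2*i+1) = - cnj (c (2*i))" for i
      by (simp_all add: c'_def partner_def)
    have four: "p $ 4 = p $ 0" for p :: quat by (rule arg_cong[where f = "($) p"]) simp
    have all: "A = B" if "\<And>i. i < ?n \<Longrightarrow> A $ e i = B $ e i" for A B :: "quat^'n"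
    proof -
      have "\<exists>i<?n. j = e i" for j using e by (auto simp: bij_betw_def image_iff set_eq_iff)
      then show ?thesis using that by (metis vec_eq_iff)
    qed
    \<comment> \<open>Right multiplication by 1, i, j, k; by \<open>neg\<close> below, the signs
      disappear in second derivatives.\<close>
    have r: "right_scale (v c) (quat 1 0 0 0) = v c" "right_scale (v c) (quat 0 1 0 0) = - w c"
      "right_scale (v c) (quat 0 0 1 0) = - v c'" "right_scale (v c) (quat 0 0 0 1) = - w c'"
      by (rule all; simp add: right_scale_def v w Q_nth c' c'[simplified] qmult_def vec_eq_iff forall_4 four)+
    have uS: "Ck_on (Suc (Suc 0)) UNIV u" using u by (simp only: numeral_2_eq_2)
    have neg: "dir_deriv (- b) (dir_deriv (- b) u) q = dir_deriv b (dir_deriv b u) q" for b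
    proof -
      have "dir_deriv (- b) u = (\<lambda>p. (- 1) *\<^sub>R dir_deriv b u p)"
        using dir_deriv_scaleR_vec[OF Ck_UNIV_differentiable[OF uS], of "-1" b] by auto
      then show ?thesis
        using dir_deriv_scaleR_vec[OF Ck_UNIV_differentiable[OF Ck_UNIV_dir_deriv[OF uS]], of "-1" b b q]
          dir_deriv_bounded_linear[OF bounded_linear_scaleR_right Ck_UNIV_differentiable[OF Ck_UNIV_dir_deriv[OF uS]], of "- b" "-1" b q]
        by simp
    qed
    have "Re (herm_quad (2 * ?n) (herm_of_form (hess (dz_vec e) (J_dz_vec e) ?u q)) c) = line_laplacian (v c) u q"
      unfolding quad line_laplacian_def quat_basis r neg by simp
    then show ?thesis using pos by simp
  qed
  show ?thesis
    unfolding positive_form_def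
  proof (intro conjI allI impI)
    fix k l
    show "herm_of_form (hess (dz_vec e) (J_dz_vec e) ?u q) l k = cnj (herm_of_form (hess (dz_vec e) (J_dz_vec e) ?u q) k l)"
      unfolding herm hh[of k l] hh[of "partner l" "partner k"] by (simp add: add.commute)
  qed (rule psd)
qed

lemma mixed_MA_nonneg:
  fixes e :: "nat \<Rightarrow> 'n::finite"
  assumes e: "bij_betw e {..<CARD('n)} UNIV" and "length us = CARD('n)"
    and "\<And>u. u \<in> set us \<Longrightarrow> Ck_on 2 UNIV u" "\<And>u b. u \<in> set us \<Longrightarrow> 0 \<le> line_laplacian b u q"
  shows "\<exists>r\<ge>0. mixed_MA e us q = complex_of_real r"
  unfolding mixed_MA_def hess_prod_def
  by (rule positive_forms_product_nonneg) (use assms positive_form_hess[OF e] in auto)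

section \<open>Subharmonic functions\<close>

lemma Ck_on_subset: "Ck_on k S f \<Longrightarrow> T \<subseteq> S \<Longrightarrow> Ck_on k T f"
  by (induction k arbitrary: f) (auto intro: continuous_on_subset)

lemma Ck_linear:
  fixes L :: "'a::euclidean_space \<Rightarrow> 'b::real_normed_vector"
  assumes "bounded_linear L"
  shows "Ck_on k UNIV L"
proof (cases k)
  case 0
  then show ?thesis using assms by (simp add: linear_continuous_on)
next
  case (Suc m)
  have D: "(L has_derivative L) (at x)" for x by (rule bounded_linear_imp_has_derivative[OF assms])
  have "dir_deriv b L = (\<lambda>x. L b)" for b by (rule ext) (rule dir_deriv_eq[OF D])
  then show ?thesis using D Suc by (auto simp: differentiable_def Ck_const)
qed

lemma Ck_inner_left: "Ck_on k UNIV (\<lambda>x::'a::euclidean_space. x \<bullet> b)"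
  by (rule Ck_linear[OF bounded_linear_inner_left])

lemma dir_deriv2_expand:
  fixes f :: "'a::euclidean_space \<Rightarrow> real"
  assumes "Ck_on 2 UNIV f"
  shows "dir_deriv x (dir_deriv y f) q =
    (\<Sum>a\<in>Basis. \<Sum>b\<in>Basis. (x \<bullet> a) * (y \<bullet> b) * dir_deriv a (dir_deriv b f) q)"
proof -
  have C: "Ck_on (Suc (Suc 0)) UNIV f" using assms by (simp only: numeral_2_eq_2)
  have 1: "dir_deriv y f = (\<lambda>p. \<Sum>b\<in>Basis. (y \<bullet> b) *\<^sub>R dir_deriv b f p)"
    by (rule ext) (rule dir_deriv_eq_sum[OF Ck_UNIV_differentiable[OF C]])
  have "(dir_deriv y f has_derivative (\<lambda>v. \<Sum>b\<in>Basis. (y \<bullet> b) *\<^sub>R dir_deriv v (dir_deriv b f) q)) (at q)"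
    unfolding 1
    by (intro has_derivative_sum has_derivative_scaleR_right has_derivative_dir_deriv
        Ck_UNIV_differentiable[OF Ck_UNIV_dir_deriv[OF C]])
  then have 2: "dir_deriv a (dir_deriv y f) q = (\<Sum>b\<in>Basis. (y \<bullet> b) *\<^sub>R dir_deriv a (dir_deriv b f) q)" for a
    by (rule dir_deriv_eq)
  show ?thesis
    by (subst dir_deriv_eq_sum[OF Ck_UNIV_differentiable[OF Ck_UNIV_dir_deriv[OF C]]])
       (simp add: 2 sum_distrib_left mult.assoc)
qed

lemma taylor_upper_bound:
  fixes f :: "'a::euclidean_space \<Rightarrow> real"
  assumes C: "Ck_on 2 UNIV f" and "\<epsilon> > 0"
  shows "\<exists>r>0. \<forall>x. norm x \<le> r \<longrightarrow>
    f x \<le> f 0 + dir_deriv x f 0 + dir_deriv x (dir_deriv x f) 0 / 2 + \<epsilon> / 2 * (norm x)\<^sup>2"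
proof -
  have C2: "Ck_on (Suc (Suc 0)) UNIV f" using C by (simp only: numeral_2_eq_2)
  let ?N = "real DIM('a)"
  \<comment> \<open>The second differential is a double sum over the basis, so \<epsilon> is shared
    among its squared-dimension many entries.\<close>
  define \<eta> where "\<eta> = \<epsilon> / ?N\<^sup>2"
  have \<eta>: "\<eta> > 0" using assms(2) by (simp add: \<eta>_def)
  have "\<forall>\<^sub>F y in nhds 0. \<bar>dir_deriv a (dir_deriv b f) y - dir_deriv a (dir_deriv b f) 0\<bar> < \<eta>" for a b
  proof -
    have "isCont (dir_deriv a (dir_deriv b f)) 0"
      using Ck_UNIV_dir_deriv[OF Ck_UNIV_dir_deriv[OF C2]] by (simp add: continuous_on_eq_continuous_at)
    then have "(dir_deriv a (dir_deriv b f) \<longlongrightarrow> dir_deriv a (dir_deriv b f) 0) (nhds 0)"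
      by (simp add: isCont_def tendsto_at_iff_tendsto_nhds)
    from tendstoD[OF this \<eta>] show ?thesis by (simp add: dist_real_def)
  qed
  then have "\<forall>\<^sub>F y in nhds (0::'a). \<forall>a\<in>Basis. \<forall>b\<in>Basis.
      \<bar>dir_deriv a (dir_deriv b f) y - dir_deriv a (dir_deriv b f) 0\<bar> < \<eta>"
    by (intro eventually_ball_finite ballI) auto
  then obtain r where r: "r > 0" "\<And>y a b. norm y < r \<Longrightarrow> a \<in> Basis \<Longrightarrow> b \<in> Basis \<Longrightarrow>
      \<bar>dir_deriv a (dir_deriv b f) y - dir_deriv a (dir_deriv b f) 0\<bar> < \<eta>"
    by (auto simp: eventually_nhds_metric)
  have diff: "\<bar>dir_deriv x (dir_deriv x f) y - dir_deriv x (dir_deriv x f) 0\<bar> \<le> \<epsilon> * (norm x)\<^sup>2" if "norm y < r" for x y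
  proof -
    have "\<bar>dir_deriv x (dir_deriv x f) y - dir_deriv x (dir_deriv x f) 0\<bar> =
      \<bar>\<Sum>a\<in>Basis. \<Sum>b\<in>Basis. (x \<bullet> a) * (x \<bullet> b) * (dir_deriv a (dir_deriv b f) y - dir_deriv a (dir_deriv b f) 0)\<bar>"
      unfolding dir_deriv2_expand[OF C, of x x] by (simp add: sum_subtractf right_diff_distrib)
    also have "\<dots> \<le> (\<Sum>a\<in>Basis. \<bar>\<Sum>b\<in>Basis. (x \<bullet> a) * (x \<bullet> b) * (dir_deriv a (dir_deriv b f) y - dir_deriv a (dir_deriv b f) 0)\<bar>)"
      by (rule sum_abs)
    also have "\<dots> \<le> (\<Sum>a\<in>(Basis::'a set). \<Sum>b\<in>(Basis::'a set). norm x * norm x * \<eta>)"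
    proof (rule sum_mono)
      fix a :: 'a assume a: "a \<in> Basis"
      have "\<bar>\<Sum>b\<in>Basis. (x \<bullet> a) * (x \<bullet> b) * (dir_deriv a (dir_deriv b f) y - dir_deriv a (dir_deriv b f) 0)\<bar> \<le>
        (\<Sum>b\<in>Basis. \<bar>(x \<bullet> a) * (x \<bullet> b) * (dir_deriv a (dir_deriv b f) y - dir_deriv a (dir_deriv b f) 0)\<bar>)"
        by (rule sum_abs)
      also have "\<dots> \<le> (\<Sum>b\<in>(Basis::'a set). norm x * norm x * \<eta>)"
        unfolding abs_mult using a that r(2)[of y]
        by (intro sum_mono mult_mono Basis_le_norm) (auto intro: less_imp_le)
      finally show "\<bar>\<Sum>b\<in>Basis. (x \<bullet> a) * (x \<bullet> b) * (dir_deriv a (dir_deriv b f) y - dir_deriv a (dir_deriv b f) 0)\<bar> \<le>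
        (\<Sum>b\<in>(Basis::'a set). norm x * norm x * \<eta>)" .
    qed
    also have "\<dots> = \<epsilon> * (norm x)\<^sup>2" by (simp add: \<eta>_def power2_eq_square)
    finally show ?thesis .
  qed
  have "f x \<le> f 0 + dir_deriv x f 0 + dir_deriv x (dir_deriv x f) 0 / 2 + \<epsilon> / 2 * (norm x)\<^sup>2" if x: "norm x \<le> r / 2" for x
  proof -
    define df where "df m t = (if m = 0 then f (t *\<^sub>R x) else if m = 1 then dir_deriv x f (t *\<^sub>R x)
       else dir_deriv x (dir_deriv x f) (t *\<^sub>R x))" for m :: nat and t :: real
    have "\<exists>t. 0 < t \<and> t < 1 \<and> (\<lambda>t. f (t *\<^sub>R x)) 1 = (\<Sum>m<2. df m 0 / fact m * 1 ^ m) + df 2 t / fact 2 * 1 ^ 2"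
    proof (rule Maclaurin)
      show "\<forall>m t. m < 2 \<and> 0 \<le> t \<and> t \<le> 1 \<longrightarrow> (df m has_real_derivative df (Suc m) t) (at t)"
      proof (intro allI impI)
        fix m :: nat and t :: real assume "m < 2 \<and> 0 \<le> t \<and> t \<le> 1"
        then have "m = 0 \<or> m = 1" by auto
        then show "(df m has_real_derivative df (Suc m) t) (at t)"
          using has_real_derivative_along_line[where x = 0 and v = x and t = t, OF Ck_UNIV_differentiable[OF C2]]
            has_real_derivative_along_line[where x = 0 and v = x and t = t, OF Ck_UNIV_differentiable[OF Ck_UNIV_dir_deriv[OF C2]]]
          by (auto simp: df_def[abs_def])
      qed
    qed (auto simp: df_def)
    then obtain t where t: "0 < t" "t < 1" "f x = f 0 + dir_deriv x f 0 + dir_deriv x (dir_deriv x f) (t *\<^sub>R x) / 2"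
      by (auto simp: df_def numeral_2_eq_2)
    have "norm (t *\<^sub>R x) \<le> norm x" using t by (simp add: mult_left_le_one_le)
    then have "norm (t *\<^sub>R x) < r" using x r(1) by linarith
    from diff[OF this, of x] show ?thesis unfolding t(3) by (simp add: abs_le_iff)
  qed
  then show ?thesis using r(1) by (intro exI[of _ "r/2"]) auto
qed

lemma quadratic_derivs:
  fixes L :: "'a::euclidean_space \<Rightarrow> real" and m :: "'a \<Rightarrow> 'a \<Rightarrow> real" and k :: real
  assumes L: "linear L"
  defines "p \<equiv> \<lambda>x. k + L x + (\<Sum>a\<in>Basis. \<Sum>b\<in>Basis. (x \<bullet> a) * (x \<bullet> b) * m a b) / 2"
  shows "Ck_on j UNIV p"
    and "b \<in> Basis \<Longrightarrow> dir_deriv b (dir_deriv b p) x = m b b"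
proof -
  have bl: "bounded_linear L" using L by (simp add: linear_linear)
  have "Ck_on j UNIV (\<lambda>x. k + L x + (1/2) * (\<Sum>a\<in>Basis. \<Sum>b\<in>Basis. m a b * ((x \<bullet> a) * (x \<bullet> b))))"
    by (intro Ck_on_add Ck_const Ck_linear[OF bl] Ck_on_cmult Ck_on_sum Ck_on_mult Ck_inner_left open_UNIV)
  then show "Ck_on j UNIV p" by (simp add: p_def mult_ac)
  \<comment> \<open>\<open>B\<close> is in general not symmetric. The second derivatives see its
    symmetrisation, which agrees with \<open>m\<close> on the diagonal.\<close>
  define B where "B x y = (\<Sum>a\<in>Basis. \<Sum>b\<in>Basis. (x \<bullet> a) * (y \<bullet> b) * m a b)" for x y :: 'a
  have "bilinear B"
    unfolding bilinear_def B_def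
    by (intro conjI allI linearI) (simp_all add: inner_add_left algebra_simps sum.distrib sum_distrib_left)
  then interpret B: bounded_bilinear B by (simp add: bilinear_conv_bounded_bilinear)
  have p: "p = (\<lambda>x. k + L x + B x x / 2)" by (simp add: p_def B_def)
  have D1: "dir_deriv v p x = L v + (B x v + B v x) / 2" for v x
    unfolding p
    by (rule dir_deriv_eq) (auto intro!: derivative_eq_intros B.FDERIV bounded_linear_imp_has_derivative[OF bl])
  have D2: "dir_deriv w (dir_deriv v p) x = (B w v + B v w) / 2" for v w x
  proof -
    have "dir_deriv v p = (\<lambda>x. L v + (B x v + B v x) / 2)" using D1 by auto
    then show ?thesis
      by (simp only:) (rule dir_deriv_eq, auto intro!: derivative_eq_intros
          bounded_linear_imp_has_derivative[OF B.bounded_linear_left] bounded_linear_imp_has_derivative[OF B.bounded_linear_right])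
  qed
  assume b: "b \<in> Basis"
  have "B b b = (\<Sum>a\<in>Basis. if a = b then m b b else 0)"
    unfolding B_def
  proof (intro sum.cong refl)
    fix a :: 'a assume a: "a \<in> Basis"
    have "(\<Sum>b'\<in>Basis. (b \<bullet> a) * (b \<bullet> b') * m a b') = (\<Sum>b'\<in>Basis. if b' = b then (b \<bullet> a) * m a b else 0)"
      using b by (intro sum.cong refl) (auto simp: inner_Basis)
    then show "(\<Sum>b'\<in>Basis. (b \<bullet> a) * (b \<bullet> b') * m a b') = (if a = b then m b b else 0)"
      using a b by (auto simp: inner_Basis)
  qed
  then show "dir_deriv b (dir_deriv b p) x = m b b" using b by (simp add: D2)
qed

text \<open>
  If the Laplacian is negative at the origin, then the second Taylor polynomial, made trace free
  and lowered, is a harmonic majorant on small spheres that lies below the function at the centre.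
\<close>

lemma subharmonic_laplacian_nonneg:
  fixes f :: "'a::euclidean_space \<Rightarrow> real"
  assumes C: "Ck_on 2 UNIV f" and sub: "subharmonic_on UNIV (\<lambda>x. ereal (f x))"
  shows "0 \<le> (\<Sum>b\<in>Basis. dir_deriv b (dir_deriv b f) 0)"
proof (rule ccontr)
  let ?s = "\<Sum>b\<in>Basis. dir_deriv b (dir_deriv b f) 0"
  assume "\<not> 0 \<le> ?s"
  define c where "c = ?s / real DIM('a)"
  have c: "c < 0" using \<open>\<not> 0 \<le> ?s\<close> by (simp add: c_def divide_neg_pos)
  have C2: "Ck_on (Suc (Suc 0)) UNIV f" using C by (simp only: numeral_2_eq_2)
  obtain r where r: "r > 0" "\<And>x. norm x \<le> r \<Longrightarrow>
      f x \<le> f 0 + dir_deriv x f 0 + dir_deriv x (dir_deriv x f) 0 / 2 + (- c / 2) / 2 * (norm x)\<^sup>2"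
    using taylor_upper_bound[OF C, of "- c / 2"] c by auto
  define m where "m a b = dir_deriv a (dir_deriv b f) 0 - (if a = b then c else 0)" for a b
  \<comment> \<open>On the sphere of radius \<open>r\<close>, removing the trace raises the
    polynomial by -(c/2) r^2, as \<open>c\<close> is negative. Half of this pays for the Taylor
    error, the other half for the lowering by -(c/4) r^2.\<close>
  define h where "h = (\<lambda>x. (f 0 + c / 4 * r\<^sup>2) + dir_deriv x f 0 +
     (\<Sum>a\<in>Basis. \<Sum>b\<in>Basis. (x \<bullet> a) * (x \<bullet> b) * m a b) / 2)"
  have lin: "linear (\<lambda>x. dir_deriv x f 0)" by (rule linear_dir_deriv[OF Ck_UNIV_differentiable[OF C2]])
  note q = quadratic_derivs[OF lin, where k = "f 0 + c / 4 * r\<^sup>2" and m = m, folded h_def]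
  have quad: "(\<Sum>a\<in>Basis. \<Sum>b\<in>Basis. (x \<bullet> a) * (x \<bullet> b) * m a b) = dir_deriv x (dir_deriv x f) 0 - c * (norm x)\<^sup>2" for x
  proof -
    have "(\<Sum>b\<in>Basis. (x \<bullet> a) * (x \<bullet> b) * m a b) =
       (\<Sum>b\<in>Basis. (x \<bullet> a) * (x \<bullet> b) * dir_deriv a (dir_deriv b f) 0) - c * (x \<bullet> a)\<^sup>2" if "a \<in> Basis" for a
    proof -
      have "(\<Sum>b\<in>Basis. (x \<bullet> a) * (x \<bullet> b) * m a b) =
        (\<Sum>b\<in>Basis. (x \<bullet> a) * (x \<bullet> b) * dir_deriv a (dir_deriv b f) 0 - (if b = a then c * (x \<bullet> a)\<^sup>2 else 0))"
        by (intro sum.cong refl) (auto simp: m_def power2_eq_square algebra_simps)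
      then show ?thesis using that by (simp add: sum_subtractf)
    qed
    then have "(\<Sum>a\<in>Basis. \<Sum>b\<in>Basis. (x \<bullet> a) * (x \<bullet> b) * m a b) =
      dir_deriv x (dir_deriv x f) 0 - c * (\<Sum>a\<in>Basis. (x \<bullet> a)\<^sup>2)"
      unfolding dir_deriv2_expand[OF C, of x x] by (simp add: sum_subtractf sum_distrib_left)
    also have "(\<Sum>a\<in>Basis. (x \<bullet> a)\<^sup>2) = (norm x)\<^sup>2"
      by (simp only: power2_norm_eq_inner euclidean_inner[of x x]) (simp only: power2_eq_square)
    finally show ?thesis .
  qed
  have harm: "harmonic_on (ball 0 r) h"
    unfolding harmonic_on_def
  proof (intro conjI ballI)
    show "Ck_on 2 (ball 0 r) h" using Ck_on_subset[OF q(1)] by auto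
    have "(\<Sum>b\<in>Basis. m b b) = ?s - c * real DIM('a)" by (simp add: m_def sum_subtractf mult.commute)
    then show "(\<Sum>b\<in>Basis. dir_deriv b (dir_deriv b h) x) = 0" for x
      using q(2) by (simp add: c_def)
  qed
  have "ereal (f 0) \<le> ereal (h 0)"
  proof -
    have "f x \<le> h x" if "norm x = r" for x
      using r(2)[of x] that unfolding h_def quad by (simp add: field_simps)
    moreover have "continuous_on (cball 0 r) h" using Ck_on_imp_continuous[OF q(1)] continuous_on_subset by blast
    ultimately show ?thesis
      using sub[unfolded subharmonic_on_def] harm r(1)
      by (elim conjE allE[of _ "ball 0 r"] allE[of _ h]) (auto simp: frontier_ball sphere_def)
  qed
  moreover have "h 0 = f 0 + c / 4 * r\<^sup>2"
    using linear_0[OF lin] by (simp add: h_def)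
  moreover have "c / 4 * r\<^sup>2 < 0" using c r(1) by (intro mult_neg_pos) auto
  ultimately show False by simp
qed

lemma second_derivative_local_max:
  fixes \<phi> :: "real \<Rightarrow> real"
  assumes "d > 0" and D: "\<And>t. \<bar>t\<bar> < d \<Longrightarrow> (\<phi> has_real_derivative \<phi>' t) (at t)"
    and D2: "(\<phi>' has_real_derivative s) (at 0)" and mx: "\<And>t. \<bar>t\<bar> < d \<Longrightarrow> \<phi> t \<le> \<phi> 0"
  shows "s \<le> 0"
proof (rule ccontr)
  assume "\<not> s \<le> 0"
  have "\<phi>' 0 = 0"
    by (rule DERIV_local_max[where f = \<phi> and x = 0 and d = d]) (use assms in auto)
  then obtain d' where d': "d' > 0" "\<And>h. 0 < h \<Longrightarrow> h < d' \<Longrightarrow> 0 < \<phi>' h"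
    using DERIV_pos_inc_right[OF D2] \<open>\<not> s \<le> 0\<close> by auto
  define t where "t = min d d' / 2"
  have t: "0 < t" "t < d" "t < d'" using assms(1) d'(1) by (auto simp: t_def)
  have "\<exists>z>0. z < t \<and> \<phi> t - \<phi> 0 = (t - 0) * \<phi>' z"
    by (rule MVT2[OF t(1)]) (use D t in auto)
  then obtain z where "0 < z" "z < t" "\<phi> t - \<phi> 0 = t * \<phi>' z" by auto
  moreover have "t * \<phi>' z > 0" using calculation d'(2)[of z] t by auto
  ultimately show False using mx[of t] t by auto
qed

text \<open>Maximum principle: f - h + \<delta> |x|^2 has no interior maximum, since its Laplacian
  would be at most 0 there but is at least 2\<delta> times the dimension.\<close>

lemma subharmonic_if_laplacian_nonneg:
  fixes f :: "'a::euclidean_space \<Rightarrow> real"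
  assumes C: "Ck_on 2 UNIV f" and lap: "\<And>x. 0 \<le> (\<Sum>b\<in>Basis. dir_deriv b (dir_deriv b f) x)"
  shows "subharmonic_on UNIV (\<lambda>x. ereal (f x))"
proof -
  have C2: "Ck_on (Suc (Suc 0)) UNIV f" using C by (simp only: numeral_2_eq_2)
  have cf: "continuous_on UNIV f" using Ck_on_imp_continuous[OF C] .
  have usc: "usc_on UNIV (\<lambda>x. ereal (f x))"
    unfolding usc_on_def
  proof (intro conjI ballI allI)
    fix c :: ereal
    show "openin (top_of_set UNIV) {x \<in> UNIV. ereal (f x) < c}"
      by (cases c) (auto intro!: open_Collect_less continuous_intros cf)
  qed auto
  have "f x1 \<le> h x1"
    if G: "open G" "compact (closure G)" and ch: "continuous_on (closure G) h" and hh: "harmonic_on G h"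
      and bd: "\<And>x. x \<in> frontier G \<Longrightarrow> f x \<le> h x" and x1: "x1 \<in> G" for G h x1
  proof (rule ccontr)
    assume "\<not> f x1 \<le> h x1"
    then have gap: "0 < f x1 - h x1" by simp
    obtain R where R: "R > 0" "\<And>x. x \<in> closure G \<Longrightarrow> norm x \<le> R"
      using compact_imp_bounded[OF G(2)] bounded_pos by metis
    \<comment> \<open>The perturbation stays within half of the gap on the closure, so it cannot
      push the maximum to the frontier.\<close>
    define \<delta> where "\<delta> = (f x1 - h x1) / (2 * R\<^sup>2)"
    have \<delta>: "\<delta> > 0" using gap R by (simp add: \<delta>_def)
    define w where "w x = f x - h x + \<delta> * (x \<bullet> x)" for x
    have "continuous_on (closure G) w"
      unfolding w_def by (intro continuous_intros ch continuous_on_subset[OF cf]) auto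
    then obtain x0 where x0: "x0 \<in> closure G" "\<And>x. x \<in> closure G \<Longrightarrow> w x \<le> w x0"
      using continuous_attains_sup[OF G(2)] x1 closure_subset by (metis empty_iff subsetD)
    have "w x1 \<le> w x0" using x0(2) x1 closure_subset by blast
    then have wx0: "f x1 - h x1 \<le> w x0" using \<delta> by (simp add: w_def) (smt (verit) inner_ge_zero mult_nonneg_nonneg)
    have x0G: "x0 \<in> G"
    proof (rule ccontr)
      assume "x0 \<notin> G"
      then have "x0 \<in> frontier G" using x0(1) G(1) by (simp add: frontier_def interior_open)
      then have "w x0 \<le> \<delta> * (norm x0)\<^sup>2" using bd by (simp add: w_def power2_norm_eq_inner)
      also have "\<dots> \<le> \<delta> * R\<^sup>2" using \<delta> R(2)[OF x0(1)] by (intro mult_left_mono power_mono) auto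
      also have "\<dots> = (f x1 - h x1) / 2" using R(1) by (simp add: \<delta>_def)
      finally show False using wx0 gap by simp
    qed
    obtain d where d: "d > 0" "ball x0 d \<subseteq> G" using G(1) x0G open_contains_ball by blast
    have hC: "Ck_on (Suc (Suc 0)) G h" using hh by (simp only: harmonic_on_def numeral_2_eq_2)
    have le: "dir_deriv b (dir_deriv b f) x0 - dir_deriv b (dir_deriv b h) x0 + 2 * \<delta> \<le> 0" if b: "b \<in> Basis" for b
    proof (rule second_derivative_local_max[OF d(1)])
      have inG: "x0 + t *\<^sub>R b \<in> G" if "\<bar>t\<bar> < d" for t
        using d(2) that b by (auto simp: subset_iff dist_norm)
      fix t :: real assume t: "\<bar>t\<bar> < d"
      have "h differentiable (at (x0 + t *\<^sub>R b))" using hC inG[OF t] by auto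
      note hd = has_real_derivative_along_line[OF this]
      note fd = has_real_derivative_along_line[where x = x0 and t = t and v = b, OF Ck_UNIV_differentiable[OF C2]]
      show "((\<lambda>t. w (x0 + t *\<^sub>R b)) has_real_derivative
         (\<lambda>t. dir_deriv b f (x0 + t *\<^sub>R b) - dir_deriv b h (x0 + t *\<^sub>R b) + \<delta> * (2 * (x0 \<bullet> b) + 2 * t)) t) (at t)"
      proof -
        have "((\<lambda>t. (x0 + t *\<^sub>R b) \<bullet> (x0 + t *\<^sub>R b)) has_real_derivative 2 * (x0 \<bullet> b) + 2 * t) (at t)"
        proof -
          have "(x0 + t *\<^sub>R b) \<bullet> (x0 + t *\<^sub>R b) = x0 \<bullet> x0 + 2 * t * (x0 \<bullet> b) + t * t" for t
            using b by (simp add: inner_add_left inner_add_right inner_commute[of b x0] inner_same_Basis algebra_simps)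
          then show ?thesis by (simp only:) (auto intro!: derivative_eq_intros)
        qed
        then show ?thesis unfolding w_def by (intro derivative_intros DERIV_cmult fd hd)
      qed
      show "w (x0 + t *\<^sub>R b) \<le> w (x0 + 0 *\<^sub>R b)" using x0(2) inG[OF t] closure_subset by fastforce
    next
      have "dir_deriv b h differentiable (at (x0 + 0 *\<^sub>R b))" using hC x0G b by auto
      note hd = has_real_derivative_along_line[OF this]
      note fd = has_real_derivative_along_line[where x = x0 and t = 0 and v = b, OF Ck_UNIV_differentiable[OF Ck_UNIV_dir_deriv[OF C2, of b]]]
      show "((\<lambda>t. dir_deriv b f (x0 + t *\<^sub>R b) - dir_deriv b h (x0 + t *\<^sub>R b) + \<delta> * (2 * (x0 \<bullet> b) + 2 * t)) has_real_derivative
         dir_deriv b (dir_deriv b f) x0 - dir_deriv b (dir_deriv b h) x0 + 2 * \<delta>) (at 0)"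
        using fd hd by (auto intro!: derivative_eq_intros)
    qed
    have "(\<Sum>b\<in>Basis. dir_deriv b (dir_deriv b f) x0 - dir_deriv b (dir_deriv b h) x0 + 2 * \<delta>) \<le> 0"
      using le by (rule sum_nonpos)
    moreover have "(\<Sum>b\<in>Basis. dir_deriv b (dir_deriv b h) x0) = 0"
      using hh x0G by (simp add: harmonic_on_def)
    ultimately have "(\<Sum>b\<in>Basis. dir_deriv b (dir_deriv b f) x0) + real DIM('a) * (2 * \<delta>) \<le> 0"
      by (simp add: sum.distrib sum_subtractf)
    moreover have "0 < real DIM('a) * (2 * \<delta>)" using \<delta> by simp
    ultimately show False using lap[of x0] by linarith
  qed
  then show ?thesis unfolding subharmonic_on_def using usc by auto
qed

lemma usc_decreasing_limit:
  fixes f :: "nat \<Rightarrow> 'a::topological_space \<Rightarrow> real"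
  assumes c: "\<And>j. continuous_on UNIV (f j)" and dec: "\<And>x. decseq (\<lambda>j. f j x)"
    and lim: "\<And>x. (\<lambda>j. ereal (f j x)) \<longlonglongrightarrow> u x"
  shows "usc_on UNIV u" "u x \<le> ereal (f j x)"
proof -
  have le: "u x \<le> ereal (f j x)" for x j
    using decseq_ge[OF _ lim, of x j] dec[of x] by (simp add: decseq_def)
  then show "u x \<le> ereal (f j x)" .
  have "{x. u x < c} = (\<Union>j. {x. ereal (f j x) < c})" for c
  proof safe
    fix x assume "u x < c"
    from order_tendstoD(2)[OF lim this] show "x \<in> (\<Union>j. {x. ereal (f j x) < c})"
      by (auto dest: eventually_happens)
  next
    fix x j assume "ereal (f j x) < c"
    then show "u x < c" using le by (rule le_less_trans[rotated])
  qed
  moreover have "open {x. ereal (f j x) < c}" for j c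
    by (cases c) (auto intro!: open_Collect_less continuous_intros assms(1))
  ultimately have "open {x. u x < c}" for c by (metis (no_types, lifting) open_UN)
  moreover have "u x < \<infinity>" for x using le[of x 0] by (metis ereal_less_PInfty order.strict_trans1 not_le ereal_infty_less(1) PInfty_neq_ereal(1))
  ultimately show "usc_on UNIV u" by (simp add: usc_on_def)
qed

text \<open>For \<delta> > 0 the subsets of the frontier where \<open>f j\<close> is at least h +
  \<delta> are compact, decreasing, and have empty intersection. So one of them is empty, and the
  corresponding \<open>f j\<close> has the harmonic majorant h + \<delta>.\<close>

lemma subharmonic_decreasing_limit:
  fixes f :: "nat \<Rightarrow> 'a::euclidean_space \<Rightarrow> real"
  assumes c: "\<And>j. continuous_on UNIV (f j)" and dec: "\<And>x. decseq (\<lambda>j. f j x)"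
    and lim: "\<And>x. (\<lambda>j. ereal (f j x)) \<longlonglongrightarrow> u x"
    and sub: "\<And>j. subharmonic_on UNIV (\<lambda>x. ereal (f j x))"
  shows "subharmonic_on UNIV u"
proof -
  note le = usc_decreasing_limit(2)[OF c dec lim]
  have "u x1 \<le> ereal (h x1)"
    if G: "open G" "compact (closure G)" and ch: "continuous_on (closure G) h" and hh: "harmonic_on G h"
      and bd: "\<And>x. x \<in> frontier G \<Longrightarrow> u x \<le> ereal (h x)" and x1: "x1 \<in> G" for G h x1
  proof -
    have "u x1 \<le> ereal (h x1 + \<delta>)" if \<delta>: "\<delta> > 0" for \<delta>
    proof -
      define K where "K j = frontier G \<inter> (\<lambda>x. f j x - h x) -` {\<delta>..}" for j
      have fG: "frontier G \<subseteq> closure G" by (simp add: frontier_def)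
      have cF: "compact (frontier G)" using G(2) compact_frontier_bounded compact_imp_bounded
        by (metis bounded_closure_image compact_closure frontier_subset_compact closed_closure bounded_subset closure_subset)
      have cK: "compact (K j)" for j
      proof -
        have "closed (K j)" unfolding K_def
          by (intro continuous_closed_preimage continuous_intros continuous_on_subset[OF c] continuous_on_subset[OF ch fG]) auto
        then have "compact (frontier G \<inter> K j)" using cF by (rule compact_Int_closed[rotated])
        then show ?thesis by (simp add: K_def Int_absorb1 flip: Int_assoc)
      qed
      have "\<exists>j. K j = {}"
      proof (rule ccontr)
        assume "\<nexists>j. K j = {}"
        then have "\<Inter> (range K) \<noteq> {}"
        proof (intro compact_nest cK)
          show "K n \<subseteq> K m" if "m \<le> n" for m n
            using decseqD[OF dec that] by (auto simp: K_def) (smt (verit))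
        qed auto
        then obtain x where x: "\<And>j. x \<in> K j" by auto
        have "u x \<le> ereal (h x)" using x[of 0] bd by (auto simp: K_def)
        also have "\<dots> < ereal (h x + \<delta>)" using \<delta> by simp
        finally have "u x < ereal (h x + \<delta>)" .
        from order_tendstoD(2)[OF lim this] obtain j where "f j x < h x + \<delta>"
          by (auto dest: eventually_happens)
        then show False using x[of j] by (auto simp: K_def)
      qed
      then obtain j where j: "K j = {}" by blast
      have "harmonic_on G (\<lambda>x. h x + \<delta>)"
      proof -
        have hC: "Ck_on (Suc (Suc 0)) G h" using hh by (simp only: harmonic_on_def numeral_2_eq_2)
        have d1: "dir_deriv b (\<lambda>x. h x + \<delta>) x = dir_deriv b h x" if "x \<in> G" for b x
          using hC that by (subst dir_deriv_add) (auto simp: dir_deriv_def)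
        have "dir_deriv b (dir_deriv b (\<lambda>x. h x + \<delta>)) x = dir_deriv b (dir_deriv b h) x" if "x \<in> G" "b \<in> Basis" for b x
        proof (rule dir_deriv_eq[where f' = "\<lambda>v. dir_deriv v (dir_deriv b h) x"])
          have "(dir_deriv b h has_derivative (\<lambda>v. dir_deriv v (dir_deriv b h) x)) (at x)"
            using hC that by (auto intro: has_derivative_dir_deriv)
          then show "(dir_deriv b (\<lambda>x. h x + \<delta>) has_derivative (\<lambda>v. dir_deriv v (dir_deriv b h) x)) (at x)"
            by (rule has_derivative_transform_within_open[OF _ G(1) that(1)]) (simp add: d1)
        qed
        moreover have "Ck_on 2 G (\<lambda>x. h x + \<delta>)" using hh by (intro Ck_on_add G(1) Ck_const) (simp add: harmonic_on_def)
        ultimately show ?thesis using hh by (simp add: harmonic_on_def)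
      qed
      moreover have "\<forall>x\<in>frontier G. ereal (f j x) \<le> ereal (h x + \<delta>)" using j by (force simp: K_def)
      moreover have "continuous_on (closure G) (\<lambda>x. h x + \<delta>)" by (intro continuous_intros ch)
      ultimately have "ereal (f j x1) \<le> ereal (h x1 + \<delta>)"
        using sub[of j, unfolded subharmonic_on_def] G x1
        by (elim conjE allE[of _ G] allE[of _ "\<lambda>x. h x + \<delta>"]) auto
      then show ?thesis using le[of x1 j] order_trans by blast
    qed
    then have "u x1 \<le> ereal (h x1) + ereal \<delta>" if "\<delta> > 0" for \<delta> using that by simp
    then show ?thesis by (rule ereal_le_epsilon2)
  qed
  then show ?thesis unfolding subharmonic_on_def using usc_decreasing_limit(1)[OF c dec lim] by auto
qed

section \<open>Smooth quaternionic plurisubharmonic functions\<close>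

lemma linear_right_scale: "linear (right_scale b)"
  by (rule linearI) (auto simp: right_scale_def qmult_def vec_eq_iff quat_def algebra_simps)

lemma right_scale_zero: "right_scale 0 l = 0"
  by (simp add: right_scale_def qmult_def vec_eq_iff quat_def)

text \<open>The multiplicativity of the quaternion norm in polarised form: left multiplication is a
  similarity.\<close>

lemma inner_qmult: "(p \<odot> x) \<bullet> (p \<odot> y) = (p \<bullet> p) * (x \<bullet> y)"
proof -
  have "v $ 4 = v $ 0" for v :: quat
    by (rule arg_cong[where f = "($) v"]) simp
  then show ?thesis
    by (simp add: inner_vec_def sum_4 qmult_def algebra_simps)
qed

lemma inner_right_scale: "right_scale b x \<bullet> right_scale b y = (b \<bullet> b) * (x \<bullet> y)"
  by (simp add: right_scale_def inner_vec_def[of "\<chi> i. _ i"] inner_qmult inner_vec_def[of b b] sum_distrib_right)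

lemma line_laplacian_zero: "Ck_on 2 UNIV u \<Longrightarrow> line_laplacian 0 u q = 0"
proof -
  assume "Ck_on 2 UNIV u"
  then have C: "Ck_on (Suc (Suc 0)) UNIV u" by (simp only: numeral_2_eq_2)
  show ?thesis
    unfolding line_laplacian_def right_scale_zero
      linear_0[OF linear_dir_deriv[OF Ck_UNIV_differentiable[OF Ck_UNIV_dir_deriv[OF C]]]] by simp
qed

lemma laplacian_on_line:
  fixes u :: "quat^'n \<Rightarrow> real"
  assumes "Ck_on 2 UNIV u"
  shows "Ck_on 2 UNIV (\<lambda>l. u (a + right_scale b l))"
    and "(\<Sum>d\<in>Basis. dir_deriv d (dir_deriv d (\<lambda>l. u (a + right_scale b l))) l) = line_laplacian b u (a + right_scale b l)"
proof -
  show "Ck_on 2 UNIV (\<lambda>l. u (a + right_scale b l))" by (rule Ck_affine[OF linear_right_scale assms])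
  have C: "Ck_on (Suc (Suc 0)) UNIV u" using assms by (simp only: numeral_2_eq_2)
  have "dir_deriv d (\<lambda>l. u (a + right_scale b l)) = (\<lambda>l. dir_deriv (right_scale b d) u (a + right_scale b l))" for d
    by (rule ext) (rule dir_deriv_affine(1)[OF linear_right_scale Ck_UNIV_differentiable[OF C]])
  then show "(\<Sum>d\<in>Basis. dir_deriv d (dir_deriv d (\<lambda>l. u (a + right_scale b l))) l) = line_laplacian b u (a + right_scale b l)"
    unfolding line_laplacian_def
    by (simp add: dir_deriv_affine(1)[OF linear_right_scale Ck_UNIV_differentiable[OF Ck_UNIV_dir_deriv[OF C]]])
qed

lemma qpsh_imp_line_laplacian_nonneg:
  fixes u :: "quat^'n \<Rightarrow> real"
  assumes "Ck_on 2 UNIV u" "qpsh_on UNIV (\<lambda>q. ereal (u q))"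
  shows "0 \<le> line_laplacian b u q"
proof (cases "b = 0")
  case False
  then have "subharmonic_on UNIV (\<lambda>l. ereal (u (q + right_scale b l)))"
    using assms(2) by (simp add: qpsh_on_def)
  from subharmonic_laplacian_nonneg[OF laplacian_on_line(1)[OF assms(1)] this]
  show ?thesis by (simp add: laplacian_on_line(2)[OF assms(1)] linear_0[OF linear_right_scale])
qed (simp add: line_laplacian_zero assms)

lemma line_laplacian_nonneg_imp_subharmonic:
  fixes u :: "quat^'n \<Rightarrow> real"
  assumes "Ck_on 2 UNIV u" "\<And>b q. 0 \<le> line_laplacian b u q"
  shows "subharmonic_on UNIV (\<lambda>l. ereal (u (a + right_scale b l)))"
  by (rule subharmonic_if_laplacian_nonneg[OF laplacian_on_line(1)[OF assms(1)]])
     (simp add: laplacian_on_line(2)[OF assms(1)] assms(2))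

lemma qpsh_on_decreasing_limit:
  fixes f :: "nat \<Rightarrow> quat^'n \<Rightarrow> real"
  assumes C: "\<And>j. Ck_on 2 UNIV (f j)" and pos: "\<And>j b q. 0 \<le> line_laplacian b (f j) q"
    and dec: "\<And>x. decseq (\<lambda>j. f j x)" and lim: "\<And>x. (\<lambda>j. ereal (f j x)) \<longlonglongrightarrow> u x"
  shows "qpsh_on UNIV u"
proof -
  note c = Ck_on_imp_continuous[OF C]
  have "subharmonic_on UNIV (\<lambda>l. u (a + right_scale b l))" for a b
    by (rule subharmonic_decreasing_limit[where f = "\<lambda>j l. f j (a + right_scale b l)"])
       (use dec lim line_laplacian_nonneg_imp_subharmonic[OF C pos]
         Ck_on_imp_continuous[OF laplacian_on_line(1)[OF C]] in auto)
  then show ?thesis using usc_decreasing_limit(1)[OF c dec lim]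
    by (simp add: qpsh_on_def convex_connected)
qed

lemma qpsh_on_smooth:
  fixes u :: "quat^'n \<Rightarrow> real"
  assumes "Ck_on 2 UNIV u" "\<And>b q. 0 \<le> line_laplacian b u q"
  shows "qpsh_on UNIV (\<lambda>q. ereal (u q))"
  by (rule qpsh_on_decreasing_limit[where f = "\<lambda>_. u"]) (use assms in auto)


section \<open>Regularised logarithms\<close>

definition log_reg :: "real \<Rightarrow> 'a::euclidean_space \<Rightarrow> real" where
  "log_reg \<epsilon> x = ln (x \<bullet> x + \<epsilon>) / 2"

lemma Ck_inner_self: "Ck_on k UNIV (\<lambda>x::'a::euclidean_space. x \<bullet> x)"
proof -
  have "Ck_on k UNIV (\<lambda>x::'a. \<Sum>b\<in>Basis. (x \<bullet> b) * (x \<bullet> b))"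
    by (intro Ck_on_sum Ck_on_mult Ck_inner_left open_UNIV)
  then show ?thesis by (subst (asm) euclidean_inner[symmetric])
qed

lemma Ck_log_reg:
  assumes "\<epsilon> > 0"
  shows "Ck_on k UNIV (log_reg \<epsilon> :: 'a::euclidean_space \<Rightarrow> real)"
proof -
  \<comment> \<open>The successive derivatives of \<open>ln t / 2\<close>, as
    \<open>Ck_on_compose_real\<close> expects them.\<close>
  define G :: "nat \<Rightarrow> real \<Rightarrow> real" where
    "G i t = (if i = 0 then ln t / 2 else (-1) ^ (i - 1) * fact (i - 1) * inverse t ^ i / 2)" for i t
  have pos: "0 < x \<bullet> x + \<epsilon>" for x :: 'a using assms by (simp add: add_nonneg_pos)
  have "Ck_on k UNIV (\<lambda>x::'a. G 0 (x \<bullet> x + \<epsilon>))"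
  proof (rule Ck_on_compose_real[where G = G and f = "\<lambda>x. x \<bullet> x + \<epsilon>", OF open_UNIV])
    show "Ck_on k UNIV (\<lambda>x::'a. x \<bullet> x + \<epsilon>)" by (intro Ck_on_add open_UNIV Ck_inner_self Ck_const)
    fix x :: 'a
    have D: "(G i has_real_derivative G (Suc i) t) (at t)" if "t > 0" for i and t :: real
    proof (cases i)
      case 0
      have "((\<lambda>t. ln t / 2) has_real_derivative inverse t / 2) (at t)"
        using that by (intro DERIV_cdivide DERIV_ln)
      then show ?thesis using 0 by (simp add: G_def[abs_def])
    next
      case (Suc m)
      have "((\<lambda>t. inverse t ^ Suc m) has_real_derivative
          of_nat (Suc m) * (- (inverse t ^ Suc (Suc 0)) * inverse t ^ (Suc m - Suc 0))) (at t)"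
        using that by (intro DERIV_power DERIV_inverse) auto
      note D = DERIV_cmult[OF this, of "(-1) ^ m * fact m / 2"]
      have "(\<lambda>t. (-1) ^ m * fact m / 2 * inverse t ^ Suc m) = G i"
        by (rule ext) (simp add: Suc G_def)
      moreover have "(-1) ^ m * fact m / 2 * (of_nat (Suc m) * (- (inverse t ^ Suc (Suc 0)) * inverse t ^ (Suc m - Suc 0))) = G (Suc i) t"
        by (simp add: Suc G_def) (simp add: field_simps)?
      ultimately show ?thesis using D by simp
    qed
    show "(G i has_real_derivative G (Suc i) (x \<bullet> x + \<epsilon>)) (at (x \<bullet> x + \<epsilon>))" for i by (rule D[OF pos])
    show "isCont (G k) (x \<bullet> x + \<epsilon>)" by (rule DERIV_isCont[OF D[OF pos]])
  qed
  then show ?thesis by (simp add: G_def log_reg_def[abs_def])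
qed

lemma dir_deriv_log_reg:
  assumes "\<epsilon> > 0"
  shows "dir_deriv v (log_reg \<epsilon>) x = (x \<bullet> v) / (x \<bullet> x + \<epsilon>)"
    and "dir_deriv w (dir_deriv v (log_reg \<epsilon>)) x =
      (w \<bullet> v) / (x \<bullet> x + \<epsilon>) - 2 * (x \<bullet> v) * (x \<bullet> w) / (x \<bullet> x + \<epsilon>)\<^sup>2"
proof -
  have pos: "0 < x \<bullet> x + \<epsilon>" for x :: 'a using assms by (simp add: add_nonneg_pos)
  have 1: "dir_deriv v (log_reg \<epsilon>) x = (x \<bullet> v) / (x \<bullet> x + \<epsilon>)" for v x :: 'a
    unfolding log_reg_def[abs_def] using pos[of x]
    by (intro dir_deriv_eq) (auto intro!: derivative_eq_intros simp: inner_commute field_simps)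
  then show "dir_deriv v (log_reg \<epsilon>) x = (x \<bullet> v) / (x \<bullet> x + \<epsilon>)" .
  have "dir_deriv v (log_reg \<epsilon>) = (\<lambda>x. (x \<bullet> v) / (x \<bullet> x + \<epsilon>))" using 1 by auto
  moreover have "dir_deriv w (\<lambda>x. (x \<bullet> v) / (x \<bullet> x + \<epsilon>)) x =
      (w \<bullet> v) / (x \<bullet> x + \<epsilon>) - 2 * (x \<bullet> v) * (x \<bullet> w) / (x \<bullet> x + \<epsilon>)\<^sup>2"
  proof (rule dir_deriv_eq[where f' = "\<lambda>w. (w \<bullet> v) / (x \<bullet> x + \<epsilon>) - 2 * (x \<bullet> v) * (x \<bullet> w) / (x \<bullet> x + \<epsilon>)\<^sup>2"])
    show "((\<lambda>x. x \<bullet> v / (x \<bullet> x + \<epsilon>)) has_derivative (\<lambda>w. w \<bullet> v / (x \<bullet> x + \<epsilon>) - 2 * (x \<bullet> v) * (x \<bullet> w) / (x \<bullet> x + \<epsilon>)\<^sup>2)) (at x)"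
    proof (rule has_derivative_eq_rhs)
      show "((\<lambda>x. x \<bullet> v / (x \<bullet> x + \<epsilon>)) has_derivative
         (\<lambda>w. ((w \<bullet> v) * (x \<bullet> x + \<epsilon>) - (x \<bullet> v) * (x \<bullet> w + w \<bullet> x + 0)) / ((x \<bullet> x + \<epsilon>) * (x \<bullet> x + \<epsilon>)))) (at x)"
        using pos[of x]
        by (intro has_derivative_divide' has_derivative_add has_derivative_inner has_derivative_inner_left
            has_derivative_ident has_derivative_const) simp
      have *: "(a * r - b * (c + c + 0)) / (r * r) = a / r - 2 * b * c / r\<^sup>2" if "r > 0" for a b c r :: real
        using that by (simp add: field_simps power2_eq_square)
      show "(\<lambda>w. ((w \<bullet> v) * (x \<bullet> x + \<epsilon>) - (x \<bullet> v) * (x \<bullet> w + w \<bullet> x + 0)) / ((x \<bullet> x + \<epsilon>) * (x \<bullet> x + \<epsilon>)))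
        = (\<lambda>w. w \<bullet> v / (x \<bullet> x + \<epsilon>) - 2 * (x \<bullet> v) * (x \<bullet> w) / (x \<bullet> x + \<epsilon>)\<^sup>2)"
      proof (rule ext)
        fix w
        have "w \<bullet> x = x \<bullet> w" by (rule inner_commute)
        then show "((w \<bullet> v) * (x \<bullet> x + \<epsilon>) - (x \<bullet> v) * (x \<bullet> w + w \<bullet> x + 0)) / ((x \<bullet> x + \<epsilon>) * (x \<bullet> x + \<epsilon>))
          = w \<bullet> v / (x \<bullet> x + \<epsilon>) - 2 * (x \<bullet> v) * (x \<bullet> w) / (x \<bullet> x + \<epsilon>)\<^sup>2"
          by (simp only: *[OF pos[of x]])
      qed
    qed
  qed
  ultimately show "dir_deriv w (dir_deriv v (log_reg \<epsilon>)) x =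
      (w \<bullet> v) / (x \<bullet> x + \<epsilon>) - 2 * (x \<bullet> v) * (x \<bullet> w) / (x \<bullet> x + \<epsilon>)\<^sup>2" by simp
qed

text \<open>Bessel's inequality for the four vectors \<open>right_scale b d\<close>, which are
  orthogonal of length |b|.\<close>

lemma bessel_right_scale:
  fixes b q :: "quat^'n"
  shows "(\<Sum>d\<in>Basis. (q \<bullet> right_scale b d)\<^sup>2) \<le> (b \<bullet> b) * (q \<bullet> q)"
proof -
  interpret linear "right_scale b" by (rule linear_right_scale)
  \<comment> \<open>The adjoint of \<open>right_scale b\<close> applied to \<open>q\<close>; hence
    the inner product of \<open>q\<close> with \<open>right_scale b y\<close> is |y|^2, and
    Cauchy-Schwarz bounds it.\<close>
  define y where "y = (\<Sum>d\<in>Basis. (q \<bullet> right_scale b d) *\<^sub>R d)"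
  have "y \<bullet> y = (\<Sum>d\<in>Basis. (q \<bullet> right_scale b d)\<^sup>2)"
    unfolding euclidean_inner[of y y] by (simp add: y_def power2_eq_square)
  moreover have "q \<bullet> right_scale b y = (\<Sum>d\<in>Basis. (q \<bullet> right_scale b d)\<^sup>2)"
    unfolding y_def by (simp add: sum scale inner_sum_right power2_eq_square)
  moreover have "(q \<bullet> right_scale b y)\<^sup>2 \<le> (q \<bullet> q) * ((b \<bullet> b) * (y \<bullet> y))"
    using Cauchy_Schwarz_ineq[of q "right_scale b y"] by (simp add: inner_right_scale)
  ultimately have "(y \<bullet> y) * (y \<bullet> y) \<le> ((b \<bullet> b) * (q \<bullet> q)) * (y \<bullet> y)"
    by (simp add: power2_eq_square mult_ac)
  then have "y \<bullet> y \<le> (b \<bullet> b) * (q \<bullet> q)"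
    by (cases "y \<bullet> y = 0") (auto simp: mult_le_cancel_right)
  then show ?thesis using \<open>y \<bullet> y = _\<close> by simp
qed

text \<open>A quaternionic line has real dimension four, so the trace contributes 4|b|^2/\<rho>,
  while the concavity of the logarithm costs at most 2|b|^2/\<rho> by Bessel.\<close>

lemma line_laplacian_log_reg_nonneg:
  fixes q :: "quat^'n"
  assumes "\<epsilon> > 0"
  shows "0 \<le> line_laplacian b (log_reg \<epsilon>) q"
proof -
  let ?\<rho> = "q \<bullet> q + \<epsilon>" and ?S = "\<Sum>d\<in>Basis. (q \<bullet> right_scale b d)\<^sup>2"
  have pos: "0 < ?\<rho>" using assms by (simp add: add_nonneg_pos)
  have "line_laplacian b (log_reg \<epsilon>) q = (\<Sum>d\<in>(Basis::quat set). (b \<bullet> b) / ?\<rho> - 2 / ?\<rho>\<^sup>2 * (q \<bullet> right_scale b d)\<^sup>2)"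
    unfolding line_laplacian_def dir_deriv_log_reg(2)[OF assms]
    by (intro sum.cong refl) (simp add: inner_right_scale inner_same_Basis power2_eq_square)
  also have "\<dots> = 4 * (b \<bullet> b) / ?\<rho> - 2 / ?\<rho>\<^sup>2 * ?S"
    by (simp add: sum_subtractf sum_distrib_left)
  also have "\<dots> \<ge> 4 * (b \<bullet> b) / ?\<rho> - 2 / ?\<rho>\<^sup>2 * ((b \<bullet> b) * (q \<bullet> q))"
    by (intro diff_left_mono mult_left_mono bessel_right_scale) auto
  also have "4 * (b \<bullet> b) / ?\<rho> - 2 / ?\<rho>\<^sup>2 * ((b \<bullet> b) * (q \<bullet> q)) = (b \<bullet> b) * (2 * (q \<bullet> q) + 4 * \<epsilon>) / ?\<rho>\<^sup>2"
  proof -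
    have "4 * x / r - 2 / r\<^sup>2 * (x * y) = x * (4 * r - 2 * y) / r\<^sup>2" if "r > 0" for x y r :: real
      using that by (simp add: field_simps power2_eq_square)
    moreover have "4 * ?\<rho> - 2 * (q \<bullet> q) = 2 * (q \<bullet> q) + 4 * \<epsilon>" by simp
    ultimately show ?thesis using pos by metis
  qed
  also have "\<dots> \<ge> 0" using assms by (intro divide_nonneg_nonneg mult_nonneg_nonneg) auto
  finally show ?thesis .
qed

lemma log_reg_decreasing_to_log_norm:
  fixes q :: "quat^'n"
  shows "decseq (\<lambda>j. log_reg (inverse (real (Suc j))) q)"
    and "(\<lambda>j. ereal (log_reg (inverse (real (Suc j))) q)) \<longlonglongrightarrow> log_norm q"
proof -
  have pos: "0 < q \<bullet> q + inverse (real (Suc j))" for j by (simp add: add_nonneg_pos)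
  show "decseq (\<lambda>j. log_reg (inverse (real (Suc j))) q)"
    unfolding decseq_def log_reg_def using pos
    by (auto intro!: divide_right_mono ln_mono le_imp_inverse_le)
  have lim: "(\<lambda>j. q \<bullet> q + inverse (real (Suc j))) \<longlonglongrightarrow> q \<bullet> q + 0"
    by (intro tendsto_intros LIMSEQ_inverse_real_of_nat)
  show "(\<lambda>j. ereal (log_reg (inverse (real (Suc j))) q)) \<longlonglongrightarrow> log_norm q"
  proof (cases "q = 0")
    case True
    have "filterlim (\<lambda>j. inverse (real (Suc j))) (at_right 0) sequentially"
      using LIMSEQ_inverse_real_of_nat by (auto simp: filterlim_at intro!: always_eventually)
    from filterlim_compose[OF ln_at_0 this]
    have l0: "filterlim (\<lambda>j. ln (inverse (real (Suc j)))) at_bot sequentially" .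
    have "filterlim (\<lambda>j. 1/2 * ln (inverse (real (Suc j)))) at_bot sequentially"
      by (rule filterlim_tendsto_pos_mult_at_bot[OF tendsto_const _ l0]) simp
    then have "filterlim (\<lambda>j. log_reg (inverse (real (Suc j))) q) at_bot sequentially"
      using True by (simp add: log_reg_def)
    then show ?thesis using True by (simp add: log_norm_def tendsto_MInfty filterlim_at_bot_dense)
  next
    case False
    have "(\<lambda>j. log_reg (inverse (real (Suc j))) q) \<longlonglongrightarrow> ln (q \<bullet> q + 0) / 2"
      unfolding log_reg_def using False by (intro tendsto_divide tendsto_ln lim tendsto_const) auto
    moreover have "ln (q \<bullet> q + 0) / 2 = ln (norm q)"
      using False by (simp add: norm_eq_sqrt_inner ln_sqrt)
    ultimately show ?thesis using False by (simp add: log_norm_def)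
  qed
qed


text \<open>The complex bilinear, not Hermitian, extension of the inner product to complexified
  vectors.\<close>

definition bilin_ext :: "'a::real_inner \<times> 'a \<Rightarrow> 'a \<times> 'a \<Rightarrow> complex" where
  "bilin_ext X Y = Complex (fst X \<bullet> fst Y - snd X \<bullet> snd Y) (fst X \<bullet> snd Y + snd X \<bullet> fst Y)"

lemma hess_log_reg:
  fixes q :: "'a::euclidean_space"
  assumes "\<epsilon> > 0"
  shows "cderiv X (cderiv Y (cfun (log_reg \<epsilon>))) q =
    bilin_ext X Y / (q \<bullet> q + \<epsilon>) - 2 / (q \<bullet> q + \<epsilon>)\<^sup>2 * bilin_ext (q, 0) X * bilin_ext (q, 0) Y"
proof -
  let ?u = "log_reg \<epsilon> :: 'a \<Rightarrow> real"
  have C: "Ck_on (Suc (Suc 0)) UNIV ?u" by (rule Ck_log_reg[OF assms])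
  have dr: "dir_deriv v (cfun ?u) = cfun (dir_deriv v ?u)" for v
    by (rule ext) (rule dir_deriv_bounded_linear[OF bounded_linear_of_real Ck_UNIV_differentiable[OF C]])
  have dr2: "dir_deriv v' (cfun (dir_deriv v ?u)) q = of_real (dir_deriv v' (dir_deriv v ?u) q)" for v v'
    by (rule dir_deriv_bounded_linear[OF bounded_linear_of_real Ck_UNIV_differentiable[OF Ck_UNIV_dir_deriv[OF C]]])
  have d: "cfun (dir_deriv v ?u) differentiable (at q)" for v
    using Ck_UNIV_differentiable[OF Ck_on_of_real[OF open_UNIV Ck_UNIV_dir_deriv[OF C]]] .
  have "cderiv Y (cfun ?u) = (\<lambda>p. cfun (dir_deriv (fst Y) ?u) p + \<i> * cfun (dir_deriv (snd Y) ?u) p)"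
    by (auto simp: cderiv_def dr)
  then have "cderiv X (cderiv Y (cfun ?u)) q =
    cderiv X (cfun (dir_deriv (fst Y) ?u)) q + \<i> * cderiv X (cfun (dir_deriv (snd Y) ?u)) q"
    using d by (simp add: cderiv_add differentiable_mult cderiv_cmult)
  also have "\<dots> = Complex
     (dir_deriv (fst X) (dir_deriv (fst Y) ?u) q - dir_deriv (snd X) (dir_deriv (snd Y) ?u) q)
     (dir_deriv (fst X) (dir_deriv (snd Y) ?u) q + dir_deriv (snd X) (dir_deriv (fst Y) ?u) q)"
    by (simp add: cderiv_def dr2 complex_eq_iff)
  also have "\<dots> = bilin_ext X Y / (q \<bullet> q + \<epsilon>) - 2 / (q \<bullet> q + \<epsilon>)\<^sup>2 * bilin_ext (q, 0) X * bilin_ext (q, 0) Y"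
  proof -
    have "Complex a b / of_real r = Complex (a / r) (b / r)" for a b r by (simp add: complex_eq_iff)
    moreover have "2 / (complex_of_real r)\<^sup>2 = of_real (2 / r\<^sup>2)" for r by simp
    ultimately show ?thesis
      unfolding dir_deriv_log_reg(2)[OF assms] bilin_ext_def
      by (simp add: complex_eq_iff add_divide_distrib diff_divide_distrib algebra_simps del: of_real_divide of_real_power)
  qed
  finally show ?thesis .
qed

text \<open>The Hessian form is the standard form divided by \<rho>, minus 2/\<rho>^2 times \<alpha>
  \<and> J\<alpha>, where \<alpha> pairs \<open>q\<close> with the Wirtinger vectors. Real and
  imaginary parts of these have length 1/2, so |\<alpha>|^2 = |q|^2/4.\<close>

lemma MA_log_reg:
  fixes e :: "nat \<Rightarrow> 'n::finite" and q :: "quat^'n"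
  assumes e: "bij_betw e {..<CARD('n)} UNIV" and \<epsilon>: "\<epsilon> > 0"
  shows "mixed_MA e (replicate CARD('n) (log_reg \<epsilon>)) q =
    of_real (fact CARD('n) * (1 / (q \<bullet> q + \<epsilon>) ^ CARD('n) - (q \<bullet> q) / (2 * (q \<bullet> q + \<epsilon>) ^ (CARD('n) + 1))))"
proof -
  let ?n = "CARD('n)" and ?\<rho> = "q \<bullet> q + \<epsilon>"
  have pos: "?\<rho> > 0" using \<epsilon> by (simp add: add_nonneg_pos)
  define a where "a = hess (dz_vec e) (J_dz_vec e) (cfun (log_reg \<epsilon>)) q"
  define \<alpha> where "\<alpha> k = bilin_ext (q, 0) (dz_vec e k)" for k
  have bbar: "bilin_ext (q, 0) (J_dz_vec e i) = J_vec \<alpha> i" for i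
    by (simp add: \<alpha>_def J_vec_def J_dz_vec_def dz_vec_def dzbar_vec_def bilin_ext_def complex_eq_iff minus_one_power_iff)
  have ortho: "x_vec e m \<bullet> x_vec e m' = (if m = m' then 1 else 0)" if m: "m < 4 * ?n" "m' < 4 * ?n" for m m'
  proof -
    have "e (m div 4) = e (m' div 4) \<longleftrightarrow> m div 4 = m' div 4"
      using e m unfolding bij_betw_def inj_on_def by (auto simp: less_mult_imp_div_less mult.commute)
    moreover have "of_nat i = (of_nat i' :: 4) \<longleftrightarrow> i = i'" if "i < 4" "i' < 4" for i i'
    proof -
      have "i = 0 \<or> i = 1 \<or> i = 2 \<or> i = 3" "i' = 0 \<or> i' = 1 \<or> i' = 2 \<or> i' = 3" using that by auto
      then show ?thesis by auto
    qed
    ultimately have "e (m div 4) = e (m' div 4) \<and> of_nat (m mod 4) = (of_nat (m' mod 4) :: 4) \<longleftrightarrow> m = m'"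
      by (metis div_mult_mod_eq mod_less_divisor zero_less_numeral)
    then show ?thesis by (auto simp: x_vec_def inner_axis_axis)
  qed
  have XY: "bilin_ext (dz_vec e k) (J_dz_vec e i) = (if k = partner i then (-1) ^ (i + 1) / 2 else 0)"
    if "k < 2 * ?n" "i < 2 * ?n" for k i
  proof -
    have "partner i < 2 * ?n" using that by simp
    then have o: "x_vec e (2*k) \<bullet> x_vec e (2 * partner i) = (if k = partner i then 1 else 0)"
      "x_vec e (2*k+1) \<bullet> x_vec e (2 * partner i+1) = (if k = partner i then 1 else 0)"
      "x_vec e (2*k) \<bullet> x_vec e (2 * partner i+1) = 0" "x_vec e (2*k+1) \<bullet> x_vec e (2 * partner i) = 0"
      using that by (subst ortho; (simp; fail)?; presburger)+
    show ?thesis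
      by (simp add: bilin_ext_def J_dz_vec_def dz_vec_def dzbar_vec_def o[simplified] complex_eq_iff)
         (simp add: minus_one_power_iff)
  qed
  have ha: "a k i = (if k = partner i then (-1) ^ (i + 1) / 2 else 0 :: complex) / complex_of_real ?\<rho> - 2 / ?\<rho>\<^sup>2 * \<alpha> k * J_vec \<alpha> i"
    if "k < 2 * ?n" "i < 2 * ?n" for k i
    unfolding a_def hess_def hess_log_reg[OF \<epsilon>] XY[OF that] bbar \<alpha>_def[symmetric] by simp
  have "mixed_MA e (replicate ?n (log_reg \<epsilon>)) q = (form_mult (2 * ?n) a ^^ ?n) ext_one {..<2 * ?n}"
    by (simp add: mixed_MA_def hess_prod_def map_replicate foldr_replicate_eq_funpow a_def)
  also have "\<dots> = fact ?n * ((1 / of_real ?\<rho>) ^ ?n + (1 / of_real ?\<rho>) ^ (?n - 1) * (- 2 / of_real (?\<rho>\<^sup>2)) * (\<Sum>k<2 * ?n. of_real ((cmod (\<alpha> k))\<^sup>2)))"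
  proof (rule std_plus_simple_power)
    fix k i assume ki: "k < 2 * ?n" "i < 2 * ?n"
    have sym: "k = partner i \<longleftrightarrow> i = partner k" by auto
    define c1 c2 :: complex where "c1 = (if k = partner i then (-1) ^ (i + 1) / 2 else 0)"
      and "c2 = (if i = partner k then (-1) ^ (k + 1) / 2 else 0)"
    \<comment> \<open>A block carries the entries 1/2 and -1/2 at transposed places, which has the
      same antisymmetric part as the single entry 1 of \<open>std_form\<close>.\<close>
    have st: "c1 - c2 = std_form k i - std_form i k"
    proof (cases "k = partner i")
      case True
      then show ?thesis by (cases "even i") (auto simp: c1_def c2_def std_form_def partner_def elim!: oddE)
    next
      case False
      then have "\<not> (even k \<and> i = k + 1)" "\<not> (even i \<and> k = i + 1)" using sym by (auto simp: partner_def)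
      then show ?thesis using False sym by (auto simp: c1_def c2_def std_form_def)
    qed
    have "a k i - a i k = (c1 - c2) / complex_of_real ?\<rho> - 2 / ?\<rho>\<^sup>2 * \<alpha> k * J_vec \<alpha> i + 2 / ?\<rho>\<^sup>2 * \<alpha> i * J_vec \<alpha> k"
      unfolding ha[OF ki] ha[OF ki(2,1)] c1_def[symmetric] c2_def[symmetric] diff_divide_distrib by simp
    also have "\<dots> = (1 / of_real ?\<rho> * std_form k i + - 2 / of_real (?\<rho>\<^sup>2) * (\<alpha> k * J_vec \<alpha> i)) -
        (1 / of_real ?\<rho> * std_form i k + - 2 / of_real (?\<rho>\<^sup>2) * (\<alpha> i * J_vec \<alpha> k))"
      unfolding st by (simp add: diff_divide_distrib mult.assoc)
    finally show "a k i - a i k = (1 / of_real ?\<rho> * std_form k i + - 2 / of_real (?\<rho>\<^sup>2) * (\<alpha> k * J_vec \<alpha> i)) -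
        (1 / of_real ?\<rho> * std_form i k + - 2 / of_real (?\<rho>\<^sup>2) * (\<alpha> i * J_vec \<alpha> k))" .
  qed simp
  also have "(\<Sum>k<2 * ?n. of_real ((cmod (\<alpha> k))\<^sup>2)) = complex_of_real ((q \<bullet> q) / 4)"
  proof -
    have c: "(cmod (\<alpha> k))\<^sup>2 = ((q \<bullet> x_vec e (2*k))\<^sup>2 + (q \<bullet> x_vec e (2*k+1))\<^sup>2) / 4" for k
      by (simp add: \<alpha>_def bilin_ext_def dz_vec_def cmod_power2 power_divide power_mult_distrib minus_one_power_iff)
    have x: "q \<bullet> x_vec e m = q $ e (m div 4) $ of_nat (m mod 4)" for m
      by (simp add: x_vec_def inner_axis)
    have "(\<Sum>k<2 * ?n. (cmod (\<alpha> k))\<^sup>2) = (\<Sum>i<?n. ((q $ e i $ 0)\<^sup>2 + (q $ e i $ 1)\<^sup>2 + (q $ e i $ 2)\<^sup>2 + (q $ e i $ 3)\<^sup>2) / 4)"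
      unfolding sum_pairs
    proof (intro sum.cong refl)
      fix i :: nat
      have "2 * (2*i) div 4 = i" "2 * (2*i) mod 4 = 0" "(2 * (2*i) + 1) div 4 = i"
        "(2 * (2*i) + 1) mod 4 = 1" "2 * (2*i+1) div 4 = i" "2 * (2*i+1) mod 4 = 2"
        "(2 * (2*i+1) + 1) div 4 = i" "(2 * (2*i+1) + 1) mod 4 = 3" by presburger+
      then show "(cmod (\<alpha> (2*i)))\<^sup>2 + (cmod (\<alpha> (2*i+1)))\<^sup>2 = ((q $ e i $ 0)\<^sup>2 + (q $ e i $ 1)\<^sup>2 + (q $ e i $ 2)\<^sup>2 + (q $ e i $ 3)\<^sup>2) / 4"
        unfolding c x by (simp only:) (simp add: add_divide_distrib)
    qed
    also have "\<dots> = (\<Sum>i<?n. (q $ e i \<bullet> q $ e i) / 4)"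
    proof -
      have "v $ 4 = v $ 0" for v :: quat by (rule arg_cong[where f = "($) v"]) simp
      then show ?thesis by (simp add: inner_vec_def sum_4 power2_eq_square add_ac)
    qed
    also have "\<dots> = (\<Sum>j\<in>UNIV. (q $ j \<bullet> q $ j) / 4)"
      by (rule sum.reindex_bij_betw[OF e])
    also have "\<dots> = (q \<bullet> q) / 4" by (simp add: inner_vec_def[of q q] sum_divide_distrib)
    finally show ?thesis by (simp only: of_real_sum[symmetric])
  qed
  also have "fact ?n * ((1 / of_real ?\<rho>) ^ ?n + (1 / of_real ?\<rho>) ^ (?n - 1) * (- 2 / of_real (?\<rho>\<^sup>2)) * complex_of_real ((q \<bullet> q) / 4)) =
     of_real (fact ?n * (1 / ?\<rho> ^ ?n - (q \<bullet> q) / (2 * ?\<rho> ^ (?n + 1))))"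
  proof -
    obtain m where m: "?n = Suc m" using zero_less_card_finite gr0_implies_Suc by blast
    have "(1 / ?\<rho>) ^ m * (- 2 / ?\<rho>\<^sup>2) * ((q \<bullet> q) / 4) = - (q \<bullet> q) / (2 * ?\<rho> ^ (Suc m + 1))"
      using pos by (simp add: power_one_over field_simps power2_eq_square)
    then have "fact ?n * ((1 / ?\<rho>) ^ ?n + (1 / ?\<rho>) ^ (?n - 1) * (- 2 / ?\<rho>\<^sup>2) * ((q \<bullet> q) / 4)) =
      fact ?n * (1 / ?\<rho> ^ ?n - (q \<bullet> q) / (2 * ?\<rho> ^ (?n + 1)))"
      unfolding m by (simp add: power_one_over)
    moreover have "complex_of_real (fact ?n * ((1 / ?\<rho>) ^ ?n + (1 / ?\<rho>) ^ (?n - 1) * (- 2 / ?\<rho>\<^sup>2) * ((q \<bullet> q) / 4))) =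
      fact ?n * ((1 / of_real ?\<rho>) ^ ?n + (1 / of_real ?\<rho>) ^ (?n - 1) * (- 2 / of_real (?\<rho>\<^sup>2)) * complex_of_real ((q \<bullet> q) / 4))"
      by simp
    ultimately show ?thesis by (simp only:)
  qed
  finally show ?thesis .
qed

section \<open>Mass estimates\<close>

text \<open>For smooth functions on the whole space this agrees with \<open>qpsh_on\<close>; it is
  the version that the positivity of forms consumes.\<close>

definition smooth_psh :: "(quat^'n \<Rightarrow> real) \<Rightarrow> bool" where
  "smooth_psh u \<longleftrightarrow> smooth_on UNIV u \<and> (\<forall>b q. 0 \<le> line_laplacian b u q)"

text \<open>The reference potential: its form is twice the standard form and, suitably scaled,
  dominates every bounded Hessian.\<close>

definition sq_norm :: "'a::real_inner \<Rightarrow> real" where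
  "sq_norm q = q \<bullet> q"

abbreviation MA_density :: "(nat \<Rightarrow> 'n::finite) \<Rightarrow> (quat^'n \<Rightarrow> real) list \<Rightarrow> quat^'n \<Rightarrow> real" where
  "MA_density e us q \<equiv> Re (mixed_MA e us q)"

definition annulus :: "real \<Rightarrow> real \<Rightarrow> 'a::real_normed_vector set" where
  "annulus r R = {q. r \<le> norm q \<and> norm q \<le> R}"

lemma compact_annulus: "compact (annulus r R :: 'a::euclidean_space set)"
proof -
  have "annulus r R = cball 0 R \<inter> - ball (0::'a) r" by (auto simp: annulus_def)
  then show ?thesis by (simp add: compact_Int_closed closed_Compl)
qed

lemma smooth_pshD:
  assumes "smooth_psh u"
  shows "Ck_on k UNIV u" "0 \<le> line_laplacian b u q"
  using assms by (auto simp: smooth_psh_def smooth_on_def simp del: Ck_on.simps)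

lemma dir_deriv_sq_norm:
  fixes x v w :: "'a::euclidean_space"
  shows "dir_deriv w (dir_deriv v sq_norm) x = 2 * (w \<bullet> v)"
proof -
  have "(sq_norm has_derivative (\<lambda>v. 2 * (x \<bullet> v))) (at x)" for x :: 'a
    unfolding sq_norm_def[abs_def]
    by (rule has_derivative_eq_rhs, rule has_derivative_inner[OF has_derivative_ident has_derivative_ident])
       (auto simp: inner_commute)
  then have "dir_deriv v sq_norm = (\<lambda>x. 2 * (x \<bullet> v))"
    by (intro ext dir_deriv_eq)
  moreover have "((\<lambda>x. 2 * (x \<bullet> v)) has_derivative (\<lambda>w. 2 * (w \<bullet> v))) (at x)"
    by (intro has_derivative_mult_right has_derivative_inner_left has_derivative_ident)
  ultimately show ?thesis by (simp add: dir_deriv_eq)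
qed

lemma smooth_psh_sq_norm: "smooth_psh (sq_norm :: quat^'n \<Rightarrow> real)"
proof -
  have "Ck_on k UNIV (sq_norm :: quat^'n \<Rightarrow> real)" for k
    using Ck_inner_self[of k] by (simp add: sq_norm_def[abs_def] del: Ck_on.simps)
  moreover have "0 \<le> line_laplacian b sq_norm q" for b q :: "quat^'n"
    unfolding line_laplacian_def dir_deriv_sq_norm by (intro sum_nonneg) simp
  ultimately show ?thesis by (simp add: smooth_psh_def smooth_on_def del: Ck_on.simps)
qed

lemma mixed_MA_linear:
  assumes "Ck_on 2 UNIV f" "Ck_on 2 UNIV g"
  shows "mixed_MA e ((\<lambda>q. c * f q + g q) # us) q = of_real c * mixed_MA e (f # us) q + mixed_MA e (g # us) q"
proof -
  have F: "Ck_on (Suc (Suc 0)) UNIV (cfun f)" "Ck_on (Suc (Suc 0)) UNIV (cfun g)"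
    using assms by (simp_all only: numeral_2_eq_2 Ck_on_of_real[OF open_UNIV])
  note d0 = F[THEN Ck_UNIV_differentiable]
  note d1 = F[THEN Ck_cderiv, THEN Ck_UNIV_differentiable]
  have cf: "cfun (\<lambda>q. c * f q + g q) = (\<lambda>q. of_real c * cfun f q + cfun g q)" by auto
  have 1: "cderiv Z (cfun (\<lambda>q. c * f q + g q)) = (\<lambda>q. of_real c * cderiv Z (cfun f) q + cderiv Z (cfun g) q)" for Z
    unfolding cf by (rule ext) (simp only: cderiv_add[OF differentiable_mult[OF differentiable_const d0(1)] d0(2)] cderiv_cmult[OF d0(1)])
  have "hess X Y (cfun (\<lambda>q. c * f q + g q)) q k i = of_real c * hess X Y (cfun f) q k i + hess X Y (cfun g) q k i" for X Y k i
    unfolding hess_def 1 by (simp only: cderiv_add[OF differentiable_mult[OF differentiable_const d1(1)] d1(2)] cderiv_cmult[OF d1(1)])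
  then show ?thesis
    by (simp add: mixed_MA_def hess_prod_Cons form_mult_def sum.distrib sum_distrib_left algebra_simps)
qed

lemma line_laplacian_linear:
  assumes "Ck_on 2 UNIV f" "Ck_on 2 UNIV g"
  shows "line_laplacian b (\<lambda>q. c * f q + g q) q = c * line_laplacian b f q + line_laplacian b g q"
proof -
  have F: "Ck_on (Suc (Suc 0)) UNIV f" "Ck_on (Suc (Suc 0)) UNIV g"
    using assms by (simp_all only: numeral_2_eq_2)
  note d0 = F[THEN Ck_UNIV_differentiable]
  note d1 = F[THEN Ck_UNIV_dir_deriv, THEN Ck_UNIV_differentiable]
  have 0: "dir_deriv v (\<lambda>q. c * f q) q = c * dir_deriv v f q" if "f differentiable (at q)" for v q and f :: "quat^'a \<Rightarrow> real"
    using dir_deriv_mult[OF differentiable_const that, of v c] by (simp add: dir_deriv_def)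
  have 1: "dir_deriv v (\<lambda>q. c * f q + g q) = (\<lambda>q. c * dir_deriv v f q + dir_deriv v g q)" for v
    by (rule ext) (simp only: dir_deriv_add[OF differentiable_mult[OF differentiable_const d0(1)] d0(2)] 0[OF d0(1)])
  show ?thesis unfolding line_laplacian_def 1
    by (simp only: dir_deriv_add[OF differentiable_mult[OF differentiable_const d1(1)] d1(2)] 0[OF d1(1)]
       sum.distrib sum_distrib_left)
qed

lemma continuous_mixed_MA:
  assumes "\<And>u. u \<in> set us \<Longrightarrow> Ck_on 2 UNIV u"
  shows "continuous_on UNIV (mixed_MA e us)"
proof -
  have "Ck_on 0 UNIV (\<lambda>q. hess_prod (2 * CARD('a)) (dz_vec e) (J_dz_vec e) (map cfun us) q {..<2 * CARD('a)})"
    using assms by (intro Ck_hess_prod) (auto simp: numeral_2_eq_2 simp del: Ck_on.simps intro!: Ck_on_of_real)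
  then show ?thesis by (simp add: mixed_MA_def[abs_def])
qed

lemma mixed_MA_move: "mixed_MA e (us @ u # ws) q = mixed_MA e (u # us @ ws) q"
proof -
  have "hess_prod N X Y (us @ u # ws) q = hess_prod N X Y (u # us @ ws) q" for N X Y us u ws
    by (induction us) (simp_all add: hess_prod_Cons form_mult_commute)
  then show ?thesis by (simp add: mixed_MA_def)
qed

lemma mixed_MA_locally_constant:
  assumes "open S" "q \<in> S" "\<And>p. p \<in> S \<Longrightarrow> \<phi> p = c"
  shows "mixed_MA e (\<phi> # us) q = 0"
proof -
  have "cderiv Z f p = 0" if "p \<in> S" "\<And>p. p \<in> S \<Longrightarrow> f p = (c::complex)" for f p Z c
  proof -
    have "(f has_derivative (\<lambda>_. 0)) (at p)"
    proof (rule has_derivative_transform_within_open[OF _ assms(1) that(1)])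
      show "((\<lambda>_. c) has_derivative (\<lambda>_. 0)) (at p)" by simp
    qed (use that in simp)
    then show ?thesis by (simp add: cderiv_def dir_deriv_eq)
  qed
  note z = this
  have "cderiv Z (cfun \<phi>) p = 0" if "p \<in> S" for p Z
    using z[OF that, of "cfun \<phi>" "of_real c"] assms(3) by simp
  then have "hess X Y (cfun \<phi>) q k i = 0" for X Y k i
    unfolding hess_def using z[OF assms(2)] by blast
  then show ?thesis by (simp add: mixed_MA_def hess_prod_Cons form_mult_def)
qed

lemma second_derivative_bound:
  fixes f :: "'a::euclidean_space \<Rightarrow> real"
  assumes "Ck_on 2 UNIV f" and B: "\<And>a b. a \<in> Basis \<Longrightarrow> b \<in> Basis \<Longrightarrow> \<bar>dir_deriv a (dir_deriv b f) q\<bar> \<le> B"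
  shows "\<bar>dir_deriv v (dir_deriv v f) q\<bar> \<le> (real DIM('a))\<^sup>2 * B * (v \<bullet> v)"
proof -
  have "\<bar>dir_deriv v (dir_deriv v f) q\<bar> \<le> (\<Sum>a\<in>Basis. \<Sum>b\<in>Basis. \<bar>(v \<bullet> a) * (v \<bullet> b) * dir_deriv a (dir_deriv b f) q\<bar>)"
    unfolding dir_deriv2_expand[OF assms(1), of v v] by (rule order_trans[OF sum_abs sum_mono[OF sum_abs]])
  also have "\<dots> \<le> (\<Sum>a\<in>(Basis::'a set). \<Sum>b\<in>(Basis::'a set). norm v * norm v * B)"
    unfolding abs_mult by (intro sum_mono mult_mono Basis_le_norm B) auto
  also have "\<dots> = (real DIM('a))\<^sup>2 * B * (v \<bullet> v)"
    by (simp add: power2_eq_square dot_square_norm)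
  finally show ?thesis .
qed

text \<open>Although \<phi> is not plurisubharmonic, M |q|^2 + \<phi> and M |q|^2 - \<phi> satisfy
  the line condition at \<open>q\<close>. Their mixed densities are both real and nonnegative, which
  gives reality and the two-sided bound together.\<close>

lemma MA_density_bound:
  fixes e :: "nat \<Rightarrow> 'n::finite"
  assumes e: "bij_betw e {..<CARD('n)} UNIV" and us: "\<And>u. u \<in> set us \<Longrightarrow> smooth_psh u" and len: "Suc (length us) = CARD('n)"
    and \<phi>: "Ck_on 2 UNIV \<phi>" and M: "\<And>v. \<bar>dir_deriv v (dir_deriv v \<phi>) q\<bar> \<le> M * (v \<bullet> v)"
  shows "mixed_MA e (\<phi> # us) q = of_real (MA_density e (\<phi> # us) q)"
    and "\<bar>MA_density e (\<phi> # us) q\<bar> \<le> M * MA_density e (sq_norm # us) q"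
proof -
  have sq: "Ck_on 2 UNIV (sq_norm :: quat^'n \<Rightarrow> real)" by (rule smooth_pshD(1)[OF smooth_psh_sq_norm])
  have len': "length (w # us) = CARD('n)" for w using len by simp
  have C2: "Ck_on 2 UNIV u" if "u \<in> set us" for u using smooth_pshD[OF us[OF that]] by blast
  have pos: "\<exists>r\<ge>0. mixed_MA e ((\<lambda>p. M * sq_norm p + s * \<phi> p) # us) q = of_real r" if "\<bar>s\<bar> = 1" for s
  proof (rule mixed_MA_nonneg[OF e len'])
    have c: "Ck_on 2 UNIV (\<lambda>p. s * \<phi> p)" by (rule Ck_on_cmult[OF open_UNIV \<phi>])
    then show "Ck_on 2 UNIV u" if "u \<in> set ((\<lambda>p. M * sq_norm p + s * \<phi> p) # us)" for u
      using that C2 by (auto intro!: Ck_on_add Ck_on_cmult sq)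
    have "line_laplacian b (\<lambda>p. M * sq_norm p + s * \<phi> p) q \<ge> 0" for b
    proof -
      have "line_laplacian b (\<lambda>p. M * sq_norm p + s * \<phi> p) q = M * line_laplacian b sq_norm q + s * line_laplacian b \<phi> q"
      proof -
        have "dir_deriv v (\<lambda>_::quat^'n. 0::real) = (\<lambda>_. 0)" for v by (auto simp: dir_deriv_def)
        then have "line_laplacian b (\<lambda>_. 0) q = 0" by (simp add: line_laplacian_def)
        then show ?thesis
          using line_laplacian_linear[OF sq c, of b M q] line_laplacian_linear[OF \<phi> Ck_const, of b s 0 q] by simp
      qed
      also have "\<dots> = (\<Sum>d\<in>Basis. 2 * M * (right_scale b d \<bullet> right_scale b d) + s * dir_deriv (right_scale b d) (dir_deriv (right_scale b d) \<phi>) q)"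
        by (simp add: line_laplacian_def dir_deriv_sq_norm sum.distrib sum_distrib_left mult.left_commute mult.assoc)
      also have "\<dots> \<ge> 0"
      proof (rule sum_nonneg)
        fix d :: quat
        have "\<bar>s * dir_deriv (right_scale b d) (dir_deriv (right_scale b d) \<phi>) q\<bar> \<le> M * (right_scale b d \<bullet> right_scale b d)"
          using M[of "right_scale b d"] that by (simp add: abs_mult)
        then show "0 \<le> 2 * M * (right_scale b d \<bullet> right_scale b d) + s * dir_deriv (right_scale b d) (dir_deriv (right_scale b d) \<phi>) q"
          by (simp add: abs_le_iff)
      qed
      finally show ?thesis .
    qed
    then show "0 \<le> line_laplacian b u q" if "u \<in> set ((\<lambda>p. M * sq_norm p + s * \<phi> p) # us)" for u b
      using that smooth_pshD(2)[OF us] by auto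
  qed
  have lin: "mixed_MA e ((\<lambda>p. M * sq_norm p + s * \<phi> p) # us) q = of_real M * mixed_MA e (sq_norm # us) q + of_real s * mixed_MA e (\<phi> # us) q" for s
  proof -
    have z: "mixed_MA e ((\<lambda>_. 0) # us) q = 0" by (rule mixed_MA_locally_constant[of UNIV]) auto
    show ?thesis
      using mixed_MA_linear[OF sq Ck_on_cmult[OF open_UNIV \<phi>], of e M s us q] mixed_MA_linear[OF \<phi> Ck_const, of e s 0 us q] z by simp
  qed
  obtain r1 where r1: "r1 \<ge> 0" "of_real M * mixed_MA e (sq_norm # us) q + mixed_MA e (\<phi> # us) q = of_real r1"
    using pos[of 1] lin[of 1] by auto
  obtain r2 where r2: "r2 \<ge> 0" "of_real M * mixed_MA e (sq_norm # us) q - mixed_MA e (\<phi> # us) q = of_real r2"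
    using pos[of "-1"] lin[of "-1"] by auto
  have "Im (mixed_MA e (\<phi> # us) q) = 0" using r1(2) r2(2) by (simp add: complex_eq_iff)
  then show "mixed_MA e (\<phi> # us) q = of_real (MA_density e (\<phi> # us) q)" by (simp add: complex_eq_iff)
  show "\<bar>MA_density e (\<phi> # us) q\<bar> \<le> M * MA_density e (sq_norm # us) q"
    using r1 r2 by (simp add: complex_eq_iff abs_le_iff)
qed

lemma MA_density_real:
  fixes e :: "nat \<Rightarrow> 'n::finite"
  assumes e: "bij_betw e {..<CARD('n)} UNIV" and us: "\<And>u. u \<in> set us \<Longrightarrow> smooth_psh u" and len: "Suc (length us) = CARD('n)"
    and \<phi>: "Ck_on 2 UNIV \<phi>"
  shows "mixed_MA e (\<phi> # us) q = of_real (MA_density e (\<phi> # us) q)"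
proof -
  \<comment> \<open>Reality concerns one point, so a bound on the second derivatives at
    \<open>q\<close> alone serves.\<close>
  let ?B = "\<Sum>a\<in>Basis. \<Sum>b\<in>Basis. \<bar>dir_deriv a (dir_deriv b \<phi>) q\<bar>"
  have "\<bar>dir_deriv a (dir_deriv b \<phi>) q\<bar> \<le> ?B" if "a \<in> Basis" "b \<in> Basis" for a b
  proof -
    have "\<bar>dir_deriv a (dir_deriv b \<phi>) q\<bar> \<le> (\<Sum>b\<in>Basis. \<bar>dir_deriv a (dir_deriv b \<phi>) q\<bar>)"
      by (rule member_le_sum) (use that in auto)
    also have "\<dots> \<le> ?B" by (rule member_le_sum[of a Basis "\<lambda>a. \<Sum>b\<in>Basis. \<bar>dir_deriv a (dir_deriv b \<phi>) q\<bar>"]) (use that in \<open>auto intro: sum_nonneg\<close>)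
    finally show ?thesis .
  qed
  from MA_density_bound(1)[OF e us len \<phi> second_derivative_bound[OF \<phi> this]] show ?thesis .
qed

lemma MA_density_nonneg:
  fixes e :: "nat \<Rightarrow> 'n::finite"
  assumes e: "bij_betw e {..<CARD('n)} UNIV" and us: "\<And>u. u \<in> set us \<Longrightarrow> smooth_psh u" and len: "length us = CARD('n)"
  shows "0 \<le> MA_density e us q"
  using mixed_MA_nonneg[OF e len, of q] smooth_pshD[OF us] by auto

lemma uniform_second_derivative_bound:
  fixes \<phi> :: "'a::euclidean_space \<Rightarrow> real"
  assumes \<phi>: "Ck_on 2 UNIV \<phi>" and supp: "supported_in R \<phi>"
  obtains M where "M \<ge> 0" "\<And>v q. \<bar>dir_deriv v (dir_deriv v \<phi>) q\<bar> \<le> M * (v \<bullet> v)"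
proof -
  have C: "Ck_on (Suc (Suc 0)) UNIV \<phi>" using \<phi> by (simp only: numeral_2_eq_2)
  have "\<exists>M\<ge>0. \<forall>q. \<bar>dir_deriv a (dir_deriv b \<phi>) q\<bar> \<le> M" for a b
  proof -
    have "continuous_on UNIV (dir_deriv a (dir_deriv b \<phi>))"
      using Ck_UNIV_dir_deriv[OF Ck_UNIV_dir_deriv[OF C]] by simp
    from bounded_supported[OF this supported_dir_deriv[OF supported_dir_deriv[OF supp]]] show ?thesis
      by (metis real_norm_def)
  qed
  then obtain B where B: "\<And>a b. B a b \<ge> 0" "\<And>a b q. \<bar>dir_deriv a (dir_deriv b \<phi>) q\<bar> \<le> B a b" by metis
  let ?B = "\<Sum>a\<in>Basis. \<Sum>b\<in>Basis. B a b"
  have "\<bar>dir_deriv a (dir_deriv b \<phi>) q\<bar> \<le> ?B" if "a \<in> Basis" "b \<in> Basis" for a b q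
  proof -
    have "\<bar>dir_deriv a (dir_deriv b \<phi>) q\<bar> \<le> B a b" by (rule B)
    also have "\<dots> \<le> (\<Sum>b\<in>Basis. B a b)" by (rule member_le_sum) (use that B in auto)
    also have "\<dots> \<le> ?B" by (rule member_le_sum[of a Basis "\<lambda>a. \<Sum>b\<in>Basis. B a b"]) (use that B in \<open>auto intro: sum_nonneg\<close>)
    finally show ?thesis .
  qed
  from second_derivative_bound[OF \<phi> this]
  have "\<bar>dir_deriv v (dir_deriv v \<phi>) q\<bar> \<le> (real DIM('a))\<^sup>2 * ?B * (v \<bullet> v)" for v q .
  moreover have "(real DIM('a))\<^sup>2 * ?B \<ge> 0" using B(1) by (intro mult_nonneg_nonneg sum_nonneg) auto
  ultimately show thesis using that by blast
qed

lemma MA_integration_by_parts: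
  fixes e :: "nat \<Rightarrow> 'n::finite"
  assumes e: "bij_betw e {..<CARD('n)} UNIV" and us: "\<And>u. u \<in> set us \<Longrightarrow> smooth_psh u" and len: "Suc (length us) = CARD('n)"
    and \<phi>: "Ck_on 2 UNIV \<phi>" "supported_in R \<phi>" and w: "Ck_on 2 UNIV w"
  shows "(LINT q|lborel. \<phi> q * MA_density e (w # us) q) = (LINT q|lborel. w q * MA_density e (\<phi> # us) q)"
proof -
  have "(LINT q|lborel. cfun \<phi> q * mixed_MA e (w # us) q) = (LINT q|lborel. cfun w q * mixed_MA e (\<phi> # us) q)"
    unfolding mixed_MA_def list.map
  proof (rule integration_by_parts)
    show "Ck_on 2 UNIV (cfun w)" "Ck_on 2 UNIV (cfun \<phi>)" by (intro Ck_on_of_real open_UNIV w \<phi>)+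
    show "supported_in R (cfun \<phi>)" using \<phi>(2) by (simp add: supported_in_def)
    show "Ck_on 3 UNIV v" if "v \<in> set (map cfun us)" for v
      using that smooth_pshD(1)[OF us] by (auto intro!: Ck_on_of_real)
  qed
  then have "(LINT q|lborel. complex_of_real (\<phi> q * MA_density e (w # us) q)) = (LINT q|lborel. complex_of_real (w q * MA_density e (\<phi> # us) q))"
    using MA_density_real[OF e us len w] MA_density_real[OF e us len \<phi>(1)] by (simp only: of_real_mult)
  then show ?thesis by (simp only: integral_complex_of_real of_real_eq_iff)
qed

lemma integrable_on_compact_times:
  fixes f :: "'a::euclidean_space \<Rightarrow> real"
  assumes "compact A" "continuous_on UNIV f"
  shows "integrable lborel (\<lambda>q. indicator A q * f q)"
  using borel_integrable_compact[OF assms(1) continuous_on_subset[OF assms(2)]] by simp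

lemma continuous_MA_density:
  assumes "\<And>u. u \<in> set us \<Longrightarrow> Ck_on 2 UNIV u"
  shows "continuous_on UNIV (MA_density e us)"
  by (intro continuous_intros continuous_mixed_MA assms)

lemma integrable_supported_MA:
  assumes "continuous_on UNIV \<phi>" "supported_in R \<phi>" "\<And>u. u \<in> set us \<Longrightarrow> Ck_on 2 UNIV u"
  shows "integrable lborel (\<lambda>q. \<phi> q * MA_density e us q)"
  by (rule integrable_supported[of _ R])
     (use assms in \<open>auto simp: supported_in_def intro!: continuous_intros continuous_mixed_MA\<close>)

text \<open>Only the values of \<open>w\<close> on \<open>A\<close> matter, since the Hessian of \<open>\<phi>\<close> vanishes elsewhere.\<close>

lemma MA_integral_estimate:
  fixes e :: "nat \<Rightarrow> 'n::finite"
  assumes e: "bij_betw e {..<CARD('n)} UNIV" and \<phi>: "Ck_on 2 UNIV \<phi>" "supported_in R \<phi>" and A: "compact A"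
    and const: "\<And>q. q \<notin> A \<Longrightarrow> \<exists>S c. open S \<and> q \<in> S \<and> (\<forall>p\<in>S. \<phi> p = c)"
  shows "\<exists>M\<ge>0. \<forall>w \<eta> us. Ck_on 2 UNIV w \<longrightarrow> (\<forall>q\<in>A. \<bar>w q\<bar> \<le> \<eta>) \<longrightarrow> \<eta> \<ge> 0 \<longrightarrow>
    (\<forall>u\<in>set us. smooth_psh u) \<longrightarrow> Suc (length us) = CARD('n) \<longrightarrow>
    \<bar>LINT q|lborel. \<phi> q * MA_density e (w # us) q\<bar> \<le> \<eta> * M * (LINT q|lborel. indicator A q * MA_density e (sq_norm # us) q)"
proof -
  obtain M where M: "M \<ge> 0" "\<And>v q. \<bar>dir_deriv v (dir_deriv v \<phi>) q\<bar> \<le> M * (v \<bullet> v)"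
    using uniform_second_derivative_bound[OF \<phi>] by blast
  have "\<bar>LINT q|lborel. \<phi> q * MA_density e (w # us) q\<bar> \<le> \<eta> * M * (LINT q|lborel. indicator A q * MA_density e (sq_norm # us) q)"
    if w: "Ck_on 2 UNIV w" "\<And>q. q \<in> A \<Longrightarrow> \<bar>w q\<bar> \<le> \<eta>" "\<eta> \<ge> 0"
      and us: "\<And>u. u \<in> set us \<Longrightarrow> smooth_psh u" "Suc (length us) = CARD('n)" for w \<eta> us
  proof -
    let ?S = "\<lambda>q. indicator A q * MA_density e (sq_norm # us) q"
    have iS: "integrable lborel ?S"
      by (rule integrable_on_compact_times[OF A continuous_MA_density])
         (use smooth_pshD(1)[OF us(1)] smooth_pshD(1)[OF smooth_psh_sq_norm] in auto)
    have pt: "norm (w q * MA_density e (\<phi> # us) q) \<le> \<eta> * M * ?S q" for q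
    proof (cases "q \<in> A")
      case True
      have "norm (w q * MA_density e (\<phi> # us) q) = \<bar>w q\<bar> * \<bar>MA_density e (\<phi> # us) q\<bar>" by (simp add: abs_mult)
      also have "\<dots> \<le> \<eta> * (M * MA_density e (sq_norm # us) q)"
        by (intro mult_mono w MA_density_bound(2)[OF e us \<phi>(1) M(2)] True) auto
      finally show ?thesis using True by simp
    next
      case False
      then obtain S c where "open S" "q \<in> S" "\<forall>p\<in>S. \<phi> p = c" using const by blast
      then have "mixed_MA e (\<phi> # us) q = 0" by (intro mixed_MA_locally_constant[of S q \<phi> c]) auto
      then show ?thesis using False by simp
    qed
    have "\<bar>LINT q|lborel. \<phi> q * MA_density e (w # us) q\<bar> = norm (LINT q|lborel. w q * MA_density e (\<phi> # us) q)"
      by (simp add: MA_integration_by_parts[OF e us \<phi> w(1)])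
    also have "\<dots> \<le> (LINT q|lborel. \<eta> * M * ?S q)"
    proof (rule Bochner_Integration.integral_norm_bound_integral)
      show i: "integrable lborel (\<lambda>q. \<eta> * M * ?S q)" using iS by simp
      have "continuous_on UNIV (MA_density e (\<phi> # us))"
        by (rule continuous_MA_density) (use smooth_pshD(1)[OF us(1)] \<phi>(1) in auto)
      then have "(\<lambda>q. w q * MA_density e (\<phi> # us) q) \<in> borel_measurable lborel"
        using Ck_on_imp_continuous[OF w(1)] by (auto intro!: borel_measurable_continuous_onI continuous_intros)
      then show "integrable lborel (\<lambda>q. w q * MA_density e (\<phi> # us) q)"
        by (rule Bochner_Integration.integrable_bound[OF i]) (use pt in \<open>auto intro!: AE_I2 intro: order_trans[OF _ abs_ge_self]\<close>)
    qed (rule pt)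
    also have "\<dots> = \<eta> * M * (LINT q|lborel. ?S q)" by simp
    finally show ?thesis .
  qed
  then show ?thesis using M(1) by (intro exI[of _ M]) auto
qed

text \<open>The third power of the positive part is of class C^2, the regularity that integration by
  parts asks of a test function.\<close>

definition cubic_part :: "real \<Rightarrow> real" where
  "cubic_part t = (max 0 t) ^ 3"

lemma Ck_cubic_part:
  assumes "open S" "Ck_on 2 S f"
  shows "Ck_on 2 S (\<lambda>x. cubic_part (f x))"
proof -
  define G :: "nat \<Rightarrow> real \<Rightarrow> real" where
    "G i t = (if i = 0 then (max 0 t) ^ 3 else if i = 1 then 3 * (max 0 t) ^ 2 else 6 * max 0 t)" for i t
  have D: "((\<lambda>t. (max 0 t) ^ Suc (Suc m)) has_real_derivative real (Suc (Suc m)) * (max 0 t) ^ Suc m) (at t)" for m and t :: real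
  proof -
    consider "t < 0" | "t > 0" | "t = 0" by linarith
    then show ?thesis
    proof cases
      case 1
      have "((\<lambda>t. (max 0 t) ^ Suc (Suc m)) has_real_derivative 0) (at t)"
      proof (rule has_field_derivative_transform_within_open[where S = "{..<0}"])
        show "((\<lambda>t. 0) has_real_derivative 0) (at t)" by simp
      qed (use 1 in auto)
      then show ?thesis using 1 by simp
    next
      case 2
      have "((\<lambda>t. (max 0 t) ^ Suc (Suc m)) has_real_derivative real (Suc (Suc m)) * t ^ Suc m) (at t)"
      proof (rule has_field_derivative_transform_within_open[where S = "{0<..}"])
        show "((\<lambda>t. t ^ Suc (Suc m)) has_real_derivative real (Suc (Suc m)) * t ^ Suc m) (at t)"
          using DERIV_pow[of "Suc (Suc m)" t] by simp
      qed (use 2 in auto)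
      then show ?thesis using 2 by simp
    next
      case 3
      have "(\<lambda>h::real. (max 0 h) ^ Suc m) \<midarrow>0\<rightarrow> (max 0 0) ^ Suc m"
        by (intro tendsto_power tendsto_max tendsto_const tendsto_ident_at)
      moreover have "\<forall>\<^sub>F h in at 0. (max 0 h) ^ Suc m = (max 0 h) ^ Suc (Suc m) / (h::real)"
        unfolding eventually_at_filter by (auto simp: max_def)
      ultimately have "(\<lambda>h. (max 0 h) ^ Suc (Suc m) / (h::real)) \<midarrow>0\<rightarrow> (max 0 0) ^ Suc m"
        by (rule Lim_transform_eventually)
      then show ?thesis using 3 by (simp add: DERIV_def)
    qed
  qed
  have "Ck_on 2 S (\<lambda>x. G 0 (f x))"
  proof (rule Ck_on_compose_real[OF assms])
    fix i x assume "i < (2::nat)"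
    then have "i = 0 \<or> i = 1" by auto
    then show "(G i has_real_derivative G (Suc i) (f x)) (at (f x))"
      using D[of 1 "f x"] DERIV_cmult[OF D[of 0 "f x"], of 3] by (auto simp: G_def[abs_def] numeral_2_eq_2 numeral_3_eq_3)
  next
    fix x
    show "isCont (G 2) (f x)" unfolding G_def[abs_def] by (auto intro!: continuous_intros)
  qed
  then show ?thesis by (simp add: G_def cubic_part_def)
qed

text \<open>A C^2 transition from 0 to 1 that is constant on both sides: the inner cube flattens it
  below \<open>a\<close>, the outer one above \<open>b\<close>.\<close>

definition smooth_step :: "real \<Rightarrow> real \<Rightarrow> real \<Rightarrow> real" where
  "smooth_step a b s = 1 - cubic_part (1 - cubic_part ((s - a) / (b - a)))"

lemma cubic_part_simps: "t \<le> 0 \<Longrightarrow> cubic_part t = 0" "cubic_part 1 = 1" "0 \<le> cubic_part t" "t \<ge> 1 \<Longrightarrow> cubic_part t \<ge> 1" "t \<le> 1 \<Longrightarrow> cubic_part t \<le> 1"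
  by (auto simp: cubic_part_def one_le_power power_le_one max_def)

lemma smooth_step:
  assumes "a < b"
  shows "s \<le> a \<Longrightarrow> smooth_step a b s = 0" "b \<le> s \<Longrightarrow> smooth_step a b s = 1" "0 \<le> smooth_step a b s" "smooth_step a b s \<le> 1"
    and "Ck_on 2 UNIV (\<lambda>q::'a::euclidean_space. smooth_step a b (q \<bullet> q))"
proof -
  show "smooth_step a b s = 0" if "s \<le> a"
    using assms that by (simp add: smooth_step_def cubic_part_simps divide_nonpos_pos)
  show "smooth_step a b s = 1" if "b \<le> s"
    using assms that cubic_part_simps(4)[of "(s - a) / (b - a)"] by (simp add: smooth_step_def cubic_part_simps)
  show "0 \<le> smooth_step a b s" "smooth_step a b s \<le> 1"
    using cubic_part_simps by (auto simp: smooth_step_def)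
  have "Ck_on 2 UNIV (\<lambda>q::'a. 1 - cubic_part (1 - cubic_part (1 / (b - a) * (q \<bullet> q - a))))"
    by (intro Ck_on_diff Ck_const Ck_cubic_part Ck_on_cmult Ck_inner_self open_UNIV)
  then show "Ck_on 2 UNIV (\<lambda>q::'a. smooth_step a b (q \<bullet> q))" by (simp add: smooth_step_def)
qed

text \<open>Formulated with the squared norm, which is smooth at the origin as well.\<close>

definition cutoff :: "real \<Rightarrow> 'a::euclidean_space \<Rightarrow> real" where
  "cutoff R q = 1 - smooth_step (R\<^sup>2) ((R + 1)\<^sup>2) (q \<bullet> q)"

lemma cutoff:
  assumes "R \<ge> 0"
  shows "Ck_on 2 UNIV (cutoff R :: 'a::euclidean_space \<Rightarrow> real)" "0 \<le> cutoff R q"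
    and "norm q \<le> R \<Longrightarrow> cutoff R q = 1" "supported_in (R + 1) (cutoff R :: 'a::euclidean_space \<Rightarrow> real)"
proof -
  have lt: "R\<^sup>2 < (R + 1)\<^sup>2" using assms by (simp add: power2_eq_square algebra_simps)
  have "Ck_on 2 UNIV (\<lambda>q::'a. 1 - smooth_step (R\<^sup>2) ((R + 1)\<^sup>2) (q \<bullet> q))"
    by (intro Ck_on_diff Ck_const smooth_step(5) lt open_UNIV)
  then show "Ck_on 2 UNIV (cutoff R :: 'a \<Rightarrow> real)" by (simp add: cutoff_def[abs_def])
  show "0 \<le> cutoff R q" using smooth_step(4)[OF lt] by (simp add: cutoff_def)
  show "cutoff R q = 1" if "norm q \<le> R"
    using smooth_step(1)[OF lt] that by (simp add: cutoff_def norm_le_square)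
  have "cutoff R x = 0" if "R + 1 < norm x" for x :: 'a
  proof -
    have "(R + 1)\<^sup>2 \<le> x \<bullet> x" using that assms by (simp add: norm_gt_square)
    then show ?thesis using smooth_step(2)[OF lt] by (simp add: cutoff_def)
  qed
  then show "supported_in (R + 1) (cutoff R :: 'a \<Rightarrow> real)" by (simp add: supported_in_def)
qed

lemma locally_constant_off_annulus:
  fixes \<phi> :: "'a::real_normed_vector \<Rightarrow> real"
  assumes "supported_in R \<phi>" "\<And>q. norm q < r \<Longrightarrow> \<phi> q = c" "q \<notin> annulus r R"
  shows "\<exists>S c. open S \<and> q \<in> S \<and> (\<forall>p\<in>S. \<phi> p = c)"
proof -
  from assms(3) consider "norm q < r" | "R < norm q" by (auto simp: annulus_def)
  then show ?thesis
  proof cases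
    case 1
    then show ?thesis using assms(2) by (intro exI[of _ "{p. norm p < r}"] exI[of _ c]) (auto intro!: open_Collect_less continuous_intros)
  next
    case 2
    then show ?thesis using assms(1)
      by (intro exI[of _ "{p. R < norm p}"] exI[of _ 0]) (auto simp: supported_in_def intro!: open_Collect_less continuous_intros)
  qed
qed

text \<open>
  The Chern-Levine-Nirenberg inequality away from the origin: each factor is traded for
  \<open>sq_norm\<close> at the cost of a slightly larger annulus.
\<close>

lemma mass_bound:
  fixes e :: "nat \<Rightarrow> 'n::finite" and F :: "(quat^'n \<Rightarrow> real) set"
  assumes e: "bij_betw e {..<CARD('n)} UNIV" and psh: "\<And>u. u \<in> F \<Longrightarrow> smooth_psh u"
    and bd: "\<And>r R. 0 < r \<Longrightarrow> \<exists>M. \<forall>u\<in>F. \<forall>q\<in>annulus r R. \<bar>u q\<bar> \<le> M"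
  shows "m \<le> CARD('n) \<Longrightarrow> 0 < r \<Longrightarrow> 0 \<le> R \<Longrightarrow> \<exists>C. \<forall>us. set us \<subseteq> F \<and> length us = m \<longrightarrow>
    (LINT q|lborel. indicator (annulus r R) q * MA_density e (us @ replicate (CARD('n) - m) sq_norm) q) \<le> C"
proof (induction m arbitrary: r R)
  case 0
  show ?case by (intro exI[of _ "LINT q|lborel. indicator (annulus r R) q * MA_density e (replicate CARD('n) sq_norm) q"]) auto
next
  case (Suc m)
  define k where "k = CARD('n) - Suc m"
  have k: "CARD('n) - m = Suc k" "Suc m + k = CARD('n)" using Suc.prems by (auto simp: k_def)
  let ?A = "annulus (r/2) (R + 1) :: (quat^'n) set"
  \<comment> \<open>It dominates the indicator of the annulus and is locally constant off the larger
    one. Halving the inner radius keeps a distance from the origin at each step, so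
    \<open>bd\<close> remains applicable.\<close>
  define \<psi> where "\<psi> q = smooth_step ((r/2)\<^sup>2) (r\<^sup>2) (q \<bullet> q) * cutoff R q" for q :: "quat^'n"
  have lt: "(r/2)\<^sup>2 < r\<^sup>2" using Suc.prems(2) by (simp add: power2_eq_square)
  have \<psi>: "Ck_on 2 UNIV \<psi>" "supported_in (R + 1) \<psi>"
  proof -
    show "Ck_on 2 UNIV \<psi>"
      unfolding \<psi>_def[abs_def] by (rule Ck_on_mult[OF open_UNIV smooth_step(5)[OF lt] cutoff(1)[OF Suc.prems(3)]])
    show "supported_in (R + 1) \<psi>"
      unfolding \<psi>_def[abs_def] supported_in_def by (simp add: supported_inD[OF cutoff(4)[OF Suc.prems(3)]])
  qed
  have \<psi>0: "0 \<le> \<psi> q" for q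
    unfolding \<psi>_def by (intro mult_nonneg_nonneg smooth_step(3)[OF lt] cutoff(2)[OF Suc.prems(3)])
  have \<psi>1: "\<psi> q = 1" if "q \<in> annulus r R" for q
  proof -
    have n: "r \<le> norm q" "norm q \<le> R" using that by (auto simp: annulus_def)
    have "r\<^sup>2 \<le> q \<bullet> q" using n(1) Suc.prems(2) by (simp add: norm_ge_square)
    then show ?thesis
      by (simp add: \<psi>_def smooth_step(2)[OF lt] cutoff(3)[OF Suc.prems(3) n(2)])
  qed
  have \<psi>r: "\<psi> q = 0" if "norm q < r/2" for q
  proof -
    have "q \<bullet> q < (r/2)\<^sup>2" using that unfolding norm_lt_square by blast
    then have "q \<bullet> q \<le> (r/2)\<^sup>2" by (rule less_imp_le)
    then show ?thesis by (simp add: \<psi>_def smooth_step(1)[OF lt])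
  qed
  have "\<exists>M\<ge>0. \<forall>w \<eta> us. Ck_on 2 UNIV w \<longrightarrow> (\<forall>q\<in>?A. \<bar>w q\<bar> \<le> \<eta>) \<longrightarrow> \<eta> \<ge> 0 \<longrightarrow>
      (\<forall>u\<in>set us. smooth_psh u) \<longrightarrow> Suc (length us) = CARD('n) \<longrightarrow>
      \<bar>LINT q|lborel. \<psi> q * MA_density e (w # us) q\<bar> \<le> \<eta> * M * (LINT q|lborel. indicator ?A q * MA_density e (sq_norm # us) q)"
    (is "\<exists>M\<ge>0. ?P M")
    by (rule MA_integral_estimate[OF e \<psi> compact_annulus[of "r/2" "R + 1"] locally_constant_off_annulus[OF \<psi>(2) \<psi>r]])
  then obtain M where M: "M \<ge> 0" "?P M" by blast
  obtain M2 where M2: "\<And>u q. u \<in> F \<Longrightarrow> q \<in> ?A \<Longrightarrow> \<bar>u q\<bar> \<le> M2" using bd[of "r/2" "R+1"] Suc.prems(2) by auto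
  define \<eta> where "\<eta> = max M2 0"
  obtain C where C: "\<And>us. set us \<subseteq> F \<Longrightarrow> length us = m \<Longrightarrow>
      (LINT q|lborel. indicator ?A q * MA_density e (us @ replicate (Suc k) sq_norm) q) \<le> C"
    using Suc.IH[of "r/2" "R+1"] Suc.prems by (auto simp: k(1))
  have "(LINT q|lborel. indicator (annulus r R) q * MA_density e (us @ replicate (CARD('n) - Suc m) sq_norm) q) \<le> \<eta> * M * C"
    if us: "set us \<subseteq> F" "length us = Suc m" for us
  proof -
    obtain u ws where uw: "us = u # ws" using us(2) by (cases us) auto
    let ?ws = "ws @ replicate k sq_norm"
    have sp: "smooth_psh w" if "w \<in> set (u # ?ws)" for w
      using that psh us(1) smooth_psh_sq_norm by (auto simp: uw split: if_splits)
    have len: "Suc (length ?ws) = CARD('n)" using us(2) k by (simp add: uw)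
    have D0: "0 \<le> MA_density e (u # ?ws) q" for q by (rule MA_density_nonneg[OF e sp]) (use len in auto)
    have C2: "Ck_on 2 UNIV w" if "w \<in> set (u # ?ws)" for w using smooth_pshD(1)[OF sp[OF that]] .
    have "(LINT q|lborel. indicator (annulus r R) q * MA_density e (u # ?ws) q) \<le> (LINT q|lborel. \<psi> q * MA_density e (u # ?ws) q)"
    proof (rule integral_mono)
      show "integrable lborel (\<lambda>q. indicator (annulus r R) q * MA_density e (u # ?ws) q)"
        by (rule integrable_on_compact_times[OF compact_annulus continuous_MA_density[OF C2]])
      show "integrable lborel (\<lambda>q. \<psi> q * MA_density e (u # ?ws) q)"
        by (rule integrable_supported_MA[OF Ck_on_imp_continuous[OF \<psi>(1)] \<psi>(2) C2])
      show "indicator (annulus r R) q * MA_density e (u # ?ws) q \<le> \<psi> q * MA_density e (u # ?ws) q" for q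
        using \<psi>0 \<psi>1 D0 by (intro mult_right_mono) (auto simp: indicator_def)
    qed
    also have "\<dots> \<le> \<bar>LINT q|lborel. \<psi> q * MA_density e (u # ?ws) q\<bar>" by simp
    also have "\<dots> \<le> \<eta> * M * (LINT q|lborel. indicator ?A q * MA_density e (sq_norm # ?ws) q)"
    proof (rule M(2)[rule_format])
      show "\<bar>u q\<bar> \<le> \<eta>" if "q \<in> ?A" for q using M2[OF _ that, of u] us(1) by (simp add: uw \<eta>_def)
    qed (use C2 sp len in \<open>auto simp: \<eta>_def simp del: Ck_on.simps\<close>)
    also have "\<dots> \<le> \<eta> * M * C"
    proof (rule mult_left_mono)
      have "(LINT q|lborel. indicator ?A q * MA_density e (ws @ replicate (Suc k) sq_norm) q) \<le> C"
        using C us by (simp add: uw)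
      then show "(LINT q|lborel. indicator ?A q * MA_density e (sq_norm # ?ws) q) \<le> C"
        by (simp add: mixed_MA_move)
    qed (use M(1) in \<open>simp add: \<eta>_def\<close>)
    finally show ?thesis by (simp add: uw k_def)
  qed
  then show ?case by blast
qed

text \<open>\<open>K\<close> is chosen before \<open>w\<close> and \<open>us\<close>, and the bound
  is linear in the size of \<open>w\<close> on the annulus. So uniform smallness of a difference on
  the annulus makes the integral small.\<close>

lemma MA_test_estimate:
  fixes e :: "nat \<Rightarrow> 'n::finite" and F :: "(quat^'n \<Rightarrow> real) set"
  assumes e: "bij_betw e {..<CARD('n)} UNIV" and psh: "\<And>u. u \<in> F \<Longrightarrow> smooth_psh u"
    and bd: "\<And>r R. 0 < r \<Longrightarrow> \<exists>M. \<forall>u\<in>F. \<forall>q\<in>annulus r R. \<bar>u q\<bar> \<le> M"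
    and \<phi>: "Ck_on 2 UNIV \<phi>" "supported_in R \<phi>" and r: "r > 0" "\<And>q. norm q < r \<Longrightarrow> \<phi> q = c" and R: "R \<ge> 0"
  shows "\<exists>K\<ge>0. \<forall>w \<eta> us. Ck_on 2 UNIV w \<longrightarrow> (\<forall>q\<in>annulus r R. \<bar>w q\<bar> \<le> \<eta>) \<longrightarrow> \<eta> \<ge> 0 \<longrightarrow> set us \<subseteq> F \<longrightarrow>
     Suc (length us) = CARD('n) \<longrightarrow> \<bar>LINT q|lborel. \<phi> q * MA_density e (w # us) q\<bar> \<le> \<eta> * K"
proof -
  let ?A = "annulus r R :: (quat^'n) set"
  have "\<exists>M\<ge>0. \<forall>w \<eta> us. Ck_on 2 UNIV w \<longrightarrow> (\<forall>q\<in>?A. \<bar>w q\<bar> \<le> \<eta>) \<longrightarrow> \<eta> \<ge> 0 \<longrightarrow>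
      (\<forall>u\<in>set us. smooth_psh u) \<longrightarrow> Suc (length us) = CARD('n) \<longrightarrow>
      \<bar>LINT q|lborel. \<phi> q * MA_density e (w # us) q\<bar> \<le> \<eta> * M * (LINT q|lborel. indicator ?A q * MA_density e (sq_norm # us) q)"
    (is "\<exists>M\<ge>0. ?P M")
    by (rule MA_integral_estimate[OF e \<phi> compact_annulus[of r R] locally_constant_off_annulus[OF \<phi>(2) r(2)]])
  then obtain M where M: "M \<ge> 0" "?P M" by blast
  obtain C where C: "\<And>us. set us \<subseteq> F \<Longrightarrow> length us = CARD('n) - 1 \<Longrightarrow>
      (LINT q|lborel. indicator ?A q * MA_density e (us @ replicate (CARD('n) - (CARD('n) - 1)) sq_norm) q) \<le> C"
    using mass_bound[OF e psh bd, of "CARD('n) - 1" r R] r R by auto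
  have "\<bar>LINT q|lborel. \<phi> q * MA_density e (w # us) q\<bar> \<le> \<eta> * (M * max C 0)"
    if w: "Ck_on 2 UNIV w" "\<forall>q\<in>?A. \<bar>w q\<bar> \<le> \<eta>" "\<eta> \<ge> 0" and us: "set us \<subseteq> F" "Suc (length us) = CARD('n)" for w \<eta> us
  proof -
    have 1: "CARD('n) - (CARD('n) - 1) = 1" using us(2) by linarith
    have "\<bar>LINT q|lborel. \<phi> q * MA_density e (w # us) q\<bar> \<le> \<eta> * M * (LINT q|lborel. indicator ?A q * MA_density e (sq_norm # us) q)"
      by (rule M(2)[rule_format]) (use w us psh in auto)
    also have "\<dots> \<le> \<eta> * M * max C 0"
    proof (rule mult_left_mono)
      have "length us = CARD('n) - 1" using us(2) by linarith
      from C[OF us(1) this] show "(LINT q|lborel. indicator ?A q * MA_density e (sq_norm # us) q) \<le> max C 0"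
        unfolding 1 using mixed_MA_move[of e us sq_norm "[]"] by simp
    qed (use w M in simp)
    finally show ?thesis by (simp add: mult.assoc)
  qed
  then show ?thesis using M(1) by (intro exI[of _ "M * max C 0"]) auto
qed

section \<open>Comparison of two approximating sequences\<close>

lemma MA_telescope:
  fixes U V :: "quat^'n::finite \<Rightarrow> real"
  assumes "Ck_on 2 UNIV U" "Ck_on 2 UNIV V"
  shows "mixed_MA e (replicate n U) q - mixed_MA e (replicate n V) q =
    (\<Sum>a<n. mixed_MA e ((\<lambda>q. U q - V q) # replicate a U @ replicate (n - Suc a) V) q)"
proof -
  define T where "T a = mixed_MA e (replicate a U @ replicate (n - a) V) q" for a
  have "T (Suc a) - T a = mixed_MA e ((\<lambda>q. U q - V q) # replicate a U @ replicate (n - Suc a) V) q" if "a < n" for a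
  proof -
    have "n - a = Suc (n - Suc a)" using that by simp
    then have "T a = mixed_MA e (V # replicate a U @ replicate (n - Suc a) V) q"
      by (simp add: T_def mixed_MA_move)
    moreover have "T (Suc a) = mixed_MA e (U # replicate a U @ replicate (n - Suc a) V) q" by (simp add: T_def)
    ultimately show ?thesis
      using mixed_MA_linear[OF assms(2,1), of e "-1" "replicate a U @ replicate (n - Suc a) V" q] by (simp add: algebra_simps)
  qed
  then have "(\<Sum>a<n. mixed_MA e ((\<lambda>q. U q - V q) # replicate a U @ replicate (n - Suc a) V) q) = (\<Sum>a<n. T (Suc a) - T a)"
    by simp
  also have "\<dots> = T n - T 0" by (rule sum_lessThan_telescope)
  finally show ?thesis by (simp add: T_def)
qed

lemma MA_test_convergence:
  fixes e :: "nat \<Rightarrow> 'n::finite" and F :: "(quat^'n \<Rightarrow> real) set"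
  assumes e: "bij_betw e {..<CARD('n)} UNIV" and psh: "\<And>u. u \<in> F \<Longrightarrow> smooth_psh u"
    and bd: "\<And>r R. 0 < r \<Longrightarrow> \<exists>M. \<forall>u\<in>F. \<forall>q\<in>annulus r R. \<bar>u q\<bar> \<le> M"
    and \<phi>: "Ck_on 2 UNIV \<phi>" "supported_in R \<phi>" and r: "r > 0" "\<And>q. norm q < r \<Longrightarrow> \<phi> q = c" and R: "R \<ge> 0"
    and UV: "\<And>j. U j \<in> F" "\<And>j. V j \<in> F"
    and unif: "\<And>\<eta>. \<eta> > 0 \<Longrightarrow> \<exists>J. \<forall>j\<ge>J. \<forall>q\<in>annulus r R. \<bar>U j q - V j q\<bar> \<le> \<eta>"
  shows "(\<lambda>j. (LINT q|lborel. \<phi> q * MA_density e (replicate CARD('n) (U j)) q) -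
    (LINT q|lborel. \<phi> q * MA_density e (replicate CARD('n) (V j)) q)) \<longlonglongrightarrow> 0"
proof -
  let ?n = "CARD('n)"
  let ?L = "\<lambda>j. (LINT q|lborel. \<phi> q * MA_density e (replicate ?n (U j)) q) - (LINT q|lborel. \<phi> q * MA_density e (replicate ?n (V j)) q)"
  let ?W = "\<lambda>j a. (\<lambda>q. U j q - V j q) # replicate a (U j) @ replicate (?n - Suc a) (V j)"
  have "\<exists>K\<ge>0. \<forall>w \<eta> us. Ck_on 2 UNIV w \<longrightarrow> (\<forall>q\<in>annulus r R. \<bar>w q\<bar> \<le> \<eta>) \<longrightarrow> \<eta> \<ge> 0 \<longrightarrow> set us \<subseteq> F \<longrightarrow>
     Suc (length us) = CARD('n) \<longrightarrow> \<bar>LINT q|lborel. \<phi> q * MA_density e (w # us) q\<bar> \<le> \<eta> * K"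
    (is "\<exists>K\<ge>0. ?P K")
    by (rule MA_test_estimate[OF e psh bd \<phi> r R])
  then obtain K where K: "K \<ge> 0" "?P K" by blast
  have C2: "Ck_on 2 UNIV (U j)" "Ck_on 2 UNIV (V j)" for j using smooth_pshD(1)[OF psh] UV by blast+
  have Cd: "Ck_on 2 UNIV (\<lambda>q. U j q - V j q)" for j by (rule Ck_on_diff[OF open_UNIV C2])
  have est: "\<bar>?L j\<bar> \<le> real ?n * (\<eta> * K)" if \<eta>: "\<eta> \<ge> 0" "\<forall>q\<in>annulus r R. \<bar>U j q - V j q\<bar> \<le> \<eta>" for j \<eta>
  proof -
    have int: "integrable lborel (\<lambda>q. \<phi> q * MA_density e us q)" if "\<And>u. u \<in> set us \<Longrightarrow> Ck_on 2 UNIV u" for us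
      by (rule integrable_supported_MA[OF Ck_on_imp_continuous[OF \<phi>(1)] \<phi>(2) that])
    have iW: "integrable lborel (\<lambda>q. \<phi> q * MA_density e (?W j a) q)" for a
      by (rule int) (use C2 Cd in \<open>auto split: if_splits simp del: Ck_on.simps\<close>)
    have "?L j = (LINT q|lborel. \<phi> q * MA_density e (replicate ?n (U j)) q - \<phi> q * MA_density e (replicate ?n (V j)) q)"
      by (rule Bochner_Integration.integral_diff[symmetric]; rule int) (use C2 in \<open>auto split: if_splits simp del: Ck_on.simps\<close>)
    also have "\<dots> = (LINT q|lborel. (\<Sum>a<?n. \<phi> q * MA_density e (?W j a) q))"
    proof -
      have "\<phi> q * MA_density e (replicate ?n (U j)) q - \<phi> q * MA_density e (replicate ?n (V j)) q = (\<Sum>a<?n. \<phi> q * MA_density e (?W j a) q)" for q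
        using arg_cong[OF MA_telescope[OF C2(1)[of j] C2(2)[of j], of e ?n q], of Re]
        by (simp add: sum_distrib_left flip: right_diff_distrib)
      then show ?thesis by simp
    qed
    also have "\<dots> = (\<Sum>a<?n. (LINT q|lborel. \<phi> q * MA_density e (?W j a) q))"
      by (rule Bochner_Integration.integral_sum) (rule iW)
    also have "\<bar>\<dots>\<bar> \<le> (\<Sum>a<?n. \<eta> * K)"
    proof (rule order_trans[OF sum_abs sum_mono])
      fix a assume "a \<in> {..<?n}"
      then show "\<bar>LINT q|lborel. \<phi> q * MA_density e (?W j a) q\<bar> \<le> \<eta> * K"
        by (intro K(2)[rule_format] Cd \<eta>(1) \<eta>(2)[rule_format]) (use UV in \<open>auto split: if_splits\<close>)
    qed
    finally show ?thesis by simp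
  qed
  show ?thesis
  proof (rule LIMSEQ_I)
    fix \<epsilon> :: real assume \<epsilon>: "\<epsilon> > 0"
    \<comment> \<open>The telescoping sum has n terms of size at most \<eta> K; the summand 1 keeps
      the denominator positive when \<open>K = 0\<close>.\<close>
    define \<eta> where "\<eta> = \<epsilon> / (2 * (real ?n * K + 1))"
    have pos: "real ?n * K + 1 > 0" using K(1) by (simp add: add_nonneg_pos)
    have \<eta>: "\<eta> > 0" using \<epsilon> pos by (simp add: \<eta>_def)
    obtain J where J: "\<And>j. j \<ge> J \<Longrightarrow> \<forall>q\<in>annulus r R. \<bar>U j q - V j q\<bar> \<le> \<eta>" using unif[OF \<eta>] by auto
    have "real ?n * (\<eta> * K) < \<epsilon>"
    proof -
      have "real ?n * (\<eta> * K) = \<eta> * (real ?n * K)" by simp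
      also have "\<dots> \<le> \<eta> * (real ?n * K + 1)" using \<eta> by (intro mult_left_mono) auto
      also have "\<dots> = \<epsilon> / 2"
      proof -
        have "x / (2 * y) * y = x / 2" if "y > 0" for x y :: real using that by simp
        from this[OF pos] show ?thesis unfolding \<eta>_def .
      qed
      finally show ?thesis using \<epsilon> by simp
    qed
    then show "\<exists>J. \<forall>j\<ge>J. norm (?L j - 0) < \<epsilon>"
      using est[OF less_imp_le[OF \<eta>] J] by (intro exI[of _ J]) (auto intro: le_less_trans)
  qed
qed

text \<open>The upper half of Dini's theorem; the lower half is immediate, since a decreasing
  sequence stays above its limit.\<close>

lemma dini_upper:
  fixes f :: "nat \<Rightarrow> 'a::euclidean_space \<Rightarrow> real"
  assumes K: "compact K" and f: "\<And>j. continuous_on K (f j)" and g: "continuous_on K g"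
    and dec: "\<And>x. x \<in> K \<Longrightarrow> decseq (\<lambda>j. f j x)" and lim: "\<And>x. x \<in> K \<Longrightarrow> (\<lambda>j. f j x) \<longlonglongrightarrow> g x" and \<eta>: "\<eta> > 0"
  shows "\<exists>J. \<forall>j\<ge>J. \<forall>x\<in>K. f j x \<le> g x + \<eta>"
proof -
  define L where "L j = K \<inter> (\<lambda>x. f j x - g x) -` {\<eta>..}" for j
  have cL: "compact (L j)" for j
  proof -
    have "closed (L j)" unfolding L_def
      by (intro continuous_closed_preimage continuous_intros f g compact_imp_closed[OF K] closed_atLeast)
    then have "compact (K \<inter> L j)" by (rule compact_Int_closed[OF K])
    then show ?thesis by (simp add: L_def Int_absorb1 flip: Int_assoc)
  qed
  have "\<exists>j. L j = {}"
  proof (rule ccontr)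
    assume "\<nexists>j. L j = {}"
    then have "\<Inter> (range L) \<noteq> {}"
    proof (intro compact_nest cL)
      show "L n \<subseteq> L m" if "m \<le> n" for m n
      proof
        fix x assume x: "x \<in> L n"
        then have "f n x \<le> f m x" using decseqD[OF dec that] by (simp add: L_def)
        then show "x \<in> L m" using x by (auto simp: L_def)
      qed
    qed auto
    then obtain x where x: "\<And>j. x \<in> L j" by auto
    have "x \<in> K" using x[of 0] by (simp add: L_def)
    from order_tendstoD(2)[OF lim[OF this], of "g x + \<eta>"] \<eta> obtain j where "f j x < g x + \<eta>"
      by (auto dest: eventually_happens)
    then show False using x[of j] by (simp add: L_def)
  qed
  then obtain J where J: "L J = {}" by blast
  have "f j x \<le> g x + \<eta>" if "j \<ge> J" "x \<in> K" for j x
  proof -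
    have "f j x \<le> f J x" using decseqD[OF dec[OF that(2)] that(1)] .
    moreover have "f J x < g x + \<eta>" using J that(2) by (force simp: L_def)
    ultimately show ?thesis by simp
  qed
  then show ?thesis by blast
qed

section \<open>Test functions that are constant near the origin\<close>

text \<open>A coordinate is truncated so that it vanishes on a half-space around the origin. A
  reflection and an exchange of the two points achieve that the larger of the two coordinates is
  positive.\<close>

lemma separating_test_function:
  fixes x y :: "'a::euclidean_space"
  assumes "x \<noteq> y"
  shows "\<exists>f r. Ck_on 2 UNIV f \<and> r > 0 \<and> (\<forall>q. norm q < r \<longrightarrow> f q = f 0) \<and> f x \<noteq> (f y :: real)"
proof -
  have sep: "\<exists>f r. Ck_on 2 UNIV f \<and> r > 0 \<and> (\<forall>q. norm q < r \<longrightarrow> f q = f 0) \<and> f x \<noteq> (f y :: real)"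
    if v: "norm v = 1" and lt: "v \<bullet> y < v \<bullet> x" "0 < v \<bullet> x" for v x y :: 'a
  proof -
    \<comment> \<open>The midpoint between v \<bullet> x and the positive part of v \<bullet> y. It
      separates the two points and is positive, so by Cauchy-Schwarz the half-space where
      \<open>f\<close> vanishes contains the ball of radius \<open>c\<close>.\<close>
    define c where "c = (max (v \<bullet> y) 0 + v \<bullet> x) / 2"
    have c: "c > 0" "c < v \<bullet> x" "v \<bullet> y < c" using lt by (auto simp: c_def)
    define f where "f q = cubic_part (q \<bullet> v - c)" for q :: 'a
    have "Ck_on 2 UNIV f"
      unfolding f_def[abs_def] by (intro Ck_cubic_part Ck_on_diff Ck_inner_left Ck_const open_UNIV)
    moreover have "f q = 0" if "norm q < c" for q
    proof -
      have "q \<bullet> v \<le> norm q * norm v" by (rule norm_cauchy_schwarz)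
      then have "q \<bullet> v - c \<le> 0" using that v by simp
      then show ?thesis by (simp add: f_def cubic_part_simps)
    qed
    moreover have "f y = 0" using c by (simp add: f_def cubic_part_simps inner_commute)
    moreover have "f x > 0" using c by (simp add: f_def cubic_part_def inner_commute)
    moreover have "f 0 = 0" using c by (simp add: f_def cubic_part_simps)
    ultimately show ?thesis using c(1) by (intro exI[of _ f] exI[of _ c]) auto
  qed
  obtain b where b: "b \<in> Basis" "x \<bullet> b \<noteq> y \<bullet> b" using assms euclidean_eqI by blast
  then consider "b \<bullet> y < b \<bullet> x" "0 < b \<bullet> x" | "b \<bullet> x < b \<bullet> y" "0 < b \<bullet> y" |
    "(- b) \<bullet> y < (- b) \<bullet> x" "0 < (- b) \<bullet> x" | "(- b) \<bullet> x < (- b) \<bullet> y" "0 < (- b) \<bullet> y"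
    by (fastforce simp: inner_commute)
  then show ?thesis
  proof cases
    case 2
    then show ?thesis using sep[of b x y] b(1) by (metis norm_Basis)
  next
    case 4
    then show ?thesis using sep[of "- b" x y] b(1) by (metis norm_Basis norm_minus_cancel)
  qed (use sep[of b y x] sep[of "- b" y x] b(1) in simp_all)
qed

text \<open>The C^2 functions that are constant near the origin form a point-separating algebra.
  Multiplication by a cutoff restores compact support, hence the radius R + 1. The error is bounded
  by a multiple of the cutoff, not merely by \<delta>, so it can be integrated against measures that
  are only locally finite.\<close>

lemma test_function_approximation:
  fixes \<phi> :: "'a::euclidean_space \<Rightarrow> real"
  assumes \<phi>: "continuous_on UNIV \<phi>" "supported_in R \<phi>" and R: "R > 0" and \<delta>: "\<delta> > 0"
  shows "\<exists>f r. Ck_on 2 UNIV f \<and> supported_in (R + 1) f \<and> r > 0 \<and> (\<forall>q. norm q < r \<longrightarrow> f q = f 0) \<and>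
    (\<forall>q. \<bar>\<phi> q - f q\<bar> \<le> \<delta> * cutoff R q)"
proof -
  define A where "A = {f::'a \<Rightarrow> real. Ck_on 2 UNIV f \<and> (\<exists>r>0. \<forall>q. norm q < r \<longrightarrow> f q = f 0)}"
  have "function_ring_on A (cball 0 (R + 1))"
  proof
    fix f g assume f: "f \<in> A" and g: "g \<in> A"
    obtain r s where rs: "r > 0" "\<forall>q. norm q < r \<longrightarrow> f q = f 0" "s > 0" "\<forall>q. norm q < s \<longrightarrow> g q = g 0"
      using f g by (auto simp: A_def)
    have C: "Ck_on 2 UNIV f" "Ck_on 2 UNIV g" using f g by (auto simp: A_def simp del: Ck_on.simps)
    have fg: "f q = f 0" "g q = g 0" if "norm q < min r s" for q
      using rs(2)[rule_format, of q] rs(4)[rule_format, of q] that by auto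
    have m: "min r s > 0" using rs by simp
    have "Ck_on 2 UNIV (\<lambda>x. f x + g x)" "Ck_on 2 UNIV (\<lambda>x. f x * g x)"
      by (intro Ck_on_add Ck_on_mult C open_UNIV)+
    then show "(\<lambda>x. f x + g x) \<in> A" "(\<lambda>x. f x * g x) \<in> A"
      unfolding A_def mem_Collect_eq using m fg by metis+
  next
    fix f assume "f \<in> A"
    then have "Ck_on 2 UNIV f" by (simp add: A_def del: Ck_on.simps)
    then show "continuous_on (cball 0 (R + 1)) f" using Ck_on_imp_continuous continuous_on_subset by blast
  next
    show "(\<lambda>_. c) \<in> A" for c by (auto simp: A_def Ck_const intro: exI[of _ 1] simp del: Ck_on.simps)
  next
    fix x y :: 'a assume "x \<noteq> y"
    then obtain f r where "Ck_on 2 UNIV f" "r > 0" "\<forall>q. norm q < r \<longrightarrow> f q = f 0" "f x \<noteq> (f y :: real)"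
      using separating_test_function by metis
    then show "\<exists>f\<in>A. f x \<noteq> f y" unfolding A_def by blast
  qed (rule compact_cball)
  from function_ring_on.Stone_Weierstrass_basic[OF this continuous_on_subset[OF \<phi>(1)] \<delta>]
  obtain g where g: "g \<in> A" "\<And>x. x \<in> cball 0 (R + 1) \<Longrightarrow> \<bar>\<phi> x - g x\<bar> < \<delta>" by auto
  obtain r where r: "r > 0" "\<forall>q. norm q < r \<longrightarrow> g q = g 0" using g(1) by (auto simp: A_def)
  have Cg: "Ck_on 2 UNIV g" using g(1) by (simp add: A_def del: Ck_on.simps)
  have R0: "R \<ge> 0" using R by simp
  define f where "f q = cutoff R q * g q" for q
  have "Ck_on 2 UNIV f" unfolding f_def[abs_def] by (intro Ck_on_mult cutoff(1) R0 Cg open_UNIV)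
  moreover have "supported_in (R + 1) f"
    unfolding f_def[abs_def] supported_in_def by (simp add: supported_inD[OF cutoff(4)[OF R0]])
  moreover have "f q = f 0" if "norm q < min r R" for q
  proof -
    have "cutoff R q = 1" by (rule cutoff(3)[OF R0]) (use that in simp)
    moreover have "cutoff R (0::'a) = 1" by (rule cutoff(3)[OF R0]) (use R in simp)
    moreover have "g q = g 0" using r(2) that by simp
    ultimately show ?thesis by (simp add: f_def)
  qed
  moreover have "\<bar>\<phi> q - f q\<bar> \<le> \<delta> * cutoff R q" for q
  proof -
    consider "norm q \<le> R" | "R < norm q" "norm q \<le> R + 1" | "R + 1 < norm q" by linarith
    then show ?thesis
    proof cases
      case 1
      then show ?thesis using g(2)[of q] cutoff(3)[OF R0 1] by (simp add: f_def)
    next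
      case 2
      have \<phi>0: "\<phi> q = 0" using supported_inD[OF \<phi>(2) 2(1)] .
      then have "\<bar>g q\<bar> \<le> \<delta>" using g(2)[of q] 2(2) by simp
      then have "\<bar>cutoff R q * g q\<bar> \<le> cutoff R q * \<delta>"
        using cutoff(2)[OF R0, of q] by (simp add: abs_mult mult_left_mono)
      then show ?thesis using \<phi>0 by (simp add: f_def mult.commute)
    next
      case 3
      have "\<phi> q = 0" using supported_inD[OF \<phi>(2)] 3 by simp
      then show ?thesis using supported_inD[OF cutoff(4)[OF R0] 3] by (simp add: f_def)
    qed
  qed
  moreover have "min r R > 0" using r(1) R by simp
  ultimately show ?thesis by blast
qed


section \<open>The measure of the logarithm\<close>

definition log_weight :: "quat^'n \<Rightarrow> real" where
  "log_weight q = fact CARD('n) / (2 * norm q ^ (2 * CARD('n)))"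

abbreviation reg :: "nat \<Rightarrow> quat^'n \<Rightarrow> real" where
  "reg j \<equiv> log_reg (inverse (real (Suc j)))"

lemma log_weight_nonneg: "0 \<le> log_weight q"
  by (simp add: log_weight_def)

lemma smooth_psh_reg: "smooth_psh (reg j)"
  unfolding smooth_psh_def smooth_on_def
  by (intro conjI allI Ck_log_reg line_laplacian_log_reg_nonneg) simp_all

lemma MA_reg:
  fixes e :: "nat \<Rightarrow> 'n::finite" and q :: "quat^'n"
  assumes e: "bij_betw e {..<CARD('n)} UNIV"
  shows "q \<noteq> 0 \<Longrightarrow> (\<lambda>j. MA_density e (replicate CARD('n) (reg j)) q) \<longlonglongrightarrow> log_weight q"
    and "q \<noteq> 0 \<Longrightarrow> MA_density e (replicate CARD('n) (reg j)) q \<le> 2 * log_weight q"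
    and "0 \<le> MA_density e (replicate CARD('n) (reg j)) q"
proof -
  let ?n = "CARD('n)" and ?s = "q \<bullet> q"
  have MA: "MA_density e (replicate ?n (reg j)) q = fact ?n * (1 / (?s + inverse (real (Suc j))) ^ ?n - ?s / (2 * (?s + inverse (real (Suc j))) ^ (?n + 1)))" for j
  proof -
    have pos: "0 < inverse (real (Suc j))" by simp
    show ?thesis unfolding MA_log_reg[OF e pos] by (rule Re_complex_of_real)
  qed
  have w: "log_weight q = fact ?n / (2 * ?s ^ ?n)"
    by (simp add: log_weight_def power_mult dot_square_norm)
  show "0 \<le> MA_density e (replicate ?n (reg j)) q"
    by (rule MA_density_nonneg[OF e]) (use smooth_psh_reg in \<open>auto split: if_splits\<close>)
  assume q: "q \<noteq> 0"
  then have s: "?s > 0" by simp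
  have lim: "(\<lambda>j. ?s + inverse (real (Suc j))) \<longlonglongrightarrow> ?s + 0"
    by (intro tendsto_intros LIMSEQ_inverse_real_of_nat)
  have "(\<lambda>j. fact ?n * (1 / (?s + inverse (real (Suc j))) ^ ?n - ?s / (2 * (?s + inverse (real (Suc j))) ^ (?n + 1))))
    \<longlonglongrightarrow> fact ?n * (1 / (?s + 0) ^ ?n - ?s / (2 * (?s + 0) ^ (?n + 1)))"
    by (intro tendsto_intros lim) (use s in auto)
  moreover have "fact ?n * (1 / (?s + 0) ^ ?n - ?s / (2 * (?s + 0) ^ (?n + 1))) = log_weight q"
    unfolding w using s by (simp add: field_simps)
  ultimately show "(\<lambda>j. MA_density e (replicate ?n (reg j)) q) \<longlonglongrightarrow> log_weight q" unfolding MA by (simp only:)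
  have \<rho>: "?s \<le> ?s + inverse (real (Suc j))" "0 < ?s + inverse (real (Suc j))" using s by (simp_all add: add_pos_pos)
  have "fact ?n * (1 / (?s + inverse (real (Suc j))) ^ ?n - ?s / (2 * (?s + inverse (real (Suc j))) ^ (?n + 1))) \<le>
    fact ?n * (1 / ?s ^ ?n)"
  proof (rule mult_left_mono)
    have "1 / (?s + inverse (real (Suc j))) ^ ?n \<le> 1 / ?s ^ ?n"
      using s \<rho> by (intro divide_left_mono power_mono mult_pos_pos zero_less_power) auto
    moreover have "0 \<le> ?s / (2 * (?s + inverse (real (Suc j))) ^ (?n + 1))"
      using s \<rho> by (intro divide_nonneg_nonneg mult_nonneg_nonneg zero_le_power) auto
    ultimately show "1 / (?s + inverse (real (Suc j))) ^ ?n - ?s / (2 * (?s + inverse (real (Suc j))) ^ (?n + 1)) \<le> 1 / ?s ^ ?n"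
      by linarith
  qed simp
  \<comment> \<open>Dropping the negative term of the density costs exactly a factor 2 against the
    limit; this bound is the dominating function of the later convergence proof.\<close>
  also have "\<dots> = 2 * log_weight q" unfolding w by simp
  finally show "MA_density e (replicate ?n (reg j)) q \<le> 2 * log_weight q" unfolding MA .
qed

section \<open>Approximations of the logarithm away from the origin\<close>

lemma log_norm_le_approx:
  fixes U :: "nat \<Rightarrow> quat^'n \<Rightarrow> real"
  assumes C: "\<And>j. continuous_on UNIV (U j)" and dec: "\<And>q. decseq (\<lambda>j. U j q)" and lim: "\<And>q. (\<lambda>j. ereal (U j q)) \<longlonglongrightarrow> log_norm q"
  shows "q \<noteq> 0 \<Longrightarrow> ln (norm q) \<le> U j q" "U j q \<le> U 0 q"
    and "0 < r \<Longrightarrow> 0 < \<eta> \<Longrightarrow> \<exists>J. \<forall>j\<ge>J. \<forall>q\<in>annulus r R. U j q \<le> ln (norm q) + \<eta>"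
proof -
  show "ln (norm q) \<le> U j q" if "q \<noteq> 0"
    using usc_decreasing_limit(2)[OF C dec lim, of q j] that by (simp add: log_norm_def)
  show "U j q \<le> U 0 q" using decseqD[OF dec[of q], of 0 j] by simp
  assume "0 < r" "0 < \<eta>"
  then have n0: "q \<noteq> 0" if "q \<in> annulus r R" for q :: "quat^'n" using that by (auto simp: annulus_def)
  show "\<exists>J. \<forall>j\<ge>J. \<forall>q\<in>annulus r R. U j q \<le> ln (norm q) + \<eta>"
  proof (rule dini_upper[OF compact_annulus continuous_on_subset[OF C] _ dec _ \<open>0 < \<eta>\<close>])
    show "continuous_on (annulus r R) (\<lambda>q::quat^'n. ln (norm q))"
      by (intro continuous_intros) (use n0 in auto)
    show "(\<lambda>j. U j q) \<longlonglongrightarrow> ln (norm q)" if "q \<in> annulus r R" for q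
      using lim[of q] n0[OF that] by (simp add: log_norm_def)
  qed simp
qed

text \<open>Each sequence lies between \<open>ln (norm q)\<close> and its first member, and both are
  bounded on the annulus. The index set lets several sequences share one family.\<close>

lemma approx_family_bound:
  fixes U :: "'i \<Rightarrow> nat \<Rightarrow> quat^'n \<Rightarrow> real"
  assumes "finite I" and C: "\<And>i j. i \<in> I \<Longrightarrow> continuous_on UNIV (U i j)" and dec: "\<And>i q. i \<in> I \<Longrightarrow> decseq (\<lambda>j. U i j q)"
    and lim: "\<And>i q. i \<in> I \<Longrightarrow> (\<lambda>j. ereal (U i j q)) \<longlonglongrightarrow> log_norm q" and r: "0 < r"
  shows "\<exists>M. \<forall>u\<in>(\<Union>i\<in>I. range (U i)). \<forall>q\<in>annulus r R. \<bar>u q\<bar> \<le> M"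
proof -
  have n0: "q \<noteq> 0" if "q \<in> annulus r R" for q :: "quat^'n" using that r by (auto simp: annulus_def)
  have bdd: "\<exists>M. \<forall>q\<in>annulus r R. \<bar>g q\<bar> \<le> M" if "continuous_on (annulus r R) g" for g :: "quat^'n \<Rightarrow> real"
    using compact_imp_bounded[OF compact_continuous_image[OF that compact_annulus]] by (auto simp: bounded_iff)
  obtain L where L: "\<And>q::quat^'n. q \<in> annulus r R \<Longrightarrow> \<bar>ln (norm q)\<bar> \<le> L"
  proof -
    have "continuous_on (annulus r R) (\<lambda>q::quat^'n. ln (norm q))"
      by (intro continuous_intros) (use n0 in auto)
    from bdd[OF this] show thesis using that by blast
  qed
  have "\<exists>M. \<forall>q\<in>annulus r R. \<bar>U i 0 q\<bar> \<le> M" if "i \<in> I" for i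
    using bdd continuous_on_subset[OF C[OF that]] by blast
  then obtain B where B: "\<And>i q. i \<in> I \<Longrightarrow> q \<in> annulus r R \<Longrightarrow> \<bar>U i 0 q\<bar> \<le> B i" by metis
  have "\<bar>U i j q\<bar> \<le> \<bar>L\<bar> + (\<Sum>i\<in>I. \<bar>B i\<bar>)" if i: "i \<in> I" and q: "q \<in> annulus r R" for i j q
  proof -
    have "ln (norm q) \<le> U i j q" "U i j q \<le> U i 0 q"
      using log_norm_le_approx(1,2)[OF C[OF i] dec[OF i] lim[OF i]] n0[OF q] by auto
    then have "\<bar>U i j q\<bar> \<le> \<bar>L\<bar> + \<bar>B i\<bar>" using L[OF q] B[OF i q] by linarith
    also have "\<bar>B i\<bar> \<le> (\<Sum>i\<in>I. \<bar>B i\<bar>)" by (rule member_le_sum) (use i assms(1) in auto)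
    finally show ?thesis by simp
  qed
  then show ?thesis by blast
qed

lemma reg_approx:
  shows "continuous_on UNIV (reg j :: quat^'n \<Rightarrow> real)" "decseq (\<lambda>j. reg j (q::quat^'n))"
    "(\<lambda>j. ereal (reg j q)) \<longlonglongrightarrow> log_norm q"
  using Ck_on_imp_continuous[OF smooth_pshD(1)[OF smooth_psh_reg]] log_reg_decreasing_to_log_norm by blast+

lemma mixed_MA_replicate:
  fixes u :: "quat^'n::finite \<Rightarrow> real"
  shows "mixed_MA e (replicate CARD('n) u) q = mixed_MA e (u # replicate (CARD('n) - 1) u) q"
proof -
  have "replicate CARD('n) u = u # replicate (CARD('n) - 1) u"
    using replicate_Suc[of "CARD('n) - 1" u] by simp
  then show ?thesis by simp
qed

text \<open>The cutoff equals 1 near the origin, so the test estimate bounds the mass of the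
  regularisations on a whole ball, pole included, by their size on the annulus between R and R +
  1.\<close>

lemma log_weight_locally_integrable:
  fixes e :: "nat \<Rightarrow> 'n::finite"
  assumes e: "bij_betw e {..<CARD('n)} UNIV" and R: "R > 0"
  shows "integrable lborel (\<lambda>q::quat^'n. cutoff R q * log_weight q)"
proof -
  let ?n = "CARD('n)" and ?F = "\<Union>i\<in>{()}. range (reg :: nat \<Rightarrow> quat^'n \<Rightarrow> real)"
  let ?c = "cutoff R :: quat^'n \<Rightarrow> real"
  define m where "m j = MA_density e (replicate ?n (reg j :: quat^'n \<Rightarrow> real))" for j
  have R0: "R \<ge> 0" using R by simp
  have psh: "smooth_psh u" if "u \<in> ?F" for u using that smooth_psh_reg by auto
  have bd: "\<exists>M. \<forall>u\<in>?F. \<forall>q\<in>annulus r R. \<bar>u q\<bar> \<le> M" if "0 < r" for r R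
    by (rule approx_family_bound) (use reg_approx that in auto)
  have one: "?c q = 1" if "norm q < R" for q by (rule cutoff(3)[OF R0]) (use that in simp)
  have R1: "R + 1 \<ge> 0" using R by simp
  have "\<exists>K\<ge>0. \<forall>w \<eta> us. Ck_on 2 UNIV w \<longrightarrow> (\<forall>q\<in>annulus R (R + 1). \<bar>w q\<bar> \<le> \<eta>) \<longrightarrow> \<eta> \<ge> 0 \<longrightarrow> set us \<subseteq> ?F \<longrightarrow>
     Suc (length us) = ?n \<longrightarrow> \<bar>LINT q|lborel. ?c q * MA_density e (w # us) q\<bar> \<le> \<eta> * K"
    (is "\<exists>K\<ge>0. ?P K")
    by (rule MA_test_estimate[OF e psh bd cutoff(1)[OF R0] cutoff(4)[OF R0] R one R1])
  then obtain K where K: "K \<ge> 0" "?P K" by blast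
  obtain M where M: "\<forall>u\<in>?F. \<forall>q\<in>annulus R (R + 1). \<bar>u q\<bar> \<le> M" using bd[OF R, of "R + 1"] by blast
  have C2: "Ck_on 2 UNIV (reg j :: quat^'n \<Rightarrow> real)" for j by (rule smooth_pshD(1)[OF smooth_psh_reg])
  have bound: "(LINT q|lborel. ?c q * m j q) \<le> max M 0 * K" for j
  proof -
    have "\<bar>LINT q|lborel. ?c q * MA_density e (reg j # replicate (?n - 1) (reg j)) q\<bar> \<le> max M 0 * K"
      by (rule K(2)[rule_format]) (use M C2 in \<open>auto split: if_splits intro: max.coboundedI1 simp del: Ck_on.simps\<close>)
    then show ?thesis unfolding m_def mixed_MA_replicate by linarith
  qed
  have cm: "continuous_on UNIV (m j)" for j
    unfolding m_def by (rule continuous_MA_density) (use C2 in \<open>auto split: if_splits simp del: Ck_on.simps\<close>)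
  have cc: "continuous_on UNIV ?c" by (rule Ck_on_imp_continuous[OF cutoff(1)[OF R0]])
  have im: "integrable lborel (\<lambda>q. ?c q * m j q)" for j
    by (rule integrable_supported[of _ "R + 1"])
       (use cm cc supported_inD[OF cutoff(4)[OF R0]] in \<open>auto simp: supported_in_def intro!: continuous_intros\<close>)
  have m0: "0 \<le> ?c q * m j q" for j q
    unfolding m_def by (intro mult_nonneg_nonneg cutoff(2)[OF R0] MA_reg(3)[OF e])
  have meas: "(\<lambda>q. ?c q * log_weight q) \<in> borel_measurable lborel"
    unfolding log_weight_def using borel_measurable_continuous_onI[OF cc] by simp
  have "(\<integral>\<^sup>+q. ennreal (?c q * log_weight q) \<partial>lborel) = (\<integral>\<^sup>+q. liminf (\<lambda>j. ennreal (?c q * m j q)) \<partial>lborel)"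
  proof (rule nn_integral_cong_AE, rule AE_mp[OF AE_lborel_singleton[of 0]], intro AE_I2 impI)
    fix q :: "quat^'n" assume "q \<noteq> 0"
    then have "(\<lambda>j. ennreal (?c q * m j q)) \<longlonglongrightarrow> ennreal (?c q * log_weight q)"
      unfolding m_def by (intro tendsto_ennrealI tendsto_mult tendsto_const MA_reg(1)[OF e])
    from lim_imp_Liminf[OF sequentially_bot this]
    show "ennreal (?c q * log_weight q) = liminf (\<lambda>j. ennreal (?c q * m j q))" by simp
  qed
  also have "\<dots> \<le> liminf (\<lambda>j. \<integral>\<^sup>+q. ennreal (?c q * m j q) \<partial>lborel)"
    by (rule nn_integral_liminf) (use borel_measurable_integrable[OF im] in simp)
  also have "\<dots> \<le> liminf (\<lambda>j::nat. ennreal (max M 0 * K))"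
    by (intro Liminf_mono always_eventually allI)
       (simp add: nn_integral_eq_integral[OF im] m0 bound ennreal_leI)
  also have "\<dots> = ennreal (max M 0 * K)" by (rule Liminf_const) simp
  finally have fin: "(\<integral>\<^sup>+q. ennreal (?c q * log_weight q) \<partial>lborel) \<le> ennreal (max M 0 * K)" .
  have nn: "norm (?c q * log_weight q) = ?c q * log_weight q" for q
    using cutoff(2)[OF R0, of q] log_weight_nonneg[of q] by simp
  show ?thesis
  proof (rule integrableI_bounded[OF meas])
    show "(\<integral>\<^sup>+q. ennreal (norm (?c q * log_weight q)) \<partial>lborel) < \<infinity>"
      unfolding nn using fin by (simp add: le_less_trans[OF _ ennreal_less_top])
  qed
qed

lemma MA_reg_weak_limit:
  fixes e :: "nat \<Rightarrow> 'n::finite" and \<phi> :: "quat^'n \<Rightarrow> real"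
  assumes e: "bij_betw e {..<CARD('n)} UNIV" and \<phi>: "continuous_on UNIV \<phi>" "supported_in R \<phi>" and R: "R > 0"
  shows "integrable lborel (\<lambda>q. \<phi> q * log_weight q)"
    and "(\<lambda>j. LINT q|lborel. \<phi> q * MA_density e (replicate CARD('n) (reg j)) q) \<longlonglongrightarrow> (LINT q|lborel. \<phi> q * log_weight q)"
proof -
  let ?n = "CARD('n)"
  define m where "m j = MA_density e (replicate ?n (reg j :: quat^'n \<Rightarrow> real))" for j
  have R0: "R \<ge> 0" using R by simp
  obtain B where B: "B \<ge> 0" "\<And>x. norm (\<phi> x) \<le> B" using bounded_supported[OF \<phi>] by blast
  have dom: "\<bar>\<phi> q\<bar> \<le> B * cutoff R q" for q
  proof (cases "norm q \<le> R")
    case True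
    then show ?thesis using B(2)[of q] cutoff(3)[OF R0 True] by simp
  next
    case False
    then have "\<phi> q = 0" using supported_inD[OF \<phi>(2)] by simp
    then show ?thesis using B(1) cutoff(2)[OF R0, of q] by simp
  qed
  have iw: "integrable lborel (\<lambda>q::quat^'n. 2 * B * (cutoff R q * log_weight q))"
    using log_weight_locally_integrable[OF e R] by simp
  have m\<phi>: "\<phi> \<in> borel_measurable borel" using \<phi>(1) by (rule borel_measurable_continuous_onI)
  have meas: "(\<lambda>q. \<phi> q * log_weight q) \<in> borel_measurable lborel"
    unfolding log_weight_def using m\<phi> by simp
  have cm: "continuous_on UNIV (m j)" for j
    unfolding m_def by (rule continuous_MA_density)
      (use smooth_pshD(1)[OF smooth_psh_reg] in \<open>auto split: if_splits simp del: Ck_on.simps\<close>)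
  have le: "norm (\<phi> q * t) \<le> 2 * B * (cutoff R q * log_weight q)" if "0 \<le> t" "t \<le> 2 * log_weight q" for q t
  proof -
    have "norm (\<phi> q * t) = \<bar>\<phi> q\<bar> * t" using that by (simp add: abs_mult)
    also have "\<dots> \<le> (B * cutoff R q) * (2 * log_weight q)"
      by (intro mult_mono dom that mult_nonneg_nonneg B(1) cutoff(2)[OF R0])
    finally show ?thesis by simp
  qed
  show "integrable lborel (\<lambda>q. \<phi> q * log_weight q)"
    by (rule Bochner_Integration.integrable_bound[OF iw meas])
       (intro AE_I2 order_trans[OF le], use log_weight_nonneg in auto)
  have "(\<lambda>j. LINT q|lborel. \<phi> q * m j q) \<longlonglongrightarrow> (LINT q|lborel. \<phi> q * log_weight q)"
  proof (rule integral_dominated_convergence[OF meas _ iw])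
    show "(\<lambda>q. \<phi> q * m j q) \<in> borel_measurable lborel" for j
      using m\<phi> borel_measurable_continuous_onI[OF cm] by simp
    \<comment> \<open>At the origin \<open>log_weight\<close> is 0 through division by zero while
      the densities tend to infinity, so this null set is removed.\<close>
    show "AE q in lborel. (\<lambda>j. \<phi> q * m j q) \<longlonglongrightarrow> \<phi> q * log_weight q"
      by (rule AE_mp[OF AE_lborel_singleton[of 0]], intro AE_I2 impI)
         (simp only: m_def, intro tendsto_mult tendsto_const MA_reg(1)[OF e])
    show "AE q in lborel. norm (\<phi> q * m j q) \<le> 2 * B * (cutoff R q * log_weight q)" for j
      by (rule AE_mp[OF AE_lborel_singleton[of 0]], intro AE_I2 impI le)
         (unfold m_def, rule MA_reg(3)[OF e], erule MA_reg(2)[OF e])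
  qed
  then show "(\<lambda>j. LINT q|lborel. \<phi> q * MA_density e (replicate CARD('n) (reg j)) q) \<longlonglongrightarrow> (LINT q|lborel. \<phi> q * log_weight q)"
    by (simp add: m_def)
qed

section \<open>Arbitrary smooth approximations of the logarithm\<close>

lemma smooth_qpsh_approxD:
  fixes U :: "nat \<Rightarrow> quat^'n \<Rightarrow> real"
  assumes "smooth_qpsh_approx UNIV u U"
  shows "smooth_psh (U j)" "continuous_on UNIV (U j)" "decseq (\<lambda>j. U j q)" "(\<lambda>j. ereal (U j q)) \<longlonglongrightarrow> u q"
proof -
  have C: "Ck_on k UNIV (U j)" for k using assms by (simp add: smooth_qpsh_approx_def smooth_on_def del: Ck_on.simps)
  show "smooth_psh (U j)"
    using assms qpsh_imp_line_laplacian_nonneg[OF C]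
    by (simp add: smooth_psh_def smooth_qpsh_approx_def del: Ck_on.simps)
  show "continuous_on UNIV (U j)" by (rule Ck_on_imp_continuous[OF C])
qed (use assms in \<open>simp_all add: smooth_qpsh_approx_def del: Ck_on.simps\<close>)

lemma MA_test_limit:
  fixes e :: "nat \<Rightarrow> 'n::finite" and U :: "nat \<Rightarrow> quat^'n \<Rightarrow> real"
  assumes e: "bij_betw e {..<CARD('n)} UNIV" and U: "smooth_qpsh_approx UNIV log_norm U"
    and \<phi>: "Ck_on 2 UNIV \<phi>" "supported_in R \<phi>" and r: "r > 0" "\<And>q. norm q < r \<Longrightarrow> \<phi> q = c" and R: "R > 0"
  shows "(\<lambda>j. LINT q|lborel. \<phi> q * MA_density e (replicate CARD('n) (U j)) q) \<longlonglongrightarrow> (LINT q|lborel. \<phi> q * log_weight q)"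
proof -
  note UD = smooth_qpsh_approxD[OF U]
  \<comment> \<open>The given and the explicit approximation are put into one family, because the
    telescoping produces products that mix them.\<close>
  define W :: "bool \<Rightarrow> nat \<Rightarrow> quat^'n \<Rightarrow> real" where "W i = (if i then U else reg)" for i
  let ?F = "\<Union>i\<in>UNIV. range (W i)"
  have W: "continuous_on UNIV (W i j)" "decseq (\<lambda>j. W i j q)" "(\<lambda>j. ereal (W i j q)) \<longlonglongrightarrow> log_norm q" "smooth_psh (W i j)" for i j q
    using UD reg_approx smooth_psh_reg by (auto simp: W_def)
  have psh: "smooth_psh u" if "u \<in> ?F" for u using that W(4) by auto
  have bd: "\<exists>M. \<forall>u\<in>?F. \<forall>q\<in>annulus r R. \<bar>u q\<bar> \<le> M" if "0 < r" for r R
    by (rule approx_family_bound) (use W that in auto)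
  have UF: "U j \<in> ?F" for j by (auto simp: W_def intro!: exI[of _ True])
  have VF: "reg j \<in> ?F" for j by (auto simp: W_def intro!: exI[of _ False])
  have unif: "\<exists>J. \<forall>j\<ge>J. \<forall>q\<in>annulus r R. \<bar>U j q - reg j q\<bar> \<le> \<eta>" if \<eta>: "\<eta> > 0" for \<eta>
  proof -
    obtain J1 where J1: "\<forall>j\<ge>J1. \<forall>q\<in>annulus r R. U j q \<le> ln (norm q) + \<eta>"
      using log_norm_le_approx(3)[OF UD(2-4) r(1) \<eta>] by blast
    obtain J2 where J2: "\<forall>j\<ge>J2. \<forall>q\<in>annulus r R. reg j (q::quat^'n) \<le> ln (norm q) + \<eta>"
      using log_norm_le_approx(3)[OF reg_approx r(1) \<eta>] by blast
    have "\<bar>U j q - reg j q\<bar> \<le> \<eta>" if "j \<ge> max J1 J2" "q \<in> annulus r R" for j q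
    proof -
      have "q \<noteq> 0" using that(2) r(1) by (auto simp: annulus_def)
      then have "ln (norm q) \<le> U j q" "ln (norm q) \<le> reg j q"
        using log_norm_le_approx(1)[OF UD(2-4)] log_norm_le_approx(1)[OF reg_approx] by blast+
      moreover have "U j q \<le> ln (norm q) + \<eta>" "reg j q \<le> ln (norm q) + \<eta>" using J1 J2 that by auto
      ultimately show ?thesis by linarith
    qed
    then show ?thesis by blast
  qed
  have R0: "R \<ge> 0" using R by simp
  have "(\<lambda>j. (LINT q|lborel. \<phi> q * MA_density e (replicate CARD('n) (U j)) q) -
    (LINT q|lborel. \<phi> q * MA_density e (replicate CARD('n) (reg j)) q)) \<longlonglongrightarrow> 0"
    by (rule MA_test_convergence[OF e psh bd \<phi> r R0 UF VF unif])
  from tendsto_add[OF this MA_reg_weak_limit(2)[OF e Ck_on_imp_continuous[OF \<phi>(1)] \<phi>(2) R]]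
  show ?thesis by simp
qed

text \<open>Uniform approximation alone would not do, as \<open>U\<close> has no uniform bound near
  the pole. But the error is at most \<delta> times a cutoff, and the cutoff is itself an admissible
  test function, so its integrals converge and control the error for all large
  \<open>j\<close>.\<close>

lemma MA_weak_limit:
  fixes e :: "nat \<Rightarrow> 'n::finite" and U :: "nat \<Rightarrow> quat^'n \<Rightarrow> real"
  assumes e: "bij_betw e {..<CARD('n)} UNIV" and U: "smooth_qpsh_approx UNIV log_norm U"
    and \<phi>: "continuous_on UNIV \<phi>" "supported_in R \<phi>" and R: "R > 0"
  shows "(\<lambda>j. LINT q|lborel. \<phi> q * MA_density e (replicate CARD('n) (U j)) q) \<longlonglongrightarrow> (LINT q|lborel. \<phi> q * log_weight q)"
proof (rule LIMSEQ_I)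
  fix \<epsilon> :: real assume \<epsilon>: "\<epsilon> > 0"
  let ?n = "CARD('n)" and ?c = "cutoff R :: quat^'n \<Rightarrow> real"
  define m where "m j = MA_density e (replicate ?n (U j))" for j
  have R0: "R \<ge> 0" and R1: "R + 1 > 0" using R by auto
  note UD = smooth_qpsh_approxD[OF U]
  have m0: "0 \<le> m j q" for j q
    unfolding m_def by (rule MA_density_nonneg[OF e]) (use UD(1) in \<open>auto split: if_splits\<close>)
  have cc: "continuous_on UNIV ?c" by (rule Ck_on_imp_continuous[OF cutoff(1)[OF R0]])
  have C2: "Ck_on 2 UNIV u" if "u \<in> set (replicate ?n (U j))" for u j
    using that smooth_pshD(1)[OF UD(1)] by (auto split: if_splits simp del: Ck_on.simps)
  have im: "integrable lborel (\<lambda>q. f q * m j q)" if "continuous_on UNIV f" "supported_in S f" for f S j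
    unfolding m_def by (rule integrable_supported_MA[OF that C2])
  define X where "X f j = (LINT q|lborel. f q * m j q)" for f j
  define L where "L f = (LINT q|lborel. f q * log_weight q)" for f :: "quat^'n \<Rightarrow> real"
  \<comment> \<open>The cutoff integrals are eventually below \<open>L ?c + 1\<close>, so each of
    the two approximation errors is at most \<epsilon>/4; the convergence for \<open>f\<close>
    contributes another \<epsilon>/4.\<close>
  define \<delta> where "\<delta> = \<epsilon> / (4 * (L ?c + 1))"
  have L0: "L ?c \<ge> 0" unfolding L_def
    by (intro Bochner_Integration.integral_nonneg mult_nonneg_nonneg cutoff(2)[OF R0] log_weight_nonneg)
  have \<delta>: "\<delta> > 0" "\<delta> * (L ?c + 1) = \<epsilon> / 4"
  proof -
    have "x / (4 * y) * y = x / 4" if "y > 0" for x y :: real using that by simp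
    from this[of "L ?c + 1" \<epsilon>] show "\<delta> * (L ?c + 1) = \<epsilon> / 4" unfolding \<delta>_def using L0 by linarith
    show "\<delta> > 0" unfolding \<delta>_def using \<epsilon> L0 by (intro divide_pos_pos) auto
  qed
  obtain f r where f: "Ck_on 2 UNIV f" "supported_in (R + 1) f" "r > 0" "\<forall>q. norm q < r \<longrightarrow> f q = f 0"
    "\<forall>q. \<bar>\<phi> q - f q\<bar> \<le> \<delta> * cutoff R q"
    using test_function_approximation[OF \<phi> R \<delta>(1)] by metis
  note cf = Ck_on_imp_continuous[OF f(1)]
  have \<phi>1: "supported_in (R + 1) \<phi>" using \<phi>(2) by (simp add: supported_in_def)
  have "X f \<longlonglongrightarrow> L f"
    unfolding X_def L_def m_def by (rule MA_test_limit[OF e U f(1,2,3) f(4)[rule_format] R1])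
  from LIMSEQ_D[OF this, of "\<epsilon> / 4"] \<epsilon> obtain J1 where J1: "\<And>j. j \<ge> J1 \<Longrightarrow> norm (X f j - L f) < \<epsilon> / 4" by auto
  have one: "?c q = 1" if "norm q < R" for q by (rule cutoff(3)[OF R0]) (use that in simp)
  have "X ?c \<longlonglongrightarrow> L ?c"
    unfolding X_def L_def m_def by (rule MA_test_limit[OF e U cutoff(1)[OF R0] cutoff(4)[OF R0] R one R1])
  from LIMSEQ_D[OF this, of 1] obtain J2 where J2: "\<And>j. j \<ge> J2 \<Longrightarrow> norm (X ?c j - L ?c) < 1" by auto
  have bnd: "\<bar>(LINT q|lborel. \<phi> q * w q) - (LINT q|lborel. f q * w q)\<bar> \<le> \<delta> * (LINT q|lborel. ?c q * w q)"
    if w: "\<And>q. 0 \<le> w q" and i: "integrable lborel (\<lambda>q. \<phi> q * w q)" "integrable lborel (\<lambda>q. f q * w q)" "integrable lborel (\<lambda>q. ?c q * w q)"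
    for w :: "quat^'n \<Rightarrow> real"
  proof -
    have "\<bar>LINT q|lborel. \<phi> q * w q - f q * w q\<bar> \<le> (LINT q|lborel. \<delta> * (?c q * w q))"
    proof (rule integral_abs_bound_integral)
      show "\<bar>\<phi> q * w q - f q * w q\<bar> \<le> \<delta> * (?c q * w q)" for q
      proof -
        have "\<bar>\<phi> q * w q - f q * w q\<bar> = \<bar>\<phi> q - f q\<bar> * w q" using w[of q] by (simp add: abs_mult flip: left_diff_distrib)
        also have "\<dots> \<le> \<delta> * ?c q * w q" using f(5) w by (intro mult_right_mono) auto
        finally show ?thesis by (simp add: mult.assoc)
      qed
    qed (use i in auto)
    then show ?thesis using i by simp
  qed
  have "norm (X \<phi> j - L \<phi>) < \<epsilon>" if j: "j \<ge> max J1 J2" for j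
  proof -
    have a: "\<bar>X \<phi> j - X f j\<bar> \<le> \<delta> * X ?c j"
      unfolding X_def by (rule bnd[OF m0 im[OF \<phi>] im[OF cf f(2)] im[OF cc cutoff(4)[OF R0]]])
    have b: "\<bar>L \<phi> - L f\<bar> \<le> \<delta> * L ?c"
      unfolding L_def by (rule bnd[OF log_weight_nonneg MA_reg_weak_limit(1)[OF e \<phi> R]
        MA_reg_weak_limit(1)[OF e cf f(2) R1] log_weight_locally_integrable[OF e R]])
    have "X ?c j \<le> L ?c + 1" using J2[of j] j by (simp add: abs_less_iff)
    then have a': "\<delta> * X ?c j \<le> \<delta> * (L ?c + 1)" using \<delta>(1) by (intro mult_left_mono) auto
    have b': "\<delta> * L ?c \<le> \<delta> * (L ?c + 1)" using \<delta>(1) by (intro mult_left_mono) auto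
    have "\<bar>X f j - L f\<bar> < \<epsilon> / 4" using J1[of j] j by simp
    then show ?thesis unfolding real_norm_def using a b a' b' \<delta>(2) \<epsilon> by linarith
  qed
  then show "\<exists>J. \<forall>j\<ge>J. norm ((LINT q|lborel. \<phi> q * MA_density e (replicate ?n (U j)) q) - (LINT q|lborel. \<phi> q * log_weight q)) < \<epsilon>"
    unfolding X_def L_def m_def by blast
qed

section \<open>The logarithm and the claimed measure meet the conditions of the definition\<close>

lemma qpsh_log_norm: "qpsh_on UNIV (log_norm :: quat^'n \<Rightarrow> ereal)"
  by (rule qpsh_on_decreasing_limit[where f = reg])
     (use smooth_pshD[OF smooth_psh_reg] reg_approx in \<open>auto simp del: Ck_on.simps\<close>)

lemma smooth_qpsh_approx_reg: "smooth_qpsh_approx UNIV log_norm (reg :: nat \<Rightarrow> quat^'n \<Rightarrow> real)"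
  unfolding smooth_qpsh_approx_def
proof (intro conjI allI ballI)
  show "smooth_on UNIV (reg j :: quat^'n \<Rightarrow> real)" for j
    by (rule smooth_psh_reg[unfolded smooth_psh_def, THEN conjunct1])
  show "qpsh_on UNIV (\<lambda>q::quat^'n. ereal (reg j q))" for j
    by (rule qpsh_on_smooth[OF smooth_pshD[OF smooth_psh_reg]])
qed (rule reg_approx)+

lemma locally_bounded_log_norm: "locally_bounded_on (UNIV - {0}) (log_norm :: quat^'n \<Rightarrow> ereal)"
  unfolding locally_bounded_on_def
proof
  fix x :: "quat^'n" assume "x \<in> UNIV - {0}"
  then have x: "norm x > 0" by simp
  have "continuous_on (annulus (norm x / 2) (2 * norm x)) (\<lambda>q::quat^'n. ln (norm q))"
    by (intro continuous_intros) (use x in \<open>auto simp: annulus_def\<close>)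
  from compact_imp_bounded[OF compact_continuous_image[OF this compact_annulus]]
  obtain M where M: "\<And>q::quat^'n. q \<in> annulus (norm x / 2) (2 * norm x) \<Longrightarrow> \<bar>ln (norm q)\<bar> \<le> M"
    by (auto simp: bounded_iff)
  show "\<exists>V M. open V \<and> x \<in> V \<and> (\<forall>y\<in>V \<inter> (UNIV - {0}). \<bar>log_norm y\<bar> \<le> ereal M)"
  proof (intro exI[of _ "{q. norm x / 2 < norm q \<and> norm q < 2 * norm x}"] exI[of _ M] conjI ballI)
    show "open {q::quat^'n. norm x / 2 < norm q \<and> norm q < 2 * norm x}"
      by (intro open_Collect_conj open_Collect_less continuous_intros)
    fix y :: "quat^'n" assume "y \<in> {q. norm x / 2 < norm q \<and> norm q < 2 * norm x} \<inter> (UNIV - {0})"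
    then show "\<bar>log_norm y\<bar> \<le> ereal M" using M[of y] by (simp add: log_norm_def annulus_def)
  qed (use x in simp)
qed

lemma emeasure_log_weight_finite:
  fixes e :: "nat \<Rightarrow> 'n::finite" and K :: "(quat^'n) set"
  assumes e: "bij_betw e {..<CARD('n)} UNIV" and K: "compact K"
  shows "emeasure (density lborel (\<lambda>q. ennreal (log_weight q))) K < \<infinity>"
proof -
  obtain R where R: "R > 0" "\<And>q. q \<in> K \<Longrightarrow> norm q \<le> R" using compact_imp_bounded[OF K] bounded_pos by metis
  have R0: "R \<ge> 0" using R by simp
  have mw: "(\<lambda>q::quat^'n. ennreal (log_weight q)) \<in> borel_measurable lborel" unfolding log_weight_def by simp
  have "emeasure (density lborel (\<lambda>q. ennreal (log_weight q))) K = (\<integral>\<^sup>+q. ennreal (log_weight q) * indicator K q \<partial>lborel)"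
    by (rule emeasure_density[OF mw]) (use compact_imp_closed[OF K] in simp)
  also have "\<dots> \<le> (\<integral>\<^sup>+q. ennreal (cutoff R q * log_weight q) \<partial>(lborel :: (quat^'n) measure))"
    by (intro nn_integral_mono) (auto simp: indicator_def cutoff(3)[OF R0 R(2)])
  also have "\<dots> = ennreal (LINT q|(lborel :: (quat^'n) measure). cutoff R q * log_weight q)"
    by (rule nn_integral_eq_integral[OF log_weight_locally_integrable[OF e R(1)]])
       (intro AE_I2 mult_nonneg_nonneg cutoff(2)[OF R0] log_weight_nonneg)
  finally show ?thesis by (simp add: le_less_trans[OF _ ennreal_less_top])
qed

theorem proposition5:
  fixes e :: "nat \<Rightarrow> 'n::finite"
  assumes "bij_betw e {..<CARD('n)} UNIV"
  shows "qpsh_on UNIV (log_norm :: quat^'n \<Rightarrow> ereal) \<and>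
    has_MA_measure e UNIV (log_norm :: quat^'n \<Rightarrow> ereal)
      (density lborel (\<lambda>q. ennreal (fact CARD('n) / (2 * norm q ^ (2 * CARD('n))))))"
proof (rule conjI[OF qpsh_log_norm])
  have "has_MA_measure e UNIV (log_norm :: quat^'n \<Rightarrow> ereal) (density lborel (\<lambda>q. ennreal (log_weight q)))"
    unfolding has_MA_measure_def
  proof (intro conjI allI impI)
    show "\<exists>K. compact K \<and> K \<subseteq> UNIV \<and> locally_bounded_on (UNIV - K) (log_norm :: quat^'n \<Rightarrow> ereal)"
      by (intro exI[of _ "{0}"]) (simp add: locally_bounded_log_norm)
    show "emeasure (density lborel (\<lambda>q. ennreal (log_weight q))) K < \<infinity>" if "compact K \<and> K \<subseteq> UNIV" for K :: "(quat^'n) set"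
      using emeasure_log_weight_finite[OF assms] that by blast
    show "\<exists>U. smooth_qpsh_approx UNIV log_norm (U :: nat \<Rightarrow> quat^'n \<Rightarrow> real)"
      using smooth_qpsh_approx_reg by blast
    fix U :: "nat \<Rightarrow> quat^'n \<Rightarrow> real" assume U: "smooth_qpsh_approx UNIV log_norm U"
    have MA: "MA_smooth e (U j) q = MA_density e (replicate CARD('n) (U j)) q" for j q
      by (rule MA_smooth_eq[OF smooth_pshD(1)[OF smooth_qpsh_approxD(1)[OF U]]])
    show "weak_limit_on UNIV (\<lambda>j. MA_smooth e (U j)) (density lborel (\<lambda>q. ennreal (log_weight q)))"
      unfolding weak_limit_on_def
    proof (intro allI impI)
      fix \<phi> :: "quat^'n \<Rightarrow> real"
      assume \<phi>: "continuous_on UNIV \<phi> \<and> compact (closure {q. \<phi> q \<noteq> 0}) \<and> closure {q. \<phi> q \<noteq> 0} \<subseteq> UNIV"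
      obtain R where R: "R > 0" "\<And>q. q \<in> closure {q. \<phi> q \<noteq> 0} \<Longrightarrow> norm q \<le> R"
        using \<phi> compact_imp_bounded bounded_pos by metis
      have "norm q \<le> R" if "\<phi> q \<noteq> 0" for q
        using R(2) that closure_subset[of "{q. \<phi> q \<noteq> 0}"] by blast
      then have supp: "supported_in R \<phi>" unfolding supported_in_def by force
      have "(LINT q|density lborel (\<lambda>q. ennreal (log_weight q)). \<phi> q) = (LINT q|lborel. log_weight q *\<^sub>R \<phi> q)"
        by (rule integral_density)
           (use \<phi> log_weight_nonneg in \<open>auto simp: log_weight_def intro: borel_measurable_continuous_onI\<close>)
      then have "(LINT q|density lborel (\<lambda>q. ennreal (log_weight q)). \<phi> q) = (LINT q|lborel. \<phi> q * log_weight q)"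
        by (simp add: mult.commute)
      then show "(\<lambda>j. LINT q|lborel. \<phi> q * MA_smooth e (U j) q) \<longlonglongrightarrow> (LINT q|density lborel (\<lambda>q. ennreal (log_weight q)). \<phi> q)"
        using MA_weak_limit[OF assms U _ supp R(1)] \<phi> by (simp add: MA)
    qed
  qed (simp_all add: qpsh_log_norm)
  then show "has_MA_measure e UNIV (log_norm :: quat^'n \<Rightarrow> ereal)
      (density lborel (\<lambda>q. ennreal (fact CARD('n) / (2 * norm q ^ (2 * CARD('n))))))"
    unfolding log_weight_def .
qed

end
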